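(* The process $X^q(t)$ describing the FCFS-ALIS parallel queueing model is a continuous-time discrete-state Markov chain. It is ergodic if and only if $\lambda_C<\mu_{\mathcal{S}(C)}$ for every nonempty $C\subseteq\mathcal{C}$. Its stationary distribution is given, up to a normalizing constant, by $$P^q(c^1,\dots,c^L,s^1,\dots,s^K)\ \propto\ \prod_{\ell=1}^L\frac{\lambda_{c^\ell}}{\mu_{\mathcal{S}(\{c^1,\dots,c^\ell\})}}\ \prod_{k=1}^K\frac{\mu_{s^k}}{\lambda_{\mathcal{C}(\{s^1,\dots,s^k\})}} .$$
   Context: Customer types are $\mathcal{C}=\{c_1,\dots,c_I\}$, server types are $\mathcal{S}=\{s_1,\dots,s_J\}$, and $\mathfrak{E}\subseteq\mathcal{S}\times\mathcal{C}$ is a compatibility relation; $(s_j,c_i)\in\mathfrak{E}$ means $s_j$ can serve $c_i$. $\mathcal{S}(c_i)$ is the set of server types compatible with $c_i$, $\mathcal{C}(s_j)$ the set of customer types compatible with $s_j$; $\mathcal{S}(C)=\bigcup_{c\in C}\mathcal{S}(c)$, $\mathcal{C}(S)=\bigcup_{s\in S}\mathcal{C}(s)$. Every server type is compatible with at least one customer type. Rates $\lambda_{c_i}>0$, $\mu_{s_j}>0$ are given; $\lambda_C=\sum_{c\in C}\lambda_c$, $\mu_S=\sum_{s\in S}\mu_s$. Ergodic means irreducible and positive recurrent. Empty products equal $1$. FCFS-ALIS model: customers of type $c_i$ arrive in independent Poisson streams of rates $\lambda_{c_i}$. There are $J$ servers $s_1,\dots,s_J$; service by $s_j$ is exponential with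 rate $\mu_{s_j}$, all service times independent of each other and of arrivals. An arriving customer is immediately assigned to the compatible server that has been idle longest, if some compatible server is idle; otherwise it joins a single queue. A server completing a service starts serving the longest waiting compatible customer if there is one, otherwise it becomes idle. $X^q(t)=(c^1,\dots,c^L,s^1,\dots,s^K)$, where $c^1,\dots,c^L$ are the types of the customers waiting at time $t$ (not yet in service) ordered by arrival (oldest first), and $s^1,\dots,s^K$ are the servers idle at time $t$ ordered by idle time (longest idle first). The states are such lists ($L\ge 0$, $0\le K\le J$) in which the idle servers are distinct and each idle server is incompatible with each waiting customer. *)

theory Defs
  imports "HOL-Probability.Probability"
begin

section \<open>Continuous-time Markov chains on a countable state space\<close>

definition transition_function :: "'x set \<Rightarrow> (real \<Rightarrow> 'x \<Rightarrow> 'x \<Rightarrow> real) \<Rightarrow> bool" where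
  "transition_function S P \<longleftrightarrow>
     (\<forall>t\<ge>0. \<forall>x\<in>S. \<forall>y\<in>S. 0 \<le> P t x y) \<and>
     (\<forall>t\<ge>0. \<forall>x\<in>S. (P t x has_sum 1) S) \<and>
     (\<forall>x\<in>S. \<forall>y\<in>S. P 0 x y = of_bool (x = y)) \<and>
     (\<forall>s\<ge>0. \<forall>t\<ge>0. \<forall>x\<in>S. \<forall>y\<in>S. ((\<lambda>z. P s x z * P t z y) has_sum P (s + t) x y) S) \<and>
     (\<forall>x\<in>S. \<forall>y\<in>S. ((\<lambda>t. P t x y) \<longlongrightarrow> of_bool (x = y)) (at_right 0))"

text \<open>Only the values of \<^term>\<open>X t\<close> and \<^term>\<open>P t\<close> for nonnegative \<^term>\<open>t\<close> matter.
  The state space carries the discrete topology, so right-continuity of a path means that the path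
  stays constant for a while after each time.\<close>

definition markov_chain ::
  "'w measure \<Rightarrow> 'x set \<Rightarrow> (real \<Rightarrow> 'x \<Rightarrow> 'x \<Rightarrow> real) \<Rightarrow> (real \<Rightarrow> 'w \<Rightarrow> 'x) \<Rightarrow> bool" where
  "markov_chain M S P X \<longleftrightarrow>
     prob_space M \<and> countable S \<and> transition_function S P \<and>
     (\<forall>t\<ge>0. X t \<in> measurable M (count_space S)) \<and>
     (AE \<omega> in M. \<forall>t\<ge>0. \<exists>\<epsilon>>0. \<forall>u\<in>{t..<t + \<epsilon>}. X u \<omega> = X t \<omega>) \<and>
     (\<forall>(n::nat) (t :: nat \<Rightarrow> real) (x :: nat \<Rightarrow> 'x).
        0 \<le> t 0 \<longrightarrow> (\<forall>i\<le>n. t i < t (Suc i)) \<longrightarrow> (\<forall>i\<le>Suc n. x i \<in> S) \<longrightarrow>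
        \<P>(\<omega> in M. \<forall>i\<le>n. X (t i) \<omega> = x i) \<noteq> 0 \<longrightarrow>
        \<P>(\<omega> in M. X (t (Suc n)) \<omega> = x (Suc n) \<bar> \<forall>i\<le>n. X (t i) \<omega> = x i)
          = P (t (Suc n) - t n) (x n) (x (Suc n)))"

text \<open>In the following, \<^term>\<open>X x\<close> is the process started in state \<^term>\<open>x\<close>.\<close>

definition transition_prob ::
  "'w measure \<Rightarrow> ('x \<Rightarrow> real \<Rightarrow> 'w \<Rightarrow> 'x) \<Rightarrow> real \<Rightarrow> 'x \<Rightarrow> 'x \<Rightarrow> real" where
  "transition_prob M X t x y = \<P>(\<omega> in M. X x t \<omega> = y)"

definition irreducible_chain :: "'x set \<Rightarrow> (real \<Rightarrow> 'x \<Rightarrow> 'x \<Rightarrow> real) \<Rightarrow> bool" where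
  "irreducible_chain S P \<longleftrightarrow> (\<forall>x\<in>S. \<forall>y\<in>S. \<exists>t\<ge>0. 0 < P t x y)"

text \<open>The first time at which the path \<^term>\<open>f\<close> is in \<^term>\<open>x\<close> after having left \<^term>\<open>x\<close>;
  it is infinite if there is no such time.\<close>

definition return_time :: "(real \<Rightarrow> 'x) \<Rightarrow> 'x \<Rightarrow> ennreal" where
  "return_time f x = Inf {ennreal t | t. 0 \<le> t \<and> f t = x \<and> (\<exists>u. 0 \<le> u \<and> u < t \<and> f u \<noteq> x)}"

text \<open>By the usual convention an absorbing state counts as positive recurrent.\<close>

definition positive_recurrent :: "'w measure \<Rightarrow> ('x \<Rightarrow> real \<Rightarrow> 'w \<Rightarrow> 'x) \<Rightarrow> 'x \<Rightarrow> bool" where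
  "positive_recurrent M X x \<longleftrightarrow>
     (AE \<omega> in M. \<forall>t\<ge>0. X x t \<omega> = x) \<or>
     (\<integral>\<^sup>+\<omega>. return_time (\<lambda>t. X x t \<omega>) x \<partial>M) < \<infinity>"

definition ergodic :: "'w measure \<Rightarrow> 'x set \<Rightarrow> ('x \<Rightarrow> real \<Rightarrow> 'w \<Rightarrow> 'x) \<Rightarrow> bool" where
  "ergodic M S X \<longleftrightarrow>
     irreducible_chain S (transition_prob M X) \<and> (\<forall>x\<in>S. positive_recurrent M X x)"

definition stationary_distribution ::
  "'x set \<Rightarrow> (real \<Rightarrow> 'x \<Rightarrow> 'x \<Rightarrow> real) \<Rightarrow> ('x \<Rightarrow> real) \<Rightarrow> bool" where
  "stationary_distribution S P \<pi> \<longleftrightarrow>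
     (\<forall>x\<in>S. 0 \<le> \<pi> x) \<and> (\<pi> has_sum 1) S \<and>
     (\<forall>t\<ge>0. \<forall>y\<in>S. ((\<lambda>x. \<pi> x * P t x y) has_sum \<pi> y) S)"


section \<open>The FCFS-ALIS parallel queueing model\<close>

text \<open>Customer types are the elements of a finite type \<open>'c\<close>, servers those of a finite type \<open>'s\<close>.
  The compatibility relation \<open>E\<close> contains \<open>(s, c)\<close> if server \<open>s\<close> can serve customers of type \<open>c\<close>.\<close>

definition servers_of :: "('s \<times> 'c) set \<Rightarrow> 'c set \<Rightarrow> 's set" where
  "servers_of E C = (\<Union>c\<in>C. {s. (s, c) \<in> E})"

definition customers_of :: "('s \<times> 'c) set \<Rightarrow> 's set \<Rightarrow> 'c set" where
  "customers_of E S = (\<Union>s\<in>S. {c. (s, c) \<in> E})"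

text \<open>A state consists of the types of the waiting customers, oldest first, and of the idle servers,
  longest idle first. All servers that are not listed are busy.\<close>

type_synonym ('c, 's) state = "'c list \<times> 's list"

definition states :: "('s \<times> 'c) set \<Rightarrow> ('c, 's) state set" where
  "states E = {(w, i). distinct i \<and> (\<forall>s\<in>set i. \<forall>c\<in>set w. (s, c) \<notin> E)}"

datatype ('c, 's) event = Arrival 'c | Completion 's

text \<open>\<^term>\<open>List.extract\<close> takes the first element with the given property out of a list: by the
  order of the lists this is the longest idle compatible server (ALIS), respectively the longest
  waiting compatible customer (FCFS).\<close>

fun next_state :: "('s \<times> 'c) set \<Rightarrow> ('c, 's) event \<Rightarrow> ('c, 's) state \<Rightarrow> ('c, 's) state" where
  "next_state E (Arrival c) (w, i) =
     (case List.extract (\<lambda>s. (s, c) \<in> E) i of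
        None \<Rightarrow> (w @ [c], i)
      | Some (i1, s, i2) \<Rightarrow> (w, i1 @ i2))"
| "next_state E (Completion s) (w, i) =
     (case List.extract (\<lambda>c. (s, c) \<in> E) w of
        None \<Rightarrow> (w, i @ [s])
      | Some (w1, c, w2) \<Rightarrow> (w1 @ w2, i))"

text \<open>In a configuration \<open>(x, a, b)\<close> the sequence \<open>a c\<close> consists of the residual time until the next
  arrival of type \<open>c\<close>, followed by the later interarrival times of type \<open>c\<close>. For a busy server \<open>s\<close>, the
  sequence \<open>b s\<close> consists of the residual time of the service in progress, followed by the durations
  of the later services of \<open>s\<close>; for an idle server it consists of the durations of its future
  services.\<close>

type_synonym ('c, 's) config = "('c, 's) state \<times> ('c \<Rightarrow> nat \<Rightarrow> real) \<times> ('s \<Rightarrow> nat \<Rightarrow> real)"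

fun event_time :: "('c, 's) config \<Rightarrow> ('c, 's) event \<Rightarrow> real" where
  "event_time (x, a, b) (Arrival c) = a c 0"
| "event_time (x, a, b) (Completion s) = b s 0"

fun possible_events :: "('c, 's) config \<Rightarrow> ('c, 's) event set" where
  "possible_events ((w, i), a, b) = range Arrival \<union> Completion ` (- set i)"

text \<open>Ties have probability zero and are resolved arbitrarily.\<close>

definition next_event :: "('c, 's) config \<Rightarrow> ('c, 's) event" where
  "next_event k = arg_min_on (event_time k) (possible_events k)"

definition time_to_event :: "('c, 's) config \<Rightarrow> real" where
  "time_to_event k = event_time k (next_event k)"

definition elapse :: "real \<Rightarrow> (nat \<Rightarrow> real) \<Rightarrow> nat \<Rightarrow> real" where
  "elapse d f = f(0 := f 0 - d)"

fun next_config :: "('s \<times> 'c) set \<Rightarrow> ('c, 's) config \<Rightarrow> ('c, 's) config" where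
  "next_config E ((w, i), a, b) =
     (let e = next_event ((w, i), a, b);
          d = time_to_event ((w, i), a, b)
      in (next_state E e (w, i),
          (\<lambda>c. if e = Arrival c then (\<lambda>n. a c (Suc n)) else elapse d (a c)),
          (\<lambda>s. if s \<in> set i then b s
               else if e = Completion s then (\<lambda>n. b s (Suc n))
               else elapse d (b s))))"

definition config_after :: "('s \<times> 'c) set \<Rightarrow> ('c, 's) config \<Rightarrow> nat \<Rightarrow> ('c, 's) config" where
  "config_after E k n = (next_config E ^^ n) k"

definition epoch :: "('s \<times> 'c) set \<Rightarrow> ('c, 's) config \<Rightarrow> nat \<Rightarrow> real" where
  "epoch E k n = (\<Sum>m<n. time_to_event (config_after E k m))"

text \<open>\<open>A c n\<close> are the interarrival times of the customers of type \<open>c\<close>, and \<open>B s n\<close> the service times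
  of server \<open>s\<close>. At time \<open>0\<close> the process is in state \<open>x\<close>, and the servers that are busy in \<open>x\<close> start
  their service. The state at time \<open>t\<close> is the one reached by the last event up to time \<open>t\<close>.\<close>

definition fcfs_alis ::
  "('s \<times> 'c) set \<Rightarrow> ('c \<Rightarrow> nat \<Rightarrow> 'w \<Rightarrow> real) \<Rightarrow> ('s \<Rightarrow> nat \<Rightarrow> 'w \<Rightarrow> real) \<Rightarrow>
   ('c, 's) state \<Rightarrow> real \<Rightarrow> 'w \<Rightarrow> ('c, 's) state" where
  "fcfs_alis E A B x t \<omega> =
     (let k = (x, (\<lambda>c n. A c n \<omega>), (\<lambda>s n. B s n \<omega>))
      in fst (config_after E k (LEAST n. t < epoch E k (Suc n))))"

definition product_form ::
  "('s \<times> 'c) set \<Rightarrow> ('c \<Rightarrow> real) \<Rightarrow> ('s \<Rightarrow> real) \<Rightarrow> ('c, 's) state \<Rightarrow> real" where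
  "product_form E lam mu = (\<lambda>(w, i).
     (\<Prod>l<length w. lam (w ! l) / sum mu (servers_of E (set (take (Suc l) w)))) *
     (\<Prod>k<length i. mu (i ! k) / sum lam (customers_of E (set (take (Suc k) i)))))"

end

theory Submission
  imports Defs
begin

text \<open>By the lack of memory of exponential clocks, the type and the time of the first event and the
  residual clocks are independent, and the residual clocks are distributed like the original ones.
  This gives the Markov property at fixed times, and it reduces the recurrence of the process to that
  of the embedded jump chain, because the total event rates lie between two positive constants.

  The product form solves the balance equations: the states from which a given state is entered by
  matching a customer with a server arise from inserting that server (or customer) into one of its
  two lists, and the corresponding sum of weights telescopes. Hence the product form multiplied by
  the total rates is invariant for the jump chain, and the mean return times are finite if and only
  if the product form is summable. Along lists of customers whose set of types is \<open>C\<close>, the weights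
  grow like powers of \<open>\<lambda>\<^sub>C / \<mu>\<^sub>S\<^sub>(\<^sub>C\<^sub>)\<close>, so that summability is equivalent to the load condition.

  The balance equations make the product form stationary up to an error of order \<open>h\<^sup>2\<close> over a time
  step \<open>h\<close>, hence stationary. For another stationary distribution \<open>\<pi>\<close>, the minimum \<open>w\<close> of the two is
  invariant as well, and by irreducibility \<open>\<pi> - w\<close> vanishes nowhere or everywhere.\<close>

text \<open>The transition probabilities are those of the constructed path, so there is no generator
  to start from. Everything rests on one conditioning step, on the first event of a configuration
  with fresh clocks; induction on the number of events carries it to fixed times and to excursions.
  Laplace transforms of the jump times exclude explosion.

  Only servers are assumed to have a partner. That every customer type has one, which makes the
  denominators positive, is derived from irreducibility in one direction and from the load condition
  in the other.

  Stationarity of the product form and invariance of a minimum both come from an inequality alone: a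
  finite measure that a mass-preserving kernel increases nowhere is invariant. So upper bounds for
  short times suffice.

  Sums over states are integrals in \<open>ennreal\<close> over the counting measure of the whole
  type; they may then be interchanged freely.\<close>

abbreviation sum_all :: "('x \<Rightarrow> ennreal) \<Rightarrow> ennreal" (binder "\<S>" 10) where
  "sum_all f \<equiv> nn_integral (count_space UNIV) f"

lemma UNIV_event: "(UNIV :: ('c, 's) event set) = range Arrival \<union> range Completion"
proof (intro set_eqI iffI UNIV_I)
  show "e \<in> range Arrival \<union> range Completion" for e :: "('c, 's) event"
    by (cases e) auto
qed

instance event :: (finite, finite) finite
proof
  show "finite (UNIV :: ('a, 'b) event set)"
    unfolding UNIV_event by simp
qed

section \<open>Exponential clocks\<close>

text \<open>A product measure is integrated by drawing coordinate \<open>j\<close> first; the others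
  are read off a fresh sample through the injection \<open>f\<close>. With \<open>f\<close> the
  identity this is Fubini for one clock; with \<open>f\<close> the shift within one sequence it says
  that an i.i.d. sequence without its head has its original law.\<close>

lemma nn_integral_PiM_split:
  fixes M :: "'i \<Rightarrow> 'a measure" and f :: "'i \<Rightarrow> 'i"
  assumes M: "\<And>i. prob_space (M i)"
    and f: "inj_on f (- {j})" and Mf: "\<And>i. i \<noteq> j \<Longrightarrow> M (f i) = M i"
    and H: "H \<in> borel_measurable (PiM UNIV M)"
  shows "(\<integral>\<^sup>+ \<kappa>. H \<kappa> \<partial>PiM UNIV M) =
    (\<integral>\<^sup>+ T. \<integral>\<^sup>+ \<kappa>. H (\<lambda>i. if i = j then T else \<kappa> (f i)) \<partial>PiM UNIV M \<partial>M j)"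
proof -
  have ins: "insert j (- {j}) = UNIV" by auto
  interpret K: prob_space "PiM UNIV M" using M by (intro prob_space_PiM) auto
  interpret R: prob_space "PiM (- {j}) M" using M by (intro prob_space_PiM) auto
  interpret Mj: prob_space "M j" using M by auto
  interpret P: pair_sigma_finite "M j" "PiM (- {j}) M" ..
  have m1[measurable]: "(\<lambda>(x, X). X(j := x)) \<in> measurable (M j \<Otimes>\<^sub>M PiM (- {j}) M) (PiM UNIV M)"
  proof (rule measurable_PiM_single')
    fix i
    have fst: "fst \<in> measurable (M j \<Otimes>\<^sub>M PiM (- {j}) M) (M j)"
      by (rule measurable_fst)
    show "(\<lambda>\<omega>. (case \<omega> of (x, X) \<Rightarrow> X(j := x)) i) \<in> measurable (M j \<Otimes>\<^sub>M PiM (- {j}) M) (M i)"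
    proof (cases "i = j")
      case True
      have "(\<lambda>\<omega>. (case \<omega> of (x, X) \<Rightarrow> X(j := x)) i) = fst"
        using True by (auto simp: fun_eq_iff)
      then show ?thesis using fst True by metis
    next
      case False
      have eq: "(\<lambda>\<omega>. (case \<omega> of (x, X) \<Rightarrow> X(j := x)) i) = (\<lambda>\<omega>. snd \<omega> i)"
        using False by (auto simp: fun_eq_iff)
      have "(\<lambda>\<omega>. snd \<omega> i) \<in> measurable (M j \<Otimes>\<^sub>M PiM (- {j}) M) (M i)"
        by (rule measurable_compose[OF measurable_snd measurable_component_singleton]) (simp add: False)
      then show ?thesis unfolding eq .
    qed
  next
    show "(\<lambda>(x, X). X(j := x)) \<in> space (M j \<Otimes>\<^sub>M PiM (- {j}) M) \<rightarrow> (\<Pi>\<^sub>E i\<in>UNIV. space (M i))"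
    proof
      fix z assume "z \<in> space (M j \<Otimes>\<^sub>M PiM (- {j}) M)"
      then show "(case z of (x, X) \<Rightarrow> X(j := x)) \<in> (\<Pi>\<^sub>E i\<in>UNIV. space (M i))"
        by (cases z) (auto simp: space_pair_measure space_PiM PiE_iff)
    qed
  qed
  have eq1: "PiM UNIV M = distr (M j \<Otimes>\<^sub>M PiM (- {j}) M) (PiM UNIV M) (\<lambda>(x, X). X(j := x))"
    by (rule distr_pair_PiM_eq_PiM[of "- {j}" M j, unfolded ins, OF M M, symmetric])
  have PM: "PiM (- {j}) (\<lambda>i. M (f i)) = PiM (- {j}) M"
    by (rule PiM_cong) (auto simp: Mf)
  have eq2: "distr (PiM UNIV M) (PiM (- {j}) M) (\<lambda>\<omega>. \<lambda>n\<in>- {j}. \<omega> (f n)) = PiM (- {j}) M"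
    by (rule distr_PiM_reindex[of UNIV M f "- {j}", unfolded PM, OF M f]) simp
  have m2: "(\<lambda>\<omega>. \<lambda>n\<in>- {j}. \<omega> (f n)) \<in> measurable (PiM UNIV M) (PiM (- {j}) M)"
    unfolding PM[symmetric] by (intro measurable_restrict measurable_component_singleton) auto
  have H': "(\<lambda>X. H (X(j := T))) \<in> borel_measurable (PiM (- {j}) M)" if "T \<in> space (M j)" for T
    using measurable_compose[OF measurable_Pair1'[OF that] measurable_compose[OF m1 H]]
    unfolding prod.case .
  have "(\<integral>\<^sup>+ \<kappa>. H \<kappa> \<partial>PiM UNIV M) = (\<integral>\<^sup>+ z. H ((\<lambda>(x, X). X(j := x)) z) \<partial>(M j \<Otimes>\<^sub>M PiM (- {j}) M))"
    by (subst eq1) (rule nn_integral_distr[OF m1], simp add: H)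
  also have "\<dots> = (\<integral>\<^sup>+ T. \<integral>\<^sup>+ X. H (X(j := T)) \<partial>PiM (- {j}) M \<partial>M j)"
    using R.nn_integral_fst[OF measurable_compose[OF m1 H], symmetric] unfolding prod.case .
  also have "\<dots> = (\<integral>\<^sup>+ T. \<integral>\<^sup>+ \<kappa>. H (\<lambda>i. if i = j then T else \<kappa> (f i)) \<partial>PiM UNIV M \<partial>M j)"
  proof (rule nn_integral_cong)
    fix T assume T: "T \<in> space (M j)"
    have "(\<integral>\<^sup>+ X. H (X(j := T)) \<partial>PiM (- {j}) M) =
      (\<integral>\<^sup>+ X. H (X(j := T)) \<partial>distr (PiM UNIV M) (PiM (- {j}) M) (\<lambda>\<omega>. \<lambda>n\<in>- {j}. \<omega> (f n)))"
      by (simp add: eq2)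
    also have "\<dots> = (\<integral>\<^sup>+ \<kappa>. H ((\<lambda>n\<in>- {j}. \<kappa> (f n))(j := T)) \<partial>PiM UNIV M)"
      by (rule nn_integral_distr[OF m2]) (simp add: H'[OF T])
    also have "\<dots> = (\<integral>\<^sup>+ \<kappa>. H (\<lambda>i. if i = j then T else \<kappa> (f i)) \<partial>PiM UNIV M)"
      by (intro nn_integral_cong arg_cong[where f=H]) (auto simp: fun_eq_iff)
    finally show "(\<integral>\<^sup>+ X. H (X(j := T)) \<partial>PiM (- {j}) M) = \<dots>" .
  qed
  finally show ?thesis .
qed

abbreviation exp_law :: "real \<Rightarrow> real measure" where
  "exp_law r \<equiv> density lborel (\<lambda>x. ennreal (exponential_density r x))"

lemma prob_space_exp_law: "0 < r \<Longrightarrow> prob_space (exp_law r)"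
  by (rule prob_space_exponential_density)

lemma nn_integral_exp_law:
  "f \<in> borel_measurable borel \<Longrightarrow>
    (\<integral>\<^sup>+ y. f y \<partial>exp_law r) = (\<integral>\<^sup>+ y. ennreal (exponential_density r y) * f y \<partial>lborel)"
  by (subst nn_integral_density) auto

text \<open>Substitute \<open>t + y\<close> for \<open>y\<close>: the density at
  \<open>t + y\<close> is \<open>exp (- r * t)\<close> times the density at
  \<open>y\<close>.\<close>

lemma exp_law_memoryless:
  assumes r: "0 < r" and t: "0 \<le> t" and f[measurable]: "f \<in> borel_measurable borel"
  shows "(\<integral>\<^sup>+ y. indicator {t<..} y * f (y - t) \<partial>exp_law r) =
    ennreal (exp (- r * t)) * (\<integral>\<^sup>+ y. f y \<partial>exp_law r)"
proof -
  have "(\<integral>\<^sup>+ y. indicator {t<..} y * f (y - t) \<partial>exp_law r) =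
    (\<integral>\<^sup>+ y. ennreal (exponential_density r y) * (indicator {t<..} y * f (y - t)) \<partial>lborel)"
    by (subst nn_integral_exp_law) auto
  also have "\<dots> = (\<integral>\<^sup>+ y. ennreal (exponential_density r (t + y)) * (indicator {t<..} (t + y) * f y) \<partial>lborel)"
    by (subst nn_integral_real_affine[where c=1 and t=t]) auto
  also have "\<dots> = (\<integral>\<^sup>+ y. ennreal (exp (- r * t)) * (ennreal (exponential_density r y) * f y) \<partial>lborel)"
  proof (rule nn_integral_cong_AE)
    show "AE y in lborel. ennreal (exponential_density r (t + y)) * (indicator {t<..} (t + y) * f y) =
       ennreal (exp (- r * t)) * (ennreal (exponential_density r y) * f y)"
      \<comment> \<open>At \<open>y = 0\<close> the strict indicator vanishes while the density does
        not, hence the exceptional null set.\<close>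
      using AE_lborel_singleton[of "0::real"]
    proof eventually_elim
      fix y :: real assume "y \<noteq> 0"
      show "ennreal (exponential_density r (t + y)) * (indicator {t<..} (t + y) * f y) =
        ennreal (exp (- r * t)) * (ennreal (exponential_density r y) * f y)"
      proof (cases "y < 0")
        case False
        then have "exponential_density r (t + y) = exp (- r * t) * exponential_density r y"
          using t by (auto simp: exponential_density_def exp_add[symmetric] algebra_simps)
        then show ?thesis using False \<open>y \<noteq> 0\<close> r
          by (auto simp: ennreal_mult exponential_density_nonneg mult.assoc)
      qed (auto simp: exponential_density_def)
    qed
  qed
  also have "\<dots> = ennreal (exp (- r * t)) * (\<integral>\<^sup>+ y. f y \<partial>exp_law r)"
    by (subst nn_integral_cmult) (auto simp: nn_integral_exp_law)
  finally show ?thesis .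
qed

lemma exp_law_AE_pos: "AE y in exp_law r. 0 \<le> y"
  by (subst AE_density) (auto simp: exponential_density_def)

lemma exp_law_AE_neq: "AE y in exp_law r. y \<noteq> T"
  using AE_lborel_singleton[of T] by (subst AE_density) auto

section \<open>Configurations driven by clock vectors\<close>

definition enabled :: "('c, 's) state \<Rightarrow> ('c, 's) event set" where
  "enabled x = range Arrival \<union> Completion ` (- set (snd x))"

text \<open>One family indexed by events and numbers replaces the two families in
  \<open>config\<close>, so that its law is a single product measure and arrivals and services are
  treated alike.\<close>

type_synonym ('c, 's) clocks = "('c, 's) event \<times> nat \<Rightarrow> real"

type_synonym ('c, 's) timed = "('c, 's) state \<times> ('c, 's) clocks"

definition config_of :: "('c, 's) timed \<Rightarrow> ('c, 's) config" where
  "config_of = (\<lambda>(x, \<kappa>). (x, \<lambda>c n. \<kappa> (Arrival c, n), \<lambda>s n. \<kappa> (Completion s, n)))"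

definition first_event :: "('c, 's) timed \<Rightarrow> ('c, 's) event" where
  "first_event = (\<lambda>(x, \<kappa>). arg_min_on (\<lambda>e. \<kappa> (e, 0)) (enabled x))"

definition holding :: "('c, 's) timed \<Rightarrow> real" where
  "holding = (\<lambda>(x, \<kappa>). \<kappa> (first_event (x, \<kappa>), 0))"

text \<open>The clock of an idle server does not run, which is why events that are not enabled keep
  theirs.\<close>

definition residual :: "('c, 's) state \<Rightarrow> ('c, 's) event \<Rightarrow> ('c, 's) clocks \<Rightarrow> ('c, 's) clocks" where
  "residual x e \<kappa> = (\<lambda>(e', n).
     if e' \<notin> enabled x then \<kappa> (e', n) else if e' = e then \<kappa> (e, Suc n)
     else if n = 0 then \<kappa> (e', 0) - \<kappa> (e, 0) else \<kappa> (e', n))"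

definition after_event ::
  "('s \<times> 'c) set \<Rightarrow> ('c, 's) timed \<Rightarrow> ('c, 's) timed" where
  "after_event E = (\<lambda>(x, \<kappa>).
     (next_state E (first_event (x, \<kappa>)) x, residual x (first_event (x, \<kappa>)) \<kappa>))"

lemma event_time_config_of: "event_time (config_of (x, \<kappa>)) = (\<lambda>e. \<kappa> (e, 0))"
proof
  show "event_time (config_of (x, \<kappa>)) e = \<kappa> (e, 0)" for e
    by (cases e) (auto simp: config_of_def)
qed

lemma possible_events_config_of: "possible_events (config_of (x, \<kappa>)) = enabled x"
  by (cases x) (auto simp: config_of_def enabled_def)

lemma next_event_config_of: "next_event (config_of k) = first_event k"
  by (cases k) (simp add: next_event_def event_time_config_of possible_events_config_of first_event_def)

lemma time_to_event_config_of: "time_to_event (config_of k) = holding k"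
  by (cases k) (simp add: time_to_event_def event_time_config_of next_event_config_of holding_def)

lemma finite_enabled[simp]: "finite (enabled (x :: ('c::finite, 's::finite) state))"
  by simp

lemma Arrival_enabled[simp]: "Arrival c \<in> enabled x"
  by (auto simp: enabled_def)

lemma Completion_enabled[simp]: "Completion s \<in> enabled x \<longleftrightarrow> s \<notin> set (snd x)"
  by (auto simp: enabled_def)

lemma enabled_nonempty[simp]: "enabled x \<noteq> {}"
  by (auto simp: enabled_def)

lemma first_event_enabled[simp]: "first_event (x :: ('c::finite, 's::finite) state, \<kappa>) \<in> enabled x"
  unfolding first_event_def prod.case by (rule arg_min_if_finite) auto

lemma first_event_least:
  "e \<in> enabled (x :: ('c::finite, 's::finite) state) \<Longrightarrow> \<kappa> (first_event (x, \<kappa>), 0) \<le> \<kappa> (e, 0)"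
  unfolding first_event_def prod.case by (rule arg_min_least) auto

lemma next_config_config_of:
  fixes k :: "('c::finite, 's::finite) timed"
  shows "next_config E (config_of k) = config_of (after_event E k)"
proof -
  obtain w i \<kappa> where k: "k = ((w, i), \<kappa>)" by (metis prod.collapse)
  have c: "config_of k = ((w, i), \<lambda>c n. \<kappa> (Arrival c, n), \<lambda>s n. \<kappa> (Completion s, n))"
    by (simp add: k config_of_def)
  show ?thesis
    unfolding c next_config.simps Let_def unfolding c[symmetric] next_event_config_of time_to_event_config_of
    unfolding k config_of_def after_event_def
    by (auto simp: fun_eq_iff residual_def elapse_def holding_def)
qed

lemma config_after_config_of:
  fixes k :: "('c::finite, 's::finite) timed"
  shows "config_after E (config_of k) n = config_of ((after_event E ^^ n) k)"
  unfolding config_after_def by (induct n) (auto simp: next_config_config_of)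

definition jump_time ::
  "('s \<times> 'c) set \<Rightarrow> ('c, 's) timed \<Rightarrow> nat \<Rightarrow> real" where
  "jump_time E k n = (\<Sum>m<n. holding ((after_event E ^^ m) k))"

definition jump_index ::
  "('s \<times> 'c) set \<Rightarrow> real \<Rightarrow> ('c, 's) timed \<Rightarrow> nat" where
  "jump_index E t k = (LEAST n. t < jump_time E k (Suc n))"

definition state_at ::
  "('s \<times> 'c) set \<Rightarrow> real \<Rightarrow> ('c, 's) timed \<Rightarrow> ('c, 's) state" where
  "state_at E t k = fst ((after_event E ^^ jump_index E t k) k)"

lemma epoch_config_of:
  fixes k :: "('c::finite, 's::finite) timed"
  shows "epoch E (config_of k) n = jump_time E k n"
  by (simp add: epoch_def jump_time_def config_after_config_of time_to_event_config_of)

lemma fst_config_of[simp]: "fst (config_of k) = fst k"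
  by (cases k) (simp add: config_of_def)

lemma fcfs_alis_state_at:
  fixes E :: "('s::finite \<times> 'c::finite) set"
  shows "fcfs_alis E A B x t \<omega> =
    state_at E t (x, \<lambda>(e, n). case e of Arrival c \<Rightarrow> A c n \<omega> | Completion s \<Rightarrow> B s n \<omega>)"
proof -
  define k where "k = (x, \<lambda>(e, n). case e of Arrival c \<Rightarrow> A c n \<omega> | Completion s \<Rightarrow> B s n \<omega>)"
  have "(x, (\<lambda>c n. A c n \<omega>), (\<lambda>s n. B s n \<omega>)) = config_of k"
    by (simp add: config_of_def k_def)
  then show ?thesis
    by (simp add: fcfs_alis_def Let_def state_at_def jump_index_def config_after_config_of
        epoch_config_of flip: k_def)
qed

section \<open>The law of the clocks, and measurability of the dynamics\<close>

locale queue =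
  fixes E :: "('s::finite \<times> 'c::finite) set" and lam :: "'c \<Rightarrow> real" and mu :: "'s \<Rightarrow> real"
  assumes lam_pos: "0 < lam c" and mu_pos: "0 < mu s"
begin

definition rate :: "('c, 's) event \<Rightarrow> real" where
  "rate e = (case e of Arrival c \<Rightarrow> lam c | Completion s \<Rightarrow> mu s)"

definition total_rate :: "('c, 's) state \<Rightarrow> real" where
  "total_rate x = sum rate (enabled x)"

definition clock_law :: "('c, 's) clocks measure" where
  "clock_law = PiM UNIV (\<lambda>j. exp_law (rate (fst j)))"

abbreviation clock_space :: "('c, 's) clocks measure" where
  "clock_space \<equiv> PiM UNIV (\<lambda>_. borel)"

abbreviation pair_space :: "('c, 's) timed measure" where
  "pair_space \<equiv> count_space UNIV \<Otimes>\<^sub>M clock_space"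

lemma rate_pos[simp]: "0 < rate e"
  using lam_pos mu_pos by (cases e) (auto simp: rate_def)

lemma rate_nonneg[simp]: "0 \<le> rate e"
  using rate_pos[of e] by linarith

lemma total_rate_pos[simp]: "0 < total_rate x"
  unfolding total_rate_def by (rule sum_pos) auto

lemma total_rate_nonneg[simp]: "0 \<le> total_rate x"
  using total_rate_pos[of x] by linarith

lemma sets_clock_law[measurable_cong]: "sets clock_law = sets clock_space"
  unfolding clock_law_def by (rule sets_PiM_cong) auto

lemma measurable_clock_law: "measurable clock_law N = measurable clock_space N"
  by (rule measurable_cong_sets[OF sets_clock_law refl])

lemma space_clock_law[simp]: "space clock_law = UNIV"
  by (simp add: clock_law_def space_PiM)

lemma prob_space_clock_law: "prob_space clock_law"
  unfolding clock_law_def by (intro prob_space_PiM prob_space_exp_law) simp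

abbreviation expect :: "(('c, 's) clocks \<Rightarrow> ennreal) \<Rightarrow> ennreal" (binder "\<E>" 10) where
  "expect f \<equiv> nn_integral clock_law f"

sublocale K: prob_space clock_law
  by (rule prob_space_clock_law)

lemma emeasure_clock_law_UNIV: "emeasure clock_law UNIV = 1"
  using K.emeasure_space_1 by simp

lemma measurable_clocks_component[measurable]: "(\<lambda>\<kappa>. \<kappa> j) \<in> borel_measurable clock_space"
  by (rule measurable_component_singleton) simp

lemma measurable_into_clocks:
  assumes "\<And>j. (\<lambda>z. f z j) \<in> borel_measurable N"
  shows "f \<in> measurable N clock_space"
  by (rule measurable_PiM_single') (use assms in auto)

lemma pred_clock_le[measurable]: "Measurable.pred clock_space (\<lambda>\<kappa>. \<kappa> i \<le> \<kappa> j)"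
  unfolding pred_def by (intro borel_measurable_le measurable_clocks_component)

lemma sets_clocks_greater[measurable]: "{\<kappa>. \<forall>e\<in>F. t < \<kappa> (e, 0)} \<in> sets clock_space"
proof -
  have "(\<Inter>e\<in>F. {\<kappa> \<in> space clock_space. t < \<kappa> (e, 0)}) \<inter> space clock_space \<in> sets clock_space"
    by (cases "F = {}")
       (auto intro!: sets.Int sets.finite_INT borel_measurable_less measurable_clocks_component)
  also have "(\<Inter>e\<in>F. {\<kappa> \<in> space clock_space. t < \<kappa> (e, 0)}) \<inter> space clock_space =
    {\<kappa>. \<forall>e\<in>F. t < \<kappa> (e, 0)}"
    by (auto simp: space_PiM)
  finally show ?thesis .
qed

text \<open>The arg min is a Hilbert choice. It factors through the set of minimisers, which depends
  measurably on the clocks and takes values in a finite discrete space, where every function is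
  measurable.\<close>

lemma first_event_measurable[measurable]:
  "(\<lambda>\<kappa>. first_event (x, \<kappa>)) \<in> measurable clock_space (count_space UNIV)"
proof -
  define S where "S \<kappa> = {e \<in> enabled x. \<forall>e'\<in>enabled x. \<kappa> (e, 0) \<le> \<kappa> (e', 0)}" for \<kappa> :: "('c, 's) clocks"
  have eq: "first_event (x, \<kappa>) = (SOME e. e \<in> S \<kappa>)" for \<kappa>
    by (auto simp: first_event_def arg_min_on_def arg_min_def is_arg_min_def S_def not_less
        intro!: arg_cong[where f=Eps])
  have mem[measurable]: "Measurable.pred clock_space (\<lambda>\<kappa>. e \<in> S \<kappa>)" for e
    unfolding S_def mem_Collect_eq by measurable
  have "S \<in> measurable clock_space (count_space UNIV)"
  proof (subst measurable_count_space_eq2, simp, safe)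
    fix A
    have "Measurable.pred clock_space (\<lambda>\<kappa>. \<forall>e\<in>UNIV. (e \<in> S \<kappa>) = (e \<in> A))"
      by measurable
    moreover have "S -` {A} \<inter> space clock_space = {\<kappa> \<in> space clock_space. \<forall>e\<in>UNIV. (e \<in> S \<kappa>) = (e \<in> A)}"
      by auto
    ultimately show "S -` {A} \<inter> space clock_space \<in> sets clock_space"
      by (simp add: pred_def)
  qed auto
  then have "(\<lambda>\<kappa>. SOME e. e \<in> S \<kappa>) \<in> measurable clock_space (count_space UNIV)"
    by (rule measurable_compose) simp
  then show ?thesis by (simp add: eq)
qed

lemma holding_measurable1[measurable]: "(\<lambda>\<kappa>. holding (x, \<kappa>)) \<in> borel_measurable clock_space"
  unfolding holding_def prod.case
  by (rule measurable_compose_countable[where f="\<lambda>e \<kappa>. \<kappa> (e, 0)"]) measurable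

lemma residual_measurable[measurable]: "residual x e \<in> measurable clock_space clock_space"
proof (rule measurable_into_clocks)
  fix j :: "('c, 's) event \<times> nat"
  show "(\<lambda>z. residual x e z j) \<in> borel_measurable clock_space"
    by (cases j) (simp add: residual_def)
qed

lemma holding_measurable[measurable]: "holding \<in> borel_measurable pair_space"
  by (rule measurable_pair_measure_countable1[OF countableI_type holding_measurable1])

lemma after_event_measurable[measurable]: "after_event E \<in> measurable pair_space pair_space"
proof (rule measurable_pair_measure_countable1[OF countableI_type])
  fix x :: "('c, 's) state"
  have [measurable]: "(\<lambda>\<kappa>. residual x (first_event (x, \<kappa>)) \<kappa>) \<in> measurable clock_space clock_space"
    by (rule measurable_compose_countable[where f="\<lambda>e \<kappa>. residual x e \<kappa>"]) measurable
  show "(\<lambda>\<kappa>. after_event E (x, \<kappa>)) \<in> measurable clock_space pair_space"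
    unfolding after_event_def prod.case
    by (intro measurable_Pair measurable_compose[OF first_event_measurable, of "\<lambda>e. next_state E e x"])
       measurable
qed

lemma funpow_after_event_measurable[measurable]:
  "(after_event E ^^ n) \<in> measurable pair_space pair_space"
  by (induct n) (auto intro: measurable_comp)

lemma jump_time_measurable[measurable]: "(\<lambda>k. jump_time E k n) \<in> borel_measurable pair_space"
  unfolding jump_time_def by measurable

lemma jump_index_measurable[measurable]: "jump_index E t \<in> measurable pair_space (count_space UNIV)"
  unfolding jump_index_def[abs_def] by measurable

lemma state_at_measurable[measurable]: "state_at E t \<in> measurable pair_space (count_space UNIV)"
proof -
  have "(\<lambda>k. fst ((after_event E ^^ jump_index E t k) k)) \<in> measurable pair_space (count_space UNIV)"
    by (rule measurable_compose_countable[where f="\<lambda>n k. fst ((after_event E ^^ n) k)"]) measurable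
  then show ?thesis by (simp add: state_at_def[abs_def])
qed

lemma Pair_measurable_clocks[measurable]: "Pair x \<in> measurable clock_space pair_space"
  by (rule measurable_Pair1') simp

lemma nn_integral_clock_law_split:
  assumes f: "inj_on f (- {j})" "\<And>i. i \<noteq> j \<Longrightarrow> fst (f i) = fst i"
    and H: "H \<in> borel_measurable clock_space"
  shows "(\<E> \<kappa>. H \<kappa>) =
    (\<integral>\<^sup>+ T. (\<E> \<kappa>. H (\<lambda>i. if i = j then T else \<kappa> (f i))) \<partial>exp_law (rate (fst j)))"
  unfolding clock_law_def
proof (rule nn_integral_PiM_split[where f=f])
  show "prob_space (exp_law (rate (fst i)))" for i :: "('c, 's) event \<times> nat"
    by (rule prob_space_exp_law) simp
  show "H \<in> borel_measurable (PiM UNIV (\<lambda>j. exp_law (rate (fst j))))"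
    unfolding clock_law_def[symmetric] measurable_clock_law by (rule H)
qed (simp_all add: f)

definition advance :: "('c, 's) event set \<Rightarrow> real \<Rightarrow> ('c, 's) clocks \<Rightarrow> ('c, 's) clocks" where
  "advance F t \<kappa> = (\<lambda>(e, n). if e \<in> F \<and> n = 0 then \<kappa> (e, n) - t else \<kappa> (e, n))"

lemma advance_measurable[measurable]: "advance F t \<in> measurable clock_space clock_space"
proof (rule measurable_into_clocks)
  fix j :: "('c, 's) event \<times> nat"
  show "(\<lambda>z. advance F t z j) \<in> borel_measurable clock_space"
    by (cases j) (simp add: advance_def)
qed

lemma update_measurable:
  assumes h: "h \<in> measurable clock_space clock_space"
  shows "(\<lambda>z. \<lambda>i. if i = j then fst z else h (snd z) (f i)) \<in> measurable (borel \<Otimes>\<^sub>M clock_space) clock_space"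
proof (rule measurable_into_clocks)
  fix i
  have "(\<lambda>z. h (snd z) (f i)) \<in> borel_measurable (borel \<Otimes>\<^sub>M clock_space)"
    by (rule measurable_compose[OF measurable_compose[OF measurable_snd h] measurable_clocks_component])
  then show "(\<lambda>z. if i = j then fst z else h (snd z) (f i)) \<in> borel_measurable (borel \<Otimes>\<^sub>M clock_space)"
    by (cases "i = j") (simp_all only: if_True if_False refl measurable_fst)
qed

text \<open>Induction on \<open>F\<close>: the clock of one event is integrated separately, and the
  one-dimensional memoryless law applies to it with the others held fixed. Besides the survival
  probability, the equation says that given survival the advanced clocks have their original
  law.\<close>

lemma clock_law_memoryless:
  assumes t: "0 \<le> t" and g: "g \<in> borel_measurable clock_space"
  shows "(\<E> \<kappa>. indicator {\<kappa>. \<forall>e\<in>F. t < \<kappa> (e, 0)} \<kappa> * g (advance F t \<kappa>)) =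
    ennreal (exp (- sum rate F * t)) * (\<E> \<kappa>. g \<kappa>)"
proof -
  have "finite F" by simp
  then show ?thesis using g
  proof (induct arbitrary: g)
    case empty
    then show ?case by (simp add: advance_def)
  next
    case (insert e F)
    note g[measurable] = insert.prems
    let ?j = "(e, 0::nat)"
    have inj: "inj_on id (- {?j})" by simp
    define J where "J \<kappa> = (indicator {\<kappa>. \<forall>e\<in>F. t < \<kappa> (e, 0)} \<kappa> :: ennreal)" for \<kappa> :: "('c, 's) clocks"
    have J_eq: "J \<kappa> = (if \<forall>e\<in>F. t < \<kappa> (e, 0) then 1 else 0)" for \<kappa>
      by (auto simp: J_def)
    define S where "S = {\<kappa> :: ('c, 's) clocks. \<forall>e\<in>F. t < \<kappa> (e, 0)}"
    have S: "S \<in> sets clock_space"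
      unfolding S_def by (rule sets_clocks_greater)
    have J_ind: "J = indicator S"
      by (rule ext) (simp add: J_def S_def)
    have J_meas: "J \<in> borel_measurable clock_space"
      unfolding J_ind by (rule borel_measurable_indicator) (rule S)
    \<comment> \<open>\<open>G T\<close> integrates over all clocks except that of \<open>e\<close>,
      which is set to \<open>T\<close>; advancing by \<open>t\<close> makes the argument
      \<open>T - t\<close> appear, as the one-dimensional law requires.\<close>
    define G where "G T = (\<E> \<kappa>. J \<kappa> * g (\<lambda>i. if i = ?j then T else advance F t \<kappa> i))" for T
    have m1: "(\<lambda>z. g (\<lambda>i. if i = ?j then fst z else advance F t (snd z) (id i))) \<in> borel_measurable (borel \<Otimes>\<^sub>M clock_space)"
      by (rule measurable_compose[OF update_measurable[OF advance_measurable] g])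
    have J_snd: "(\<lambda>z. J (snd z)) \<in> borel_measurable ((borel :: real measure) \<Otimes>\<^sub>M clock_space)"
      by (rule measurable_compose[OF measurable_snd J_meas])
    have m2: "(\<lambda>z. J (snd z) * g (\<lambda>i. if i = ?j then fst z else advance F t (snd z) i)) \<in>
        borel_measurable (borel \<Otimes>\<^sub>M clock_law)"
      using borel_measurable_times_ennreal[OF J_snd m1]
      unfolding id_apply measurable_cong_sets[OF sets_pair_measure_cong[OF refl sets_clock_law] refl] .
    have G_meas: "G \<in> borel_measurable borel"
      using K.borel_measurable_nn_integral_fst[OF m2] unfolding G_def fst_conv snd_conv .
    have G_inner: "(\<lambda>\<kappa>. J \<kappa> * g (\<lambda>i. if i = ?j then T else advance F t \<kappa> i)) \<in> borel_measurable clock_law" for T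
      using measurable_compose[OF measurable_Pair1' m2, of T] unfolding fst_conv snd_conv by simp
    have ne: "e' \<noteq> e" if "e' \<in> F" for e'
      using insert.hyps(2) that by metis
    have J_upd: "J (\<lambda>i. if i = ?j then T else \<kappa> i) = J \<kappa>" for T \<kappa>
      by (simp add: J_eq ne cong: ball_cong)
    have ind: "indicator {\<kappa>. \<forall>e\<in>insert e F. t < \<kappa> (e, 0)} (\<lambda>i. if i = ?j then T else \<kappa> i) =
        (indicator {t<..} T * J \<kappa> :: ennreal)" for T \<kappa>
      by (simp add: J_eq indicator_def ne cong: ball_cong)
    have sh: "advance (insert e F) t (\<lambda>i. if i = ?j then T else \<kappa> i) = (\<lambda>i. if i = ?j then T - t else advance F t \<kappa> i)" for T \<kappa>
      using insert.hyps(2) by (auto simp: advance_def fun_eq_iff)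
    have sh': "advance F t (\<lambda>i. if i = ?j then T else \<kappa> i) = (\<lambda>i. if i = ?j then T else advance F t \<kappa> i)" for T \<kappa>
      using insert.hyps(2) by (auto simp: advance_def fun_eq_iff)
    have mi: "(\<lambda>\<kappa>. indicator {\<kappa>. \<forall>e\<in>insert e F. t < \<kappa> (e, 0)} \<kappa> * g (advance (insert e F) t \<kappa>)) \<in> borel_measurable clock_space"
      by (intro borel_measurable_times_ennreal measurable_compose[OF advance_measurable g]
          borel_measurable_indicator sets_clocks_greater)
    have mi': "(\<lambda>\<kappa>. J \<kappa> * g (advance F t \<kappa>)) \<in> borel_measurable clock_space"
      by (intro borel_measurable_times_ennreal J_meas measurable_compose[OF advance_measurable g])
    have "(\<E> \<kappa>. indicator {\<kappa>. \<forall>e\<in>insert e F. t < \<kappa> (e, 0)} \<kappa> * g (advance (insert e F) t \<kappa>)) =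
      (\<integral>\<^sup>+ T. (\<E> \<kappa>. indicator {t<..} T * (J \<kappa> * g (\<lambda>i. if i = ?j then T - t else advance F t \<kappa> i))) \<partial>exp_law (rate e))"
      by (rule nn_integral_clock_law_split[OF inj _ mi, unfolded id_apply ind sh mult.assoc fst_conv]) (rule refl)
    also have "\<dots> = (\<integral>\<^sup>+ T. indicator {t<..} T * G (T - t) \<partial>exp_law (rate e))"
      unfolding G_def
      by (intro nn_integral_cong nn_integral_cmult G_inner)
    also have "\<dots> = ennreal (exp (- rate e * t)) * (\<integral>\<^sup>+ T. G T \<partial>exp_law (rate e))"
      by (rule exp_law_memoryless[OF rate_pos t G_meas])
    also have "(\<integral>\<^sup>+ T. G T \<partial>exp_law (rate e)) = (\<E> \<kappa>. J \<kappa> * g (advance F t \<kappa>))"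
      by (rule nn_integral_clock_law_split[OF inj _ mi', unfolded id_apply J_upd sh' fst_conv G_def[symmetric], symmetric])
         (rule refl)
    also have "\<dots> = ennreal (exp (- sum rate F * t)) * (\<E> \<kappa>. g \<kappa>)"
      unfolding J_def by (rule insert.hyps(3)) fact
    also have "ennreal (exp (- rate e * t)) * (ennreal (exp (- sum rate F * t)) * (\<E> \<kappa>. g \<kappa>)) =
      ennreal (exp (- sum rate (insert e F) * t)) * (\<E> \<kappa>. g \<kappa>)"
    proof -
      have "exp (- sum rate (insert e F) * t) = exp (- rate e * t) * exp (- sum rate F * t)"
        using insert.hyps(1,2) by (simp add: exp_add[symmetric] algebra_simps)
      then show ?thesis
        by (simp only: ennreal_mult' exp_ge_zero mult.assoc)
    qed
    finally show ?case .
  qed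
qed

end

section \<open>The first event\<close>

lemma exp_law_AE_greater: "AE y in exp_law r. 0 < y"
  using exp_law_AE_pos[where r=r] exp_law_AE_neq[where r=r and T=0] by eventually_elim simp

text \<open>The density of rate \<open>r\<close> times the exponential is \<open>r / q\<close> times
  the density of rate \<open>q\<close>. For \<open>r\<close> the rate of one event and
  \<open>q\<close> the total rate, the exponential is the probability that no competitor comes
  before \<open>y\<close>, and \<open>r / q\<close> becomes the probability that this event is the
  first.\<close>

lemma nn_integral_exp_law_tilt:
  assumes r: "0 < r" "0 < q" and g: "g \<in> borel_measurable borel"
  shows "(\<integral>\<^sup>+ y. ennreal (exp (- (q - r) * y)) * g y \<partial>exp_law r) = ennreal (r / q) * (\<integral>\<^sup>+ y. g y \<partial>exp_law q)"
proof -
  have "(\<integral>\<^sup>+ y. ennreal (exp (- (q - r) * y)) * g y \<partial>exp_law r) =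
    (\<integral>\<^sup>+ y. ennreal (exponential_density r y) * (ennreal (exp (- (q - r) * y)) * g y) \<partial>lborel)"
    using g by (intro nn_integral_exp_law) measurable
  also have "\<dots> = (\<integral>\<^sup>+ y. ennreal (r / q) * (ennreal (exponential_density q y) * g y) \<partial>lborel)"
  proof (rule nn_integral_cong)
    fix y
    have "exponential_density r y * exp (- (q - r) * y) = r / q * exponential_density q y"
      using r by (auto simp: exponential_density_def exp_add[symmetric] algebra_simps)
    then show "ennreal (exponential_density r y) * (ennreal (exp (- (q - r) * y)) * g y) =
      ennreal (r / q) * (ennreal (exponential_density q y) * g y)"
      using r by (simp add: mult.assoc[symmetric] ennreal_mult'[symmetric] exponential_density_nonneg)
  qed
  also have "\<dots> = ennreal (r / q) * (\<integral>\<^sup>+ y. g y \<partial>exp_law q)"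
    using g by (simp add: nn_integral_cmult nn_integral_exp_law)
  finally show ?thesis .
qed

lemma nn_integral_exp_law_const: "0 < r \<Longrightarrow> (\<integral>\<^sup>+ y. c \<partial>exp_law r) = c"
proof -
  assume "0 < r"
  then interpret prob_space "exp_law r" by (rule prob_space_exp_law)
  show ?thesis by (simp only: nn_integral_const emeasure_space_1 mult_1_right)
qed

lemma nn_integral_exp_law_exp:
  assumes "0 < q"
  shows "(\<integral>\<^sup>+ y. ennreal (exp (- y)) \<partial>exp_law q) = ennreal (q / (q + 1))"
  using nn_integral_exp_law_tilt[of q "q + 1" "\<lambda>_. 1"] assms
    nn_integral_exp_law_const[of "q + 1" 1] by simp

context queue
begin

lemma AE_clock_neq: "AE \<kappa> in clock_law. \<kappa> j \<noteq> T"
  unfolding clock_law_def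
  by (rule AE_PiM_component[where P="\<lambda>y. y \<noteq> T"]) (simp_all add: prob_space_exp_law exp_law_AE_neq)

lemma AE_clock_pos: "AE \<kappa> in clock_law. 0 < \<kappa> j"
  unfolding clock_law_def
  by (rule AE_PiM_component[where P="\<lambda>y. 0 < y"]) (simp_all add: prob_space_exp_law exp_law_AE_greater)

lemma first_event_eqI:
  fixes x :: "('c, 's) state"
  assumes "e \<in> enabled x" "\<And>e'. e' \<in> enabled x \<Longrightarrow> e' \<noteq> e \<Longrightarrow> \<kappa> (e, 0) < \<kappa> (e', 0)"
  shows "first_event (x, \<kappa>) = e"
proof (rule ccontr)
  assume "first_event (x, \<kappa>) \<noteq> e"
  then have "\<kappa> (e, 0) < \<kappa> (first_event (x, \<kappa>), 0)"
    by (intro assms first_event_enabled)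
  with first_event_least[OF assms(1), of \<kappa>] show False by simp
qed

text \<open>Its index map is the injection with which the clock of \<open>e\<close> is split off: a
  fresh \<open>T\<close> put in front of the sequence of \<open>e\<close> in a fresh \<kappa> gives
  the clock law again.\<close>

definition prepend :: "('c, 's) event \<Rightarrow> real \<Rightarrow> ('c, 's) clocks \<Rightarrow> ('c, 's) clocks" where
  "prepend e T \<kappa> = (\<lambda>i. if i = (e, 0) then T else \<kappa> (if fst i = e then (e, snd i - 1) else i))"

lemma residual_prepend:
  "e \<in> enabled x \<Longrightarrow> residual x e (prepend e T \<kappa>) = advance (enabled x - {e}) T \<kappa>"
  by (rule ext) (auto simp: residual_def prepend_def advance_def)

lemma of_bool_first_event_measurable:
  "(\<lambda>\<kappa>. of_bool (first_event (x, \<kappa>) = e) :: ennreal) \<in> borel_measurable clock_space"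
  by (rule measurable_compose[OF first_event_measurable]) simp

text \<open>Condition on the clock \<open>T\<close> of an enabled event \<open>e\<close>. It is the
  first event iff all other running clocks exceed \<open>T\<close>; by memorylessness this has
  probability \<open>exp (- (total_rate x - rate e) * T)\<close> and leaves clocks with the law they
  started with. The tilting lemma then changes the law of \<open>T\<close> from rate
  \<open>rate e\<close> to \<open>total_rate x\<close>.\<close>

lemma nn_integral_first_event:
  fixes G :: "('c, 's) event \<Rightarrow> real \<Rightarrow> ('c, 's) clocks \<Rightarrow> ennreal"
  assumes G: "\<And>e. (\<lambda>z. G e (fst z) (snd z)) \<in> borel_measurable (borel \<Otimes>\<^sub>M clock_space)"
  shows "(\<E> \<kappa>. G (first_event (x, \<kappa>)) (holding (x, \<kappa>)) (residual x (first_event (x, \<kappa>)) \<kappa>)) =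
    (\<Sum>e\<in>enabled x. ennreal (rate e / total_rate x) *
      (\<integral>\<^sup>+ y. (\<E> \<kappa>. G e y \<kappa>) \<partial>exp_law (total_rate x)))"
proof -
  define H where "H e \<kappa> = of_bool (first_event (x, \<kappa>) = e) * G e (\<kappa> (e, 0)) (residual x e \<kappa>)" for e \<kappa>
  have H_meas: "H e \<in> borel_measurable clock_space" for e
    unfolding H_def
    by (intro borel_measurable_times_ennreal of_bool_first_event_measurable)
       (rule measurable_compose[OF measurable_Pair[OF measurable_clocks_component residual_measurable] G,
         unfolded fst_conv snd_conv])
  have H_meas': "H e \<in> borel_measurable clock_law" for e
    using H_meas unfolding measurable_clock_law .
  have G_inner: "G e T \<in> borel_measurable clock_space" for e T
    using measurable_compose[OF measurable_Pair1' G, of T e] unfolding fst_conv snd_conv by simp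
  have G_outer: "(\<lambda>T. (\<E> \<kappa>. G e T \<kappa>)) \<in> borel_measurable borel" for e
  proof -
    have "(\<lambda>z. G e (fst z) (snd z)) \<in> borel_measurable (borel \<Otimes>\<^sub>M clock_law)"
      using G unfolding measurable_cong_sets[OF sets_pair_measure_cong[OF refl sets_clock_law] refl] .
    from K.borel_measurable_nn_integral_fst[OF this] show ?thesis
      unfolding fst_conv snd_conv .
  qed
  have "(\<E> \<kappa>. G (first_event (x, \<kappa>)) (holding (x, \<kappa>)) (residual x (first_event (x, \<kappa>)) \<kappa>)) =
      (\<E> \<kappa>. (\<Sum>e\<in>enabled x. H e \<kappa>))"
  proof (rule nn_integral_cong)
    fix \<kappa>
    have "(\<Sum>e\<in>enabled x. H e \<kappa>) = (\<Sum>e\<in>{first_event (x, \<kappa>)}. H e \<kappa>)"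
      by (rule sum.mono_neutral_right) (auto simp: H_def)
    then show "G (first_event (x, \<kappa>)) (holding (x, \<kappa>)) (residual x (first_event (x, \<kappa>)) \<kappa>) =
        (\<Sum>e\<in>enabled x. H e \<kappa>)"
      by (simp add: H_def holding_def)
  qed
  also have "\<dots> = (\<Sum>e\<in>enabled x. (\<E> \<kappa>. H e \<kappa>))"
    by (rule nn_integral_sum[OF H_meas'])
  also have "\<dots> = (\<Sum>e\<in>enabled x. ennreal (rate e / total_rate x) *
      (\<integral>\<^sup>+ y. (\<E> \<kappa>. G e y \<kappa>) \<partial>exp_law (total_rate x)))"
  proof (rule sum.cong[OF refl])
    fix e assume e: "e \<in> enabled x"
    let ?F = "enabled x - {e}"
    have F: "sum rate ?F = total_rate x - rate e"
      using e by (simp add: total_rate_def sum_diff1)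
    have inner: "(\<E> \<kappa>. H e (prepend e T \<kappa>)) =
        ennreal (exp (- (total_rate x - rate e) * T)) * (\<E> \<kappa>. G e T \<kappa>)"
      if T: "0 \<le> T" for T
    proof -
      have "(\<E> \<kappa>. H e (prepend e T \<kappa>)) =
        (\<E> \<kappa>. indicator {\<kappa>. \<forall>e\<in>?F. T < \<kappa> (e, 0)} \<kappa> * G e T (advance ?F T \<kappa>))"
      proof (rule nn_integral_cong_AE)
        \<comment> \<open>Almost surely no other clock ties with \<open>T\<close>; at a tie the
          unspecified choice of the first event would matter.\<close>
        have "AE \<kappa> in clock_law. \<forall>e'\<in>UNIV. \<kappa> (e' :: ('c, 's) event, 0) \<noteq> T"
          by (rule AE_finite_allI) (simp_all only: finite AE_clock_neq)
        then show "AE \<kappa> in clock_law. H e (prepend e T \<kappa>) =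
            indicator {\<kappa>. \<forall>e\<in>?F. T < \<kappa> (e, 0)} \<kappa> * G e T (advance ?F T \<kappa>)"
        proof eventually_elim
          fix \<kappa> :: "('c, 's) clocks" assume neq: "\<forall>e'\<in>UNIV. \<kappa> (e' :: ('c, 's) event, 0) \<noteq> T"
          have p0: "prepend e T \<kappa> (e, 0) = T"
            by (simp add: prepend_def)
          have p1: "prepend e T \<kappa> (e', 0) = \<kappa> (e', 0)" if "e' \<noteq> e" for e'
            using that by (simp add: prepend_def)
          have "first_event (x, prepend e T \<kappa>) = e \<longleftrightarrow> (\<forall>e\<in>?F. T < \<kappa> (e, 0))"
          proof
            assume fe: "first_event (x, prepend e T \<kappa>) = e"
            show "\<forall>e\<in>?F. T < \<kappa> (e, 0)"
            proof
              fix e' assume "e' \<in> ?F"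
              then have "e' \<in> enabled x" "e' \<noteq> e" by auto
              with first_event_least[of e' x "prepend e T \<kappa>"] neq fe p0 p1 show "T < \<kappa> (e', 0)"
                by (metis UNIV_I order_le_less)
            qed
          next
            assume "\<forall>e\<in>?F. T < \<kappa> (e, 0)"
            then show "first_event (x, prepend e T \<kappa>) = e"
              by (intro first_event_eqI e) (simp add: p0 p1)
          qed
          then show "H e (prepend e T \<kappa>) =
            indicator {\<kappa>. \<forall>e\<in>?F. T < \<kappa> (e, 0)} \<kappa> * G e T (advance ?F T \<kappa>)"
            unfolding H_def residual_prepend[OF e] p0 by (simp add: indicator_def)
        qed
      qed
      also have "\<dots> = ennreal (exp (- sum rate ?F * T)) * (\<E> \<kappa>. G e T \<kappa>)"
        by (rule clock_law_memoryless[OF T G_inner])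
      finally show ?thesis unfolding F .
    qed
    have "(\<E> \<kappa>. H e \<kappa>) = (\<integral>\<^sup>+ T. (\<E> \<kappa>. H e (prepend e T \<kappa>)) \<partial>exp_law (rate e))"
      unfolding prepend_def
    proof (rule nn_integral_clock_law_split[where j="(e, 0)", unfolded fst_conv])
      show "inj_on (\<lambda>i. if fst i = e then (e, snd i - 1) else i) (- {(e, 0::nat)})"
      proof (rule inj_onI)
        fix a b :: "('c, 's) event \<times> nat"
        assume "a \<in> - {(e, 0::nat)}" "b \<in> - {(e, 0::nat)}"
          "(if fst a = e then (e, snd a - 1) else a) = (if fst b = e then (e, snd b - 1) else b)"
        then show "a = b"
          by (cases a; cases b; cases "snd a"; cases "snd b") (auto split: if_splits)
      qed
    qed (auto intro: H_meas)
    also have "\<dots> = (\<integral>\<^sup>+ T. ennreal (exp (- (total_rate x - rate e) * T)) * (\<E> \<kappa>. G e T \<kappa>) \<partial>exp_law (rate e))"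
      using exp_law_AE_pos by (intro nn_integral_cong_AE) (rule AE_mp, assumption, rule AE_I2, rule impI, rule inner)
    also have "\<dots> = ennreal (rate e / total_rate x) *
      (\<integral>\<^sup>+ y. (\<E> \<kappa>. G e y \<kappa>) \<partial>exp_law (total_rate x))"
      by (rule nn_integral_exp_law_tilt[OF rate_pos total_rate_pos G_outer])
    finally show "(\<E> \<kappa>. H e \<kappa>) = ennreal (rate e / total_rate x) *
      (\<integral>\<^sup>+ y. (\<E> \<kappa>. G e y \<kappa>) \<partial>exp_law (total_rate x))" .
  qed
  finally show ?thesis .
qed

text \<open>First-step analysis. The later inductions on the number of events use this form or its
  special case for functions of the next configuration.\<close>

lemma nn_integral_holding_after_event:
  fixes F :: "real \<Rightarrow> ('c, 's) timed \<Rightarrow> ennreal"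
  assumes F: "(\<lambda>z. F (fst z) (snd z)) \<in> borel_measurable (borel \<Otimes>\<^sub>M pair_space)"
  shows "(\<E> \<kappa>. F (holding (x, \<kappa>)) (after_event E (x, \<kappa>))) =
    (\<Sum>e\<in>enabled x. ennreal (rate e / total_rate x) *
      (\<integral>\<^sup>+ y. (\<E> \<kappa>. F y (next_state E e x, \<kappa>)) \<partial>exp_law (total_rate x)))"
proof -
  have m: "(\<lambda>z. F (fst z) (next_state E e x, snd z)) \<in> borel_measurable (borel \<Otimes>\<^sub>M clock_space)" for e
    using measurable_compose[OF measurable_Pair[OF measurable_fst measurable_compose[OF measurable_snd Pair_measurable_clocks]] F]
    unfolding fst_conv snd_conv .
  show ?thesis
    using nn_integral_first_event[where G="\<lambda>e y \<kappa>. F y (next_state E e x, \<kappa>)", OF m]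
    unfolding after_event_def prod.case .
qed

definition jump_op :: "(('c, 's) state \<Rightarrow> ennreal) \<Rightarrow> ('c, 's) state \<Rightarrow> ennreal" where
  "jump_op f x = (\<Sum>e\<in>enabled x. ennreal (rate e / total_rate x) * f (next_state E e x))"

lemma jump_op_const: "jump_op (\<lambda>_. c) x = c"
proof -
  have "(\<Sum>e\<in>enabled x. ennreal (rate e / total_rate x)) = ennreal (\<Sum>e\<in>enabled x. rate e / total_rate x)"
    by (rule sum_ennreal) simp
  also have "(\<Sum>e\<in>enabled x. rate e / total_rate x) = total_rate x / total_rate x"
    unfolding sum_divide_distrib[symmetric] by (simp add: total_rate_def)
  finally show ?thesis
    using total_rate_pos[of x] by (simp add: jump_op_def sum_distrib_right[symmetric])
qed

lemma jump_op_mono: "(\<And>x. f x \<le> g x) \<Longrightarrow> jump_op f x \<le> jump_op g x"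
  unfolding jump_op_def by (intro sum_mono mult_left_mono) auto

lemma nn_integral_after_event:
  assumes F: "F \<in> borel_measurable pair_space"
  shows "(\<E> \<kappa>. F (after_event E (x, \<kappa>))) =
    jump_op (\<lambda>z. (\<E> \<kappa>. F (z, \<kappa>))) x"
  using nn_integral_holding_after_event[where F="\<lambda>_. F", OF measurable_compose[OF measurable_snd F]]
  unfolding jump_op_def nn_integral_exp_law_const[OF total_rate_pos] .

text \<open>The next configuration has fresh clocks, so what holds almost surely for fresh clocks
  holds almost surely after an event.\<close>

lemma AE_after_event:
  assumes P: "Measurable.pred pair_space P" and AE: "\<And>z. AE \<kappa> in clock_law. P (z, \<kappa>)"
  shows "AE \<kappa> in clock_law. P (after_event E (x, \<kappa>))"
proof -
  have m: "(\<lambda>k. of_bool (\<not> P k) :: ennreal) \<in> borel_measurable pair_space"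
    by (rule measurable_compose[OF P]) simp
  have m1: "(\<lambda>\<kappa>. of_bool (\<not> P (z, \<kappa>)) :: ennreal) \<in> borel_measurable clock_law" for z
    unfolding measurable_clock_law
    by (rule measurable_compose[OF Pair_measurable_clocks m])
  have m2: "(\<lambda>\<kappa>. of_bool (\<not> P (after_event E (x, \<kappa>))) :: ennreal) \<in> borel_measurable clock_law"
    unfolding measurable_clock_law
    by (rule measurable_compose[OF measurable_compose[OF Pair_measurable_clocks after_event_measurable] m])
  have "(\<E> \<kappa>. of_bool (\<not> P (z, \<kappa>))) = 0" for z
    unfolding nn_integral_0_iff_AE[OF m1] using AE[of z] by eventually_elim simp
  then have "(\<E> \<kappa>. of_bool (\<not> P (after_event E (x, \<kappa>)))) = 0"
    unfolding nn_integral_after_event[OF m] by (simp add: jump_op_const)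
  then show ?thesis
    unfolding nn_integral_0_iff_AE[OF m2] by eventually_elim (simp split: if_splits)
qed

section \<open>Jump times: positivity of the holding times and absence of explosion\<close>

lemma jump_time_Suc: "jump_time E k (Suc n) = holding k + jump_time E (after_event E k) n"
  unfolding jump_time_def by (simp add: sum.lessThan_Suc_shift funpow_swap1 del: sum.lessThan_Suc)

definition rate_bound :: real where
  "rate_bound = sum rate UNIV"

lemma total_rate_le: "total_rate x \<le> rate_bound"
  unfolding total_rate_def rate_bound_def by (rule sum_mono2) auto

lemma rate_bound_pos: "0 < rate_bound"
  using total_rate_le total_rate_pos by (rule less_le_trans[rotated])

lemma AE_holding_pos: "AE \<kappa> in clock_law. 0 < holding ((after_event E ^^ n) (x, \<kappa>))"
proof (induct n arbitrary: x)
  case 0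
  have "AE \<kappa> in clock_law. \<forall>e\<in>UNIV. 0 < \<kappa> (e :: ('c, 's) event, 0)"
    by (rule AE_finite_allI) (simp_all only: finite AE_clock_pos)
  then show ?case by eventually_elim (simp add: holding_def)
next
  case (Suc n)
  have "Measurable.pred pair_space (\<lambda>k. 0 < holding ((after_event E ^^ n) k))"
    by (intro borel_measurable_pred_less borel_measurable_const
        measurable_compose[OF funpow_after_event_measurable holding_measurable])
  from AE_after_event[OF this Suc] show ?case
    by (simp add: funpow_swap1)
qed

text \<open>The Laplace transform at 1 of a holding time is \<open>q / (q + 1)\<close> with
  \<open>q\<close> the total rate. It increases with \<open>q\<close>, so each jump contributes a
  factor of at most its value at \<open>rate_bound\<close>, which is below 1.\<close>

lemma nn_integral_exp_jump_time:
  "(\<E> \<kappa>. ennreal (exp (- jump_time E (x, \<kappa>) n))) \<le> ennreal ((rate_bound / (rate_bound + 1)) ^ n)"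
proof (induct n arbitrary: x)
  case 0
  then show ?case by (simp add: jump_time_def emeasure_clock_law_UNIV)
next
  case (Suc n)
  let ?\<theta> = "rate_bound / (rate_bound + 1)"
  have \<theta>: "0 \<le> ?\<theta>" using rate_bound_pos by simp
  define F where "F y k = ennreal (exp (- y)) * ennreal (exp (- jump_time E k n))" for y k
  have m: "(\<lambda>k. ennreal (exp (- jump_time E k n))) \<in> borel_measurable pair_space"
    using jump_time_measurable by measurable
  have me: "(\<lambda>y::real. ennreal (exp (- y))) \<in> borel_measurable borel"
    by measurable
  have F: "(\<lambda>z. F (fst z) (snd z)) \<in> borel_measurable (borel \<Otimes>\<^sub>M pair_space)"
    unfolding F_def
    by (intro borel_measurable_times_ennreal measurable_compose[OF measurable_fst me]
        measurable_compose[OF measurable_snd m])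
  have m1: "(\<lambda>\<kappa>. ennreal (exp (- jump_time E (z, \<kappa>) n))) \<in> borel_measurable clock_law" for z
    unfolding measurable_clock_law
    by (rule measurable_compose[OF Pair_measurable_clocks m])
  have "(\<E> \<kappa>. ennreal (exp (- jump_time E (x, \<kappa>) (Suc n)))) =
    (\<E> \<kappa>. F (holding (x, \<kappa>)) (after_event E (x, \<kappa>)))"
    by (simp add: jump_time_Suc F_def ennreal_mult'[symmetric] exp_add[symmetric])
  also have "\<dots> = (\<Sum>e\<in>enabled x. ennreal (rate e / total_rate x) *
      (\<integral>\<^sup>+ y. (\<E> \<kappa>. F y (next_state E e x, \<kappa>)) \<partial>exp_law (total_rate x)))"
    by (rule nn_integral_holding_after_event[OF F])
  also have "\<dots> \<le> (\<Sum>e\<in>enabled x. ennreal (rate e / total_rate x) * ennreal (?\<theta> ^ Suc n))"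
  proof (intro sum_mono mult_left_mono)
    fix e
    have "(\<integral>\<^sup>+ y. (\<E> \<kappa>. F y (next_state E e x, \<kappa>)) \<partial>exp_law (total_rate x)) =
      (\<integral>\<^sup>+ y. ennreal (exp (- y)) * (\<E> \<kappa>. ennreal (exp (- jump_time E (next_state E e x, \<kappa>) n))) \<partial>exp_law (total_rate x))"
      unfolding F_def by (intro nn_integral_cong nn_integral_cmult m1)
    also have "\<dots> = ennreal (total_rate x / (total_rate x + 1)) * (\<E> \<kappa>. ennreal (exp (- jump_time E (next_state E e x, \<kappa>) n)))"
      by (subst nn_integral_multc) (simp_all add: nn_integral_exp_law_exp)
    also have "\<dots> \<le> ennreal ?\<theta> * ennreal (?\<theta> ^ n)"
    proof (intro mult_mono Suc ennreal_leI)
      show "total_rate x / (total_rate x + 1) \<le> ?\<theta>"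
      proof -
        have "total_rate x / (total_rate x + 1) = 1 - 1 / (total_rate x + 1)"
        proof -
          have "0 < total_rate x + 1" using total_rate_pos[of x] by linarith
          then show ?thesis by (simp add: divide_simps)
        qed
        moreover have "?\<theta> = 1 - 1 / (rate_bound + 1)"
          using rate_bound_pos by (simp add: divide_simps)
        moreover have "1 / (rate_bound + 1) \<le> 1 / (total_rate x + 1)"
          using total_rate_le[of x] total_rate_pos[of x] by (intro frac_le add_pos_pos) auto
        ultimately show ?thesis by linarith
      qed
    qed auto
    also have "\<dots> = ennreal (?\<theta> ^ Suc n)"
      by (simp only: power_Suc ennreal_mult'[OF \<theta>])
    finally show "(\<integral>\<^sup>+ y. (\<E> \<kappa>. F y (next_state E e x, \<kappa>)) \<partial>exp_law (total_rate x)) \<le> ennreal (?\<theta> ^ Suc n)" .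
  qed auto
  also have "\<dots> = ennreal (?\<theta> ^ Suc n)"
    using jump_op_const[of "ennreal (?\<theta> ^ Suc n)" x] unfolding jump_op_def .
  finally show ?case .
qed

text \<open>The almost sure event on which the pathwise arguments take place: no two events at the
  same time along the path, and no explosion.\<close>

definition good :: "('c, 's) timed \<Rightarrow> bool" where
  "good k \<longleftrightarrow> (\<forall>n. 0 < holding ((after_event E ^^ n) k)) \<and> (\<forall>T. \<exists>n. T < jump_time E k n)"

text \<open>Markov's inequality for \<open>exp (- jump_time E (x, \<kappa>) n)\<close>, with a bound
  that tends to 0 as \<open>n\<close> grows.\<close>

lemma AE_jump_time_unbounded: "AE \<kappa> in clock_law. \<exists>n. real N < jump_time E (x, \<kappa>) n"
proof -
  define S where "S = {\<kappa> \<in> space clock_law. \<not> (\<exists>n. real N < jump_time E (x, \<kappa>) n)}"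
  have jm: "(\<lambda>\<kappa>. jump_time E (x, \<kappa>) n) \<in> borel_measurable clock_law" for n
    unfolding measurable_clock_law
    by (rule measurable_compose[OF Pair_measurable_clocks jump_time_measurable])
  have S: "S \<in> sets clock_law"
    unfolding S_def using jm by measurable
  let ?\<theta> = "rate_bound / (rate_bound + 1)"
  have bound: "measure clock_law S \<le> exp (real N) * ?\<theta> ^ n" for n
  proof -
    have "ennreal (exp (- real N)) * emeasure clock_law S = (\<E> \<kappa>. ennreal (exp (- real N)) * indicator S \<kappa>)"
      by (rule nn_integral_cmult_indicator[symmetric, OF S])
    also have "\<dots> \<le> (\<E> \<kappa>. ennreal (exp (- jump_time E (x, \<kappa>) n)))"
      by (intro nn_integral_mono) (auto simp: S_def indicator_def not_less intro!: ennreal_leI)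
    also have "\<dots> \<le> ennreal (?\<theta> ^ n)"
      by (rule nn_integral_exp_jump_time)
    finally have "ennreal (exp (- real N) * measure clock_law S) \<le> ennreal (?\<theta> ^ n)"
      by (simp add: K.emeasure_eq_measure ennreal_mult')
    then have "exp (- real N) * measure clock_law S \<le> ?\<theta> ^ n"
      using rate_bound_pos by (simp add: ennreal_le_iff)
    then have "exp (real N) * (exp (- real N) * measure clock_law S) \<le> exp (real N) * ?\<theta> ^ n"
      by (intro mult_left_mono) auto
    then show ?thesis by (simp add: mult.assoc[symmetric] exp_add[symmetric])
  qed
  have "(\<lambda>n. exp (real N) * ?\<theta> ^ n) \<longlonglongrightarrow> exp (real N) * 0"
    using rate_bound_pos by (intro tendsto_mult tendsto_const LIMSEQ_power_zero) simp
  then have "measure clock_law S \<le> exp (real N) * 0"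
    by (rule LIMSEQ_le_const) (use bound in blast)
  then have "emeasure clock_law S = 0"
    by (simp add: K.emeasure_eq_measure measure_le_0_iff)
  then show ?thesis
    using S unfolding S_def by (subst AE_iff_measurable[OF _ refl]) auto
qed

lemma AE_good: "AE \<kappa> in clock_law. good (x, \<kappa>)"
proof -
  have "AE \<kappa> in clock_law. \<forall>n. 0 < holding ((after_event E ^^ n) (x, \<kappa>))"
    unfolding AE_all_countable by (simp add: AE_holding_pos)
  moreover have "AE \<kappa> in clock_law. \<forall>N. \<exists>n. real N < jump_time E (x, \<kappa>) n"
    unfolding AE_all_countable by (simp add: AE_jump_time_unbounded)
  ultimately show ?thesis
  proof eventually_elim
    case (elim \<kappa>)
    show ?case unfolding good_def
    proof (intro conjI allI)
      fix T :: real
      obtain N where "T < real N" using reals_Archimedean2 by blast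
      then show "\<exists>n. T < jump_time E (x, \<kappa>) n" using elim(2) by (meson less_trans)
    qed (use elim(1) in blast)
  qed
qed

end

section \<open>The Markov property\<close>

context queue
begin

definition elapsed :: "real \<Rightarrow> ('c, 's) timed \<Rightarrow> ('c, 's) timed" where
  "elapsed t k = (fst k, advance (enabled (fst k)) t (snd k))"

text \<open>The configuration at time \<open>t\<close> on the hypothesis that \<open>n\<close>
  events have occurred. Keeping \<open>n\<close> as a parameter lets statements about
  \<open>flow\<close> be proved by induction on \<open>n\<close>.\<close>

definition flow_after :: "nat \<Rightarrow> real \<Rightarrow> ('c, 's) timed \<Rightarrow> ('c, 's) timed" where
  "flow_after n t k = elapsed (t - jump_time E k n) ((after_event E ^^ n) k)"

definition flow :: "real \<Rightarrow> ('c, 's) timed \<Rightarrow> ('c, 's) timed" where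
  "flow t k = flow_after (jump_index E t k) t k"

definition in_period :: "nat \<Rightarrow> real \<Rightarrow> ('c, 's) timed \<Rightarrow> bool" where
  "in_period n t k \<longleftrightarrow> t < jump_time E k (Suc n) \<and> (\<forall>m<n. jump_time E k (Suc m) \<le> t)"

lemma advance_enabled: "e \<in> F \<Longrightarrow> advance F t \<kappa> (e, 0) = \<kappa> (e, 0) - t"
  by (simp add: advance_def)

lemma first_event_advance: "first_event (x, advance (enabled x) t \<kappa>) = first_event (x, \<kappa>)"
proof -
  have "is_arg_min (\<lambda>e. advance (enabled x) t \<kappa> (e, 0)) (\<lambda>e. e \<in> enabled x) =
      is_arg_min (\<lambda>e. \<kappa> (e, 0)) (\<lambda>e. e \<in> enabled x)"
    by (auto simp: is_arg_min_def fun_eq_iff advance_enabled)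
  then show ?thesis
    by (simp add: first_event_def arg_min_on_def arg_min_def)
qed

lemma holding_elapsed: "holding (elapsed t k) = holding k - t"
  by (cases k) (simp add: holding_def elapsed_def first_event_advance advance_enabled)

text \<open>After an event the other running clocks are differences with the clock of that event, so
  a common shift of all running clocks cancels.\<close>

lemma after_event_elapsed: "after_event E (elapsed t k) = after_event E k"
proof (cases k)
  case (Pair x \<kappa>)
  have "residual x e (advance (enabled x) t \<kappa>) = residual x e \<kappa>" if "e \<in> enabled x" for e
    using that by (auto simp: residual_def advance_def fun_eq_iff)
  then show ?thesis
    by (simp add: Pair after_event_def elapsed_def first_event_advance)
qed

lemma funpow_after_event_elapsed: "(after_event E ^^ Suc n) (elapsed t k) = (after_event E ^^ Suc n) k"
  unfolding funpow_Suc_right comp_apply after_event_elapsed ..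

lemma jump_time_0[simp]: "jump_time E k 0 = 0"
  by (simp add: jump_time_def)

lemma jump_time_elapsed: "jump_time E (elapsed t k) (Suc n) = jump_time E k (Suc n) - t"
  by (simp add: jump_time_Suc holding_elapsed after_event_elapsed)

lemma jump_time_add:
  "jump_time E k (m + n) = jump_time E k m + jump_time E ((after_event E ^^ m) k) n"
  by (induct m arbitrary: k) (simp_all add: jump_time_Suc funpow_swap1)

lemma jump_index_eqI: "in_period n t k \<Longrightarrow> jump_index E t k = n"
  unfolding jump_index_def in_period_def
  by (rule Least_equality) (auto simp: not_less[symmetric])

lemma good_in_period:
  assumes "good k" "0 \<le> t"
  shows "in_period (jump_index E t k) t k"
proof -
  obtain N where N: "t < jump_time E k N" using assms(1) by (auto simp: good_def)
  then obtain n where "N = Suc n" using assms(2) by (cases N) auto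
  with N have "t < jump_time E k (Suc n)" by simp
  then have "t < jump_time E k (Suc (jump_index E t k))"
    unfolding jump_index_def by (rule LeastI)
  moreover have "jump_time E k (Suc m) \<le> t" if "m < jump_index E t k" for m
    using that not_less_Least[of m "\<lambda>n. t < jump_time E k (Suc n)"] by (auto simp: jump_index_def)
  ultimately show ?thesis by (auto simp: in_period_def)
qed

lemma in_period_unique: "in_period n t k \<Longrightarrow> in_period m t k \<Longrightarrow> n = m"
  using jump_index_eqI by metis

lemma state_at_fst_flow: "state_at E t k = fst (flow t k)"
  by (simp add: state_at_def flow_def flow_after_def elapsed_def)

text \<open>The flow property of a single path: the configuration at time \<open>t\<close> has the
  jump times of \<open>k\<close> after \<open>t\<close>, moved by \<open>t\<close>, and visits the
  same states. Together with the law of \<open>flow t\<close> it yields the Markov property.\<close>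

lemma state_at_add:
  assumes k: "good k" and t: "0 \<le> t" and s: "0 \<le> s"
  shows "state_at E (t + s) k = state_at E s (flow t k)"
proof -
  let ?n = "jump_index E t k"
  define i where "i = jump_index E (t + s) k"
  have n: "in_period ?n t k" using good_in_period[OF k t] .
  have i: "in_period i (t + s) k" unfolding i_def using t s by (intro good_in_period k) simp
  have "?n \<le> i"
  proof (rule ccontr)
    assume "\<not> ?n \<le> i"
    then have "jump_time E k (Suc i) \<le> t" using n by (auto simp: in_period_def)
    with i s show False by (auto simp: in_period_def)
  qed
  then obtain j where j: "i = ?n + j" using le_Suc_ex by blast
  have time: "jump_time E (flow t k) (Suc m) = jump_time E k (Suc (?n + m)) - t" for m
    using jump_time_add[of k ?n "Suc m"] by (simp add: flow_def flow_after_def jump_time_elapsed)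
  have "in_period j s (flow t k)"
    using i unfolding in_period_def time j by (auto simp: algebra_simps dest!: spec[where x="?n + _"])
  then have ji: "jump_index E s (flow t k) = j" by (rule jump_index_eqI)
  have fl: "flow t k = elapsed (t - jump_time E k ?n) ((after_event E ^^ ?n) k)"
    by (simp add: flow_def flow_after_def)
  have "fst ((after_event E ^^ j) (flow t k)) = fst ((after_event E ^^ j) ((after_event E ^^ ?n) k))"
  \<comment> \<open>Before a further jump the two configurations differ in their clocks, although
    their states agree; from the next jump on they coincide.\<close>
  proof (cases j)
    case 0
    then show ?thesis by (simp add: fl elapsed_def)
  next
    case (Suc m)
    show ?thesis unfolding fl Suc funpow_after_event_elapsed ..
  qed
  also have "\<dots> = fst ((after_event E ^^ i) k)"
    by (simp add: j funpow_add add.commute[of ?n])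
  finally show ?thesis
    by (simp add: state_at_def ji i_def)
qed

lemma state_at_right_continuous:
  assumes k: "good k" and t: "0 \<le> t"
  shows "\<exists>\<epsilon>>0. \<forall>u\<in>{t..<t + \<epsilon>}. state_at E u k = state_at E t k"
proof -
  let ?n = "jump_index E t k"
  have n: "in_period ?n t k" using good_in_period[OF k t] .
  have "in_period ?n u k" if "u \<in> {t..<t + (jump_time E k (Suc ?n) - t)}" for u
    using n that by (auto simp: in_period_def intro: order_trans)
  then have "\<forall>u\<in>{t..<t + (jump_time E k (Suc ?n) - t)}. state_at E u k = state_at E t k"
    unfolding state_at_def by (metis jump_index_eqI)
  moreover have "0 < jump_time E k (Suc ?n) - t" using n by (auto simp: in_period_def)
  ultimately show ?thesis by blast
qed

lemma advance_measurable2: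
  assumes a: "a \<in> borel_measurable N" and b: "b \<in> measurable N clock_space"
  shows "(\<lambda>z. advance F (a z) (b z)) \<in> measurable N clock_space"
proof (rule measurable_into_clocks)
  fix j :: "('c, 's) event \<times> nat"
  have bj: "(\<lambda>z. b z j) \<in> borel_measurable N"
    by (rule measurable_compose[OF b measurable_clocks_component])
  have "(\<lambda>z. b z j - a z) \<in> borel_measurable N"
    by (rule borel_measurable_diff[OF bj a])
  then show "(\<lambda>z. advance F (a z) (b z) j) \<in> borel_measurable N"
    using bj by (cases j; cases "fst j \<in> F \<and> snd j = 0") (simp_all only: advance_def prod.case fst_conv snd_conv if_True if_False simp_thms)
qed

lemma elapsed_measurable:
  assumes a: "a \<in> borel_measurable N" and b: "b \<in> measurable N pair_space"
  shows "(\<lambda>z. elapsed (a z) (b z)) \<in> measurable N pair_space"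
  unfolding elapsed_def
  by (rule measurable_compose_countable[where f="\<lambda>x z. (x, advance (enabled x) (a z) (snd (b z)))"
        and g="\<lambda>z. fst (b z)"])
     (intro measurable_Pair measurable_const advance_measurable2 a measurable_compose[OF b measurable_snd]
        measurable_compose[OF b measurable_fst]; simp)+

lemma in_period_measurable:
  assumes a: "a \<in> borel_measurable N" and b: "b \<in> measurable N pair_space"
  shows "(\<lambda>z. of_bool (in_period n (a z) (b z)) :: ennreal) \<in> borel_measurable N"
proof -
  have j: "(\<lambda>z. jump_time E (b z) m) \<in> borel_measurable N" for m
    by (rule measurable_compose[OF b jump_time_measurable])
  have "{z \<in> space N. in_period n (a z) (b z)} = {z \<in> space N. a z < jump_time E (b z) (Suc n)} \<inter>
     {z \<in> space N. \<forall>m\<in>{..<n}. jump_time E (b z) (Suc m) \<le> a z}"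
    by (auto simp: in_period_def)
  also have "\<dots> \<in> sets N"
    by (intro sets.Int sets.sets_Collect_finite_All borel_measurable_less borel_measurable_le a j) simp
  finally have "indicator {z \<in> space N. in_period n (a z) (b z)} \<in> borel_measurable N"
    by (rule borel_measurable_indicator)
  then show ?thesis
    by (rule measurable_cong[THEN iffD1, rotated]) (simp add: indicator_def)
qed

lemma in_period_0: "in_period 0 t k \<longleftrightarrow> t < holding k"
  by (simp add: in_period_def jump_time_Suc)

lemma in_period_Suc:
  "in_period (Suc n) t k \<longleftrightarrow> holding k \<le> t \<and> in_period n (t - holding k) (after_event E k)"
  unfolding in_period_def All_less_Suc2 jump_time_Suc[of k]
  by (auto simp: algebra_simps)

lemma flow_after_Suc: "flow_after (Suc n) t k = flow_after n (t - holding k) (after_event E k)"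
  by (simp add: flow_after_def jump_time_Suc funpow_swap1 diff_diff_eq)

lemma less_holding_iff:
  fixes x :: "('c, 's) state"
  shows "t < holding (x, \<kappa>) \<longleftrightarrow> (\<forall>e\<in>enabled x. t < \<kappa> (e, 0))"
  using first_event_least[of _ x \<kappa>] first_event_enabled[of x \<kappa>]
  by (auto simp: holding_def intro: less_le_trans)

lemma nn_integral_in_period_0:
  assumes t: "0 \<le> t" and g: "g \<in> borel_measurable clock_space"
  shows "(\<E> \<kappa>. of_bool (t < holding (x, \<kappa>)) * g (advance (enabled x) t \<kappa>)) =
    ennreal (exp (- total_rate x * t)) * (\<E> \<kappa>. g \<kappa>)"
  using clock_law_memoryless[OF t g, of "enabled x"]
  unfolding less_holding_iff total_rate_def[symmetric] indicator_def mem_Collect_eq .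

text \<open>On the event of exactly \<open>n\<close> jumps up to time \<open>t\<close>, the clocks
  at \<open>t\<close> are fresh and independent of the state. For \<open>n = 0\<close> this is
  memorylessness; for \<open>Suc n\<close> condition on the first event and use the hypothesis for
  the remaining time.\<close>

lemma nn_integral_flow_after:
  assumes t: "0 \<le> t" and G: "G \<in> borel_measurable pair_space"
  shows "(\<E> \<kappa>. of_bool (in_period n t (x, \<kappa>)) * G (flow_after n t (x, \<kappa>))) =
    (\<E> \<kappa>. of_bool (in_period n t (x, \<kappa>)) * (\<E> \<kappa>'. G (fst (flow_after n t (x, \<kappa>)), \<kappa>')))"
  using t
proof (induct n arbitrary: x t)
  case 0
  have g: "(\<lambda>\<kappa>. G (x, \<kappa>)) \<in> borel_measurable clock_space"
    by (rule measurable_compose[OF Pair_measurable_clocks G])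
  have fa: "flow_after 0 t (x, \<kappa>) = (x, advance (enabled x) t \<kappa>)" for \<kappa>
    by (simp add: flow_after_def elapsed_def)
  show ?case
    unfolding in_period_0 fa fst_conv nn_integral_in_period_0[OF 0 g]
      nn_integral_in_period_0[OF 0 borel_measurable_const]
    by (simp add: emeasure_clock_law_UNIV)
next
  case (Suc n)
  define H where "H z = (\<E> \<kappa>'. G (z, \<kappa>'))" for z
  \<comment> \<open>The factor for \<open>y \<le> t\<close> keeps the remaining time
    \<open>t - y\<close> nonnegative where the hypothesis is used; beyond \<open>t\<close> both
    integrands below vanish.\<close>
  define I where "I y k = (of_bool (y \<le> t) * of_bool (in_period n (t - y) k) :: ennreal)" for y k
  define F where "F y k = I y k * G (flow_after n (t - y) k)" for y k
  define F' where "F' y k = I y k * H (fst (flow_after n (t - y) k))" for y k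
  let ?B = "(borel :: real measure) \<Otimes>\<^sub>M pair_space"
  have fst: "fst \<in> borel_measurable ?B" and snd: "snd \<in> measurable ?B pair_space"
    by (rule measurable_fst, rule measurable_snd)
  have tf: "(\<lambda>z. t - fst z) \<in> borel_measurable ?B"
    by (intro borel_measurable_diff borel_measurable_const fst)
  have le: "(\<lambda>z. of_bool (fst z \<le> t) :: ennreal) \<in> borel_measurable ?B"
  proof -
    have "(\<lambda>y :: real. of_bool (y \<le> t) :: ennreal) \<in> borel_measurable borel"
      by measurable
    from measurable_compose[OF fst this] show ?thesis .
  qed
  have I: "(\<lambda>z. I (fst z) (snd z)) \<in> borel_measurable ?B"
    unfolding I_def by (intro borel_measurable_times_ennreal le in_period_measurable[OF tf snd])
  have fl: "(\<lambda>z. flow_after n (t - fst z) (snd z)) \<in> measurable ?B pair_space"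
    unfolding flow_after_def
    by (intro elapsed_measurable borel_measurable_diff tf measurable_compose[OF snd jump_time_measurable]
        measurable_compose[OF snd funpow_after_event_measurable])
  have H: "H \<in> borel_measurable (count_space UNIV)"
    by simp
  have F: "(\<lambda>z. F (fst z) (snd z)) \<in> borel_measurable ?B"
    unfolding F_def by (intro borel_measurable_times_ennreal I measurable_compose[OF fl G])
  have F': "(\<lambda>z. F' (fst z) (snd z)) \<in> borel_measurable ?B"
    unfolding F'_def
    by (intro borel_measurable_times_ennreal I measurable_compose[OF measurable_compose[OF fl measurable_fst] H])
  have eq: "(\<E> \<kappa>. F y (z, \<kappa>)) = (\<E> \<kappa>. F' y (z, \<kappa>))" for y z
  proof (cases "y \<le> t")
    case True
    then show ?thesis
      using Suc.hyps[of "t - y" z] by (simp add: F_def F'_def I_def H_def)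
  next
    case False
    then show ?thesis by (simp add: F_def F'_def I_def)
  qed
  have "(\<E> \<kappa>. of_bool (in_period (Suc n) t (x, \<kappa>)) * G (flow_after (Suc n) t (x, \<kappa>))) =
    (\<E> \<kappa>. F (holding (x, \<kappa>)) (after_event E (x, \<kappa>)))"
    by (simp add: in_period_Suc flow_after_Suc F_def I_def of_bool_conj)
  also have "\<dots> = (\<E> \<kappa>. F' (holding (x, \<kappa>)) (after_event E (x, \<kappa>)))"
    unfolding nn_integral_holding_after_event[OF F] nn_integral_holding_after_event[OF F'] eq ..
  also have "\<dots> = (\<E> \<kappa>. of_bool (in_period (Suc n) t (x, \<kappa>)) * H (fst (flow_after (Suc n) t (x, \<kappa>))))"
    by (simp add: in_period_Suc flow_after_Suc F'_def I_def of_bool_conj)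
  finally show ?case unfolding H_def .
qed

lemma suminf_in_period:
  assumes k: "good k" and t: "0 \<le> t"
  shows "(\<Sum>n. of_bool (in_period n t k) * f n) = (f (jump_index E t k) :: ennreal)"
proof -
  have "(\<lambda>n. of_bool (in_period n t k) * f n) = (\<lambda>n. if n = jump_index E t k then f n else 0)"
    using good_in_period[OF k t] in_period_unique[of _ t k] by (auto simp: fun_eq_iff)
  then show ?thesis
    using sums_If_finite[of "\<lambda>n. n = jump_index E t k" f] by (simp add: sums_iff)
qed

text \<open>On good paths exactly one number of jumps belongs to each time, so the statement for
  fixed \<open>n\<close> can be summed over \<open>n\<close>.\<close>

lemma nn_integral_flow:
  assumes t: "0 \<le> t" and G: "G \<in> borel_measurable pair_space"
  shows "(\<E> \<kappa>. G (flow t (x, \<kappa>))) =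
    (\<E> \<kappa>. (\<E> \<kappa>'. G (state_at E t (x, \<kappa>), \<kappa>')))"
proof -
  define H where "H z = (\<E> \<kappa>'. G (z, \<kappa>'))" for z
  have H: "H \<in> borel_measurable (count_space UNIV)"
    by simp
  have P: "(\<lambda>\<kappa>. (x, \<kappa>)) \<in> measurable clock_law pair_space"
    unfolding measurable_clock_law by (rule Pair_measurable_clocks)
  have ip: "(\<lambda>\<kappa>. of_bool (in_period n t (x, \<kappa>)) :: ennreal) \<in> borel_measurable clock_law" for n
    by (rule in_period_measurable[OF borel_measurable_const P])
  have fl: "(\<lambda>\<kappa>. flow_after n t (x, \<kappa>)) \<in> measurable clock_law pair_space" for n
    unfolding flow_after_def
    by (intro elapsed_measurable borel_measurable_diff borel_measurable_const
        measurable_compose[OF P jump_time_measurable] measurable_compose[OF P funpow_after_event_measurable])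
  have "(\<E> \<kappa>. G (flow t (x, \<kappa>))) =
    (\<E> \<kappa>. (\<Sum>n. of_bool (in_period n t (x, \<kappa>)) * G (flow_after n t (x, \<kappa>))))"
    by (rule nn_integral_cong_AE, rule AE_mp[OF AE_good[of x]], rule AE_I2)
       (auto simp: suminf_in_period[OF _ t] flow_def)
  also have "\<dots> = (\<Sum>n. (\<E> \<kappa>. of_bool (in_period n t (x, \<kappa>)) * G (flow_after n t (x, \<kappa>))))"
    by (intro nn_integral_suminf borel_measurable_times_ennreal ip measurable_compose[OF fl G])
  also have "\<dots> = (\<Sum>n. (\<E> \<kappa>. of_bool (in_period n t (x, \<kappa>)) * H (fst (flow_after n t (x, \<kappa>)))))"
    unfolding nn_integral_flow_after[OF t G] H_def ..
  also have "\<dots> = (\<E> \<kappa>. (\<Sum>n. of_bool (in_period n t (x, \<kappa>)) * H (fst (flow_after n t (x, \<kappa>)))))"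
    by (intro nn_integral_suminf[symmetric] borel_measurable_times_ennreal ip
        measurable_compose[OF measurable_compose[OF fl measurable_fst] H])
  also have "\<dots> = (\<E> \<kappa>. H (state_at E t (x, \<kappa>)))"
    by (rule nn_integral_cong_AE, rule AE_mp[OF AE_good[of x]], rule AE_I2)
       (auto simp: suminf_in_period[OF _ t] state_at_fst_flow flow_def)
  finally show ?thesis unfolding H_def .
qed

end

text \<open>The bridge between \<open>has_sum\<close>, in which transition functions and stationary
  distributions are defined, and integrals over counting measures, in which the computations are
  done.\<close>

lemma nonneg_has_sum_iff_nn_integral:
  fixes g :: "'x \<Rightarrow> real"
  assumes g: "\<And>y. y \<in> S \<Longrightarrow> 0 \<le> g y" and c: "0 \<le> c"
  shows "(g has_sum c) S \<longleftrightarrow> (\<integral>\<^sup>+ y. ennreal (g y) \<partial>count_space S) = ennreal c"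
proof
  have nonneg: "AE y in count_space S. 0 \<le> g y"
    using g by (simp add: AE_count_space)
  {
    assume "(g has_sum c) S"
    then have sm: "g summable_on S" and c_eq: "infsum g S = c"
      by (auto simp: has_sum_imp_summable infsumI)
    then have abs: "Infinite_Set_Sum.abs_summable_on g S"
      using summable_on_iff_abs_summable_on_real abs_summable_equivalent by blast
    then have "integrable (count_space S) g"
      by (simp add: Infinite_Set_Sum.abs_summable_on_def)
    moreover have "integral\<^sup>L (count_space S) g = c"
      using infsetsum_infsum[OF abs] c_eq by (simp add: infsetsum_def)
    ultimately show "(\<integral>\<^sup>+ y. ennreal (g y) \<partial>count_space S) = ennreal c"
      using nn_integral_eq_integral[OF _ nonneg] by metis
  next
    assume eq: "(\<integral>\<^sup>+ y. ennreal (g y) \<partial>count_space S) = ennreal c"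
    then have int: "integrable (count_space S) g"
      by (intro integrableI_nn_integral_finite[OF _ nonneg]) auto
    then have "ennreal (integral\<^sup>L (count_space S) g) = ennreal c"
      using nn_integral_eq_integral[OF int nonneg] eq by metis
    then have c_eq: "integral\<^sup>L (count_space S) g = c"
      using c integral_nonneg_AE[OF nonneg] by (simp add: ennreal_inj)
    have abs: "Infinite_Set_Sum.abs_summable_on g S"
      using int by (simp add: Infinite_Set_Sum.abs_summable_on_def)
    then have "g summable_on S"
      using summable_on_iff_abs_summable_on_real abs_summable_equivalent by blast
    moreover have "infsum g S = c"
      using infsetsum_infsum[OF abs] c_eq by (simp add: infsetsum_def)
    ultimately show "(g has_sum c) S"
      using has_sum_infsum by blast
  }
qed

lemma nn_integral_discrete:
  fixes X :: "'w \<Rightarrow> 'x :: countable"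
  assumes X: "X \<in> measurable N (count_space UNIV)"
  shows "(\<integral>\<^sup>+ \<omega>. f (X \<omega>) \<partial>N) = (\<S> y. emeasure N {\<omega> \<in> space N. X \<omega> = y} * f y)"
proof -
  have "distr N (count_space UNIV) X = density (count_space UNIV) (\<lambda>y. emeasure N {\<omega> \<in> space N. X \<omega> = y})"
    (is "_ = ?D")
  proof (rule measure_eqI_countable[where A=UNIV])
    fix y
    have "emeasure (distr N (count_space UNIV) X) {y} = emeasure N (X -` {y} \<inter> space N)"
      by (rule emeasure_distr[OF X]) simp
    also have "X -` {y} \<inter> space N = {\<omega> \<in> space N. X \<omega> = y}" by auto
    finally show "emeasure (distr N (count_space UNIV) X) {y} = emeasure ?D {y}"
      by (simp add: emeasure_density nn_integral_count_space_indicator[symmetric])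
  qed auto
  then have "(\<integral>\<^sup>+ y. f y \<partial>distr N (count_space UNIV) X) = (\<integral>\<^sup>+ y. f y \<partial>?D)" by simp
  then show ?thesis
    by (simp add: nn_integral_distr[OF X] nn_integral_density)
qed

lemma next_state_closed:
  "x \<in> states E \<Longrightarrow> e \<in> enabled x \<Longrightarrow> next_state E e x \<in> states E"
proof (cases x; cases e)
  fix w i c
  assume x: "x \<in> states E" "x = (w, i)" "e = Arrival c"
  show "next_state E e x \<in> states E"
  proof (cases "List.extract (\<lambda>s. (s, c) \<in> E) i")
    case None
    then have "\<not> (\<exists>s\<in>set i. (s, c) \<in> E)" by (rule extract_None_iff[THEN iffD1])
    then show ?thesis using x None by (auto simp: states_def)
  next
    case (Some a)
    then obtain i1 s i2 where ex: "List.extract (\<lambda>s. (s, c) \<in> E) i = Some (i1, s, i2)" by (metis prod.collapse)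
    have nxt: "next_state E e x = (w, i1 @ i2)" using x ex by simp
    have "i = i1 @ s # i2" using extract_Some_iff[THEN iffD1, OF ex] by simp
    then show ?thesis using x unfolding nxt by (auto simp: states_def)
  qed
next
  fix w i s
  assume x: "x \<in> states E" "e \<in> enabled x" "x = (w, i)" "e = Completion s"
  show "next_state E e x \<in> states E"
  proof (cases "List.extract (\<lambda>c. (s, c) \<in> E) w")
    case None
    then have "\<not> (\<exists>c\<in>set w. (s, c) \<in> E)" by (rule extract_None_iff[THEN iffD1])
    then show ?thesis using x None by (auto simp: states_def)
  next
    case (Some a)
    then obtain w1 c w2 where ex: "List.extract (\<lambda>c. (s, c) \<in> E) w = Some (w1, c, w2)" by (metis prod.collapse)
    have nxt: "next_state E e x = (w1 @ w2, i)" using x ex by simp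
    have "w = w1 @ c # w2" using extract_Some_iff[THEN iffD1, OF ex] by simp
    then show ?thesis using x unfolding nxt by (auto simp: states_def)
  qed
qed

section \<open>The transition function and the finite-dimensional distributions\<close>

context queue
begin

definition trans_prob :: "real \<Rightarrow> ('c, 's) state \<Rightarrow> ('c, 's) state \<Rightarrow> real" where
  "trans_prob t x y = measure clock_law {\<kappa>. state_at E t (x, \<kappa>) = y}"

lemma fst_funpow_after_event_closed:
  assumes "fst k \<in> states E"
  shows "fst ((after_event E ^^ n) k) \<in> states E"
proof (induct n)
  case (Suc n)
  obtain x \<kappa> where eq: "(after_event E ^^ n) k = (x, \<kappa>)" by (metis prod.collapse)
  with Suc show ?case by (simp add: after_event_def next_state_closed)
qed (use assms in simp)

lemma state_at_closed: "x \<in> states E \<Longrightarrow> state_at E t (x, \<kappa>) \<in> states E"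
  unfolding state_at_def by (rule fst_funpow_after_event_closed) simp

lemma state_at_measurable1: "(\<lambda>\<kappa>. state_at E t (x, \<kappa>)) \<in> measurable clock_law (count_space UNIV)"
  unfolding measurable_clock_law
  by (rule measurable_compose[OF Pair_measurable_clocks state_at_measurable])

lemma emeasure_trans: "emeasure clock_law {\<kappa>. state_at E t (x, \<kappa>) = y} = ennreal (trans_prob t x y)"
  by (simp add: trans_prob_def K.emeasure_eq_measure)

lemma trans_prob_nonneg[simp]: "0 \<le> trans_prob t x y"
  by (simp add: trans_prob_def)

lemma trans_prob_le_1: "trans_prob t x y \<le> 1"
  by (simp add: trans_prob_def)

lemma trans_prob_outside: "x \<in> states E \<Longrightarrow> y \<notin> states E \<Longrightarrow> trans_prob t x y = 0"
proof -
  assume "x \<in> states E" "y \<notin> states E"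
  then have "{\<kappa>. state_at E t (x, \<kappa>) = y} = {}" using state_at_closed by blast
  then show ?thesis by (simp add: trans_prob_def)
qed

lemma nn_integral_state_at:
  "(\<E> \<kappa>. f (state_at E t (x, \<kappa>))) = (\<S> y. ennreal (trans_prob t x y) * f y)"
  using nn_integral_discrete[OF state_at_measurable1, of f t x] by (simp add: emeasure_trans)

lemma nn_integral_of_bool_state_at:
  "(\<E> \<kappa>. of_bool (state_at E t (x, \<kappa>) = y)) = ennreal (trans_prob t x y)"
proof -
  have "(\<S> z. ennreal (trans_prob t x z) * of_bool (z = y)) =
    (\<S> z. ennreal (trans_prob t x y) * indicator {y} z)"
    by (intro nn_integral_cong) (auto simp: indicator_def)
  also have "\<dots> = ennreal (trans_prob t x y)"
    by (subst nn_integral_cmult_indicator) auto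
  finally show ?thesis
    unfolding nn_integral_state_at[of "\<lambda>z. of_bool (z = y)"] .
qed

lemma nn_integral_states:
  "x \<in> states E \<Longrightarrow> (\<S> y. ennreal (trans_prob t x y) * f y) =
    (\<integral>\<^sup>+ y. ennreal (trans_prob t x y) * f y \<partial>count_space (states E))"
  by (rule nn_integral_count_space_eq) (auto simp: trans_prob_outside)

lemma trans_prob_has_sum: "x \<in> states E \<Longrightarrow> (trans_prob t x has_sum 1) (states E)"
  using nn_integral_state_at[of "\<lambda>_. 1" t x] nn_integral_states[of x t "\<lambda>_. 1"]
  by (subst nonneg_has_sum_iff_nn_integral) (simp_all add: emeasure_clock_law_UNIV)

lemma nn_integral_state_at_add:
  assumes "0 \<le> t" "0 \<le> s"
  shows "(\<E> \<kappa>. f (state_at E (t + s) (x, \<kappa>))) =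
    (\<E> \<kappa>. (\<E> \<kappa>'. f (state_at E s (state_at E t (x, \<kappa>), \<kappa>'))))"
proof -
  have "(\<E> \<kappa>. f (state_at E (t + s) (x, \<kappa>))) = (\<E> \<kappa>. f (state_at E s (flow t (x, \<kappa>))))"
    by (rule nn_integral_cong_AE, rule AE_mp[OF AE_good[of x]], rule AE_I2) (simp add: state_at_add assms)
  also have "\<dots> = (\<E> \<kappa>. (\<E> \<kappa>'. f (state_at E s (state_at E t (x, \<kappa>), \<kappa>'))))"
    by (rule nn_integral_flow[OF assms(1)]) (rule measurable_compose[OF state_at_measurable], simp)
  finally show ?thesis .
qed

lemma trans_prob_add:
  assumes "0 \<le> t" "0 \<le> s"
  shows "ennreal (trans_prob (t + s) x y) = (\<S> z. ennreal (trans_prob t x z) * ennreal (trans_prob s z y))"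
  using nn_integral_state_at_add[OF assms, of "\<lambda>z. of_bool (z = y)" x]
    nn_integral_state_at[of "\<lambda>z. ennreal (trans_prob s z y)" t x]
  by (simp add: nn_integral_of_bool_state_at)

lemma trans_prob_0: "trans_prob 0 x y = of_bool (x = y)"
proof -
  have "AE \<kappa> in clock_law. state_at E 0 (x, \<kappa>) = x"
    using AE_holding_pos[of 0 x]
  proof eventually_elim
    case (elim \<kappa>)
    then have "in_period 0 0 (x, \<kappa>)" by (simp add: in_period_0)
    then show ?case by (simp add: state_at_def jump_index_eqI)
  qed
  then have "(\<E> \<kappa>. of_bool (state_at E 0 (x, \<kappa>) = y)) = (\<E> \<kappa>. of_bool (x = y))"
    by (intro nn_integral_cong_AE) auto
  then show ?thesis
    unfolding nn_integral_of_bool_state_at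
    by (cases "x = y")
       (auto simp: emeasure_clock_law_UNIV ennreal_eq_0_iff intro: antisym)
qed

lemma state_at_less_holding: "t < holding k \<Longrightarrow> state_at E t k = fst k"
proof -
  assume "t < holding k"
  then have "in_period 0 t k" by (simp add: in_period_0)
  then show ?thesis by (simp add: state_at_def jump_index_eqI)
qed

lemma nn_integral_less_holding:
  "0 \<le> t \<Longrightarrow> (\<E> \<kappa>. of_bool (t < holding (x, \<kappa>))) = ennreal (exp (- total_rate x * t))"
  using nn_integral_in_period_0[of t "\<lambda>_. 1" x] by (simp add: emeasure_clock_law_UNIV)

lemma trans_prob_stay: "0 \<le> t \<Longrightarrow> exp (- total_rate x * t) \<le> trans_prob t x x"
proof -
  assume t: "0 \<le> t"
  have "(\<E> \<kappa>. of_bool (t < holding (x, \<kappa>))) \<le> (\<E> \<kappa>. of_bool (state_at E t (x, \<kappa>) = x))"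
    by (intro nn_integral_mono) (auto simp: state_at_less_holding)
  then show ?thesis
    unfolding nn_integral_less_holding[OF t] nn_integral_of_bool_state_at by (simp add: ennreal_le_iff)
qed

lemma trans_prob_add_le_1: "x \<noteq> y \<Longrightarrow> trans_prob t x x + trans_prob t x y \<le> 1"
proof -
  assume "x \<noteq> y"
  have "ennreal (trans_prob t x x) + ennreal (trans_prob t x y) =
    (\<E> \<kappa>. of_bool (state_at E t (x, \<kappa>) = x) + of_bool (state_at E t (x, \<kappa>) = y))"
    unfolding nn_integral_of_bool_state_at[symmetric]
    by (rule nn_integral_add[symmetric]; rule measurable_compose[OF state_at_measurable1]; simp)
  also have "\<dots> \<le> (\<E> \<kappa>. 1)"
    using \<open>x \<noteq> y\<close> by (intro nn_integral_mono) auto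
  finally have "ennreal (trans_prob t x x + trans_prob t x y) \<le> ennreal 1"
    by (simp add: emeasure_clock_law_UNIV)
  then show ?thesis by (subst (asm) ennreal_le_iff) auto
qed

lemma trans_prob_tendsto: "((\<lambda>t. trans_prob t x y) \<longlongrightarrow> of_bool (x = y)) (at_right 0)"
proof -
  have lim: "((\<lambda>t. exp (- total_rate x * t)) \<longlongrightarrow> exp (- total_rate x * 0)) (at_right 0)"
    by (intro tendsto_intros)
  have ev: "\<forall>\<^sub>F t in at_right 0. (0::real) \<le> t"
    by (simp add: eventually_at_right_less eventually_mono[OF eventually_at_right_less])
  show ?thesis
  proof (cases "x = y")
    case True
    show ?thesis
    proof (rule tendsto_sandwich)
      show "\<forall>\<^sub>F t in at_right 0. exp (- total_rate x * t) \<le> trans_prob t x y"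
        using ev by eventually_elim (use True trans_prob_stay in metis)
      show "\<forall>\<^sub>F t in at_right 0. trans_prob t x y \<le> 1"
        by (simp add: trans_prob_le_1)
    qed (use lim True in auto)
  next
    case False
    show ?thesis
    proof (rule tendsto_sandwich[where f="\<lambda>_. 0" and h="\<lambda>t. 1 - exp (- total_rate x * t)"])
      show "\<forall>\<^sub>F t in at_right 0. trans_prob t x y \<le> 1 - exp (- total_rate x * t)"
        using ev
      proof eventually_elim
        case (elim t)
        show ?case using trans_prob_stay[OF elim, of x] trans_prob_add_le_1[OF False, of t] by linarith
      qed
      show "((\<lambda>t. 1 - exp (- total_rate x * t)) \<longlongrightarrow> of_bool (x = y)) (at_right 0)"
        using tendsto_diff[OF tendsto_const[of 1] lim] False by simp
    qed (use False in auto)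
  qed
qed

lemma transition_function_trans_prob: "transition_function (states E) trans_prob"
  unfolding transition_function_def
proof (intro conjI allI impI ballI)
  fix s t :: real and x y
  assume st: "0 \<le> s" "0 \<le> t" and x: "x \<in> states E"
  have "ennreal (trans_prob (s + t) x y) = (\<integral>\<^sup>+ z. ennreal (trans_prob s x z) * ennreal (trans_prob t z y) \<partial>count_space (states E))"
    by (simp add: trans_prob_add[OF st] nn_integral_states[OF x])
  then show "((\<lambda>z. trans_prob s x z * trans_prob t z y) has_sum trans_prob (s + t) x y) (states E)"
    by (subst nonneg_has_sum_iff_nn_integral) (simp_all add: ennreal_mult')
qed (auto simp: trans_prob_has_sum trans_prob_0 trans_prob_tendsto)

lemma finite_dim_measurable:
  fixes n :: nat
  shows "(\<lambda>k. of_bool (\<forall>i\<le>n. state_at E (u i) k = y i) :: ennreal) \<in> borel_measurable pair_space"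
proof -
  have "{k \<in> space pair_space. \<forall>i\<in>{..n}. state_at E (u i) k = y i} \<in> sets pair_space"
  proof (intro sets.sets_Collect_finite_All)
    fix i
    have "state_at E (u i) -` {y i} \<inter> space pair_space \<in> sets pair_space"
      by (rule measurable_sets[OF state_at_measurable]) simp
    then show "{k \<in> space pair_space. state_at E (u i) k = y i} \<in> sets pair_space"
      by (simp add: vimage_def Int_def conj_commute)
  qed simp
  then have "indicator {k \<in> space pair_space. \<forall>i\<in>{..n}. state_at E (u i) k = y i} \<in> borel_measurable pair_space"
    by (rule borel_measurable_indicator)
  then show ?thesis
    by (rule measurable_cong[THEN iffD1, rotated]) (auto simp: indicator_def)
qed

text \<open>The Markov property is applied at the first time only: the remaining times, moved by
  \<open>u 0\<close>, are covered by the hypothesis for the process started in \<open>y 0\<close>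
  with fresh clocks.\<close>

lemma finite_dim_distribution:
  fixes u :: "nat \<Rightarrow> real"
  assumes "0 \<le> u 0" "\<And>i. i < n \<Longrightarrow> u i < u (Suc i)"
  shows "(\<E> \<kappa>. of_bool (\<forall>i\<le>n. state_at E (u i) (x, \<kappa>) = y i)) =
    ennreal (trans_prob (u 0) x (y 0) * (\<Prod>i<n. trans_prob (u (Suc i) - u i) (y i) (y (Suc i))))"
  using assms
proof (induct n arbitrary: u x y)
  case 0
  then show ?case by (simp add: nn_integral_of_bool_state_at)
next
  case (Suc n)
  have mono1: "u i < u (Suc i)" if "i < Suc n" for i
    using Suc.prems(2) that .
  have mono: "u 0 \<le> u i" if "i \<le> Suc n" for i
    using that
  proof (induct i)
    case (Suc i)
    then show ?case using mono1[of i] by simp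
  qed simp
  define P where "P k = (\<forall>i\<le>n. state_at E (u (Suc i) - u 0) k = y (Suc i))" for k
  define G where "G k = (of_bool (fst k = y 0) * of_bool (P k) :: ennreal)" for k
  have G: "G \<in> borel_measurable pair_space"
    unfolding G_def P_def
    by (intro borel_measurable_times_ennreal finite_dim_measurable)
       (rule measurable_compose[OF measurable_fst], simp)
  have step: "(\<E> \<kappa>'. G (z, \<kappa>')) = of_bool (z = y 0) *
      ennreal (\<Prod>i<Suc n. trans_prob (u (Suc i) - u i) (y i) (y (Suc i)))" for z
  proof (cases "z = y 0")
    case True
    have "(\<E> \<kappa>'. of_bool (P (y 0, \<kappa>'))) =
      ennreal (trans_prob (u (Suc 0) - u 0) (y 0) (y (Suc 0)) *
        (\<Prod>i<n. trans_prob (u (Suc (Suc i)) - u 0 - (u (Suc i) - u 0)) (y (Suc i)) (y (Suc (Suc i)))))"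
      unfolding P_def
      using Suc.prems mono[of "Suc 0"] by (intro Suc.hyps[of "\<lambda>i. u (Suc i) - u 0" "y 0" "\<lambda>i. y (Suc i)"]) auto
    then show ?thesis
      using True by (simp add: G_def prod.lessThan_Suc_shift del: prod.lessThan_Suc)
  qed (simp add: G_def)
  have "(\<E> \<kappa>. of_bool (\<forall>i\<le>Suc n. state_at E (u i) (x, \<kappa>) = y i)) =
    (\<E> \<kappa>. G (flow (u 0) (x, \<kappa>)))"
  proof (rule nn_integral_cong_AE, rule AE_mp[OF AE_good[of x]], rule AE_I2, rule impI)
    fix \<kappa> assume good: "good (x, \<kappa>)"
    have "state_at E (u (Suc i)) (x, \<kappa>) = state_at E (u (Suc i) - u 0) (flow (u 0) (x, \<kappa>))" if "i \<le> n" for i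
      using state_at_add[OF good Suc.prems(1), of "u (Suc i) - u 0"] mono[of "Suc i"] that by simp
    then have "(\<forall>i\<le>Suc n. state_at E (u i) (x, \<kappa>) = y i) \<longleftrightarrow>
      fst (flow (u 0) (x, \<kappa>)) = y 0 \<and> P (flow (u 0) (x, \<kappa>))"
      by (simp add: All_less_Suc2 P_def state_at_fst_flow flip: less_Suc_eq_le)
    then show "of_bool (\<forall>i\<le>Suc n. state_at E (u i) (x, \<kappa>) = y i) = G (flow (u 0) (x, \<kappa>))"
      by (simp add: G_def)
  qed
  also have "\<dots> = (\<E> \<kappa>. of_bool (state_at E (u 0) (x, \<kappa>) = y 0) *
      ennreal (\<Prod>i<Suc n. trans_prob (u (Suc i) - u i) (y i) (y (Suc i))))"
    unfolding nn_integral_flow[OF Suc.prems(1) G] step ..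
  also have "\<dots> = ennreal (trans_prob (u 0) x (y 0)) * ennreal (\<Prod>i<Suc n. trans_prob (u (Suc i) - u i) (y i) (y (Suc i)))"
    unfolding nn_integral_of_bool_state_at[symmetric]
    by (rule nn_integral_multc, rule measurable_compose[OF state_at_measurable1], simp)
  finally show ?case
    by (simp only: ennreal_mult' trans_prob_nonneg)
qed

end

section \<open>Transfer from the canonical clock law to the given random variables\<close>

locale driven_queue = queue E lam mu + M: prob_space M
  for E :: "('s::finite \<times> 'c::finite) set" and lam mu and M :: "'w measure" +
  fixes A :: "'c \<Rightarrow> nat \<Rightarrow> 'w \<Rightarrow> real" and B :: "'s \<Rightarrow> nat \<Rightarrow> 'w \<Rightarrow> real"
  assumes interarrival: "distributed M lborel (A c n) (exponential_density (lam c))"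
    and service: "distributed M lborel (B s n) (exponential_density (mu s))"
    and indep: "M.indep_vars (\<lambda>_. borel) (\<lambda>j. case j of Inl (c, n) \<Rightarrow> A c n | Inr (s, n) \<Rightarrow> B s n) UNIV"
begin

definition clocks :: "'w \<Rightarrow> ('c, 's) clocks" where
  "clocks \<omega> = (\<lambda>(e, n). case e of Arrival c \<Rightarrow> A c n \<omega> | Completion s \<Rightarrow> B s n \<omega>)"

abbreviation X where "X \<equiv> fcfs_alis E A B"

lemma X_eq: "X x t \<omega> = state_at E t (x, clocks \<omega>)"
  unfolding clocks_def using fcfs_alis_state_at[of E A B x t \<omega>] .

lemma A_measurable: "A c n \<in> borel_measurable M"
  using distributed_measurable[OF interarrival] unfolding measurable_lborel1 .

lemma B_measurable: "B s n \<in> borel_measurable M"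
  using distributed_measurable[OF service] unfolding measurable_lborel1 .

lemma clocks_measurable: "clocks \<in> measurable M clock_space"
proof (rule measurable_into_clocks)
  fix j :: "('c, 's) event \<times> nat"
  obtain e n where j: "j = (e, n)" by (rule prod.exhaust)
  show "(\<lambda>\<omega>. clocks \<omega> j) \<in> borel_measurable M"
    unfolding clocks_def j prod.case by (cases e) (simp_all only: event.case A_measurable B_measurable)
qed

lemma distr_exp_law:
  assumes "distributed M lborel Y (exponential_density r)"
  shows "distr M borel Y = exp_law r"
proof -
  have "distr M borel Y = distr M lborel Y"
    by (rule distr_cong[OF refl sets_lborel[symmetric] refl])
  also have "\<dots> = exp_law r"
    by (rule distributed_distr_eq_density[OF assms])
  finally show ?thesis .
qed

text \<open>Independence is stated for a family indexed by a sum type. The injection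
  \<open>p\<close> renames the indices to pairs of an event and a number, and reindexing along an
  injection turns a product measure into a product measure.\<close>

lemma distr_clocks: "distr M clock_space clocks = clock_law"
proof -
  define Y where "Y j = (case j of Inl (c, n) \<Rightarrow> A c n | Inr (s, n) \<Rightarrow> B s n)" for j
  define p where "p = (\<lambda>(e :: ('c, 's) event, n :: nat). case e of Arrival c \<Rightarrow> Inl (c, n) | Completion s \<Rightarrow> Inr (s, n))"
  have Y: "Y j \<in> borel_measurable M" for j
    by (cases j; cases "projl j"; cases "projr j")
       (simp_all only: Y_def sum.case prod.case A_measurable B_measurable sum.sel)
  have "distr M (PiM UNIV (\<lambda>_. borel)) (\<lambda>\<omega>. \<lambda>j\<in>UNIV. Y j \<omega>) = PiM UNIV (\<lambda>j. distr M borel (Y j))"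
    using indep unfolding Y_def[abs_def, symmetric]
    by (subst M.indep_vars_iff_distr_eq_PiM'[OF UNIV_not_empty Y, symmetric])
  then have eq: "distr M (PiM UNIV (\<lambda>_. borel)) (\<lambda>\<omega> j. Y j \<omega>) = PiM UNIV (\<lambda>j. distr M borel (Y j))"
    by (simp add: restrict_def)
  have ps: "prob_space (distr M borel (Y j))" for j
    by (rule M.prob_space_distr[OF Y])
  have law: "distr M borel (Y (p j)) = exp_law (rate (fst j))" for j
  proof (cases j)
    case (Pair e n)
    show ?thesis
    proof (cases e)
      case (Arrival c)
      then show ?thesis
        using distr_exp_law[OF interarrival] by (simp add: Pair p_def Y_def rate_def)
    next
      case (Completion s)
      then show ?thesis
        using distr_exp_law[OF service] by (simp add: Pair p_def Y_def rate_def)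
    qed
  qed
  have inj: "inj p"
    by (rule injI) (auto simp: p_def split: event.splits)
  have m1: "(\<lambda>\<omega> j. Y j \<omega>) \<in> measurable M (PiM UNIV (\<lambda>_. borel))"
    by (rule measurable_PiM_single'[OF Y]) simp
  have m2: "(\<lambda>z n. z (p n)) \<in> measurable (PiM UNIV (\<lambda>_. borel)) clock_space"
    by (rule measurable_into_clocks) (rule measurable_component_singleton, simp)
  have "distr (PiM UNIV (\<lambda>j. distr M borel (Y j))) (PiM UNIV (\<lambda>i. distr M borel (Y (p i)))) (\<lambda>z. \<lambda>n\<in>UNIV. z (p n)) =
      PiM UNIV (\<lambda>i. distr M borel (Y (p i)))"
    by (rule distr_PiM_reindex[OF ps inj]) simp
  then have "clock_law = distr (PiM UNIV (\<lambda>j. distr M borel (Y j))) clock_law (\<lambda>z n. z (p n))"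
    unfolding law clock_law_def[symmetric] by (simp add: restrict_def)
  also have "\<dots> = distr (PiM UNIV (\<lambda>j. distr M borel (Y j))) clock_space (\<lambda>z n. z (p n))"
    by (rule distr_cong[OF refl sets_clock_law refl])
  also have "\<dots> = distr M clock_space (\<lambda>\<omega>. (\<lambda>z n. z (p n)) (\<lambda>j. Y j \<omega>))"
    unfolding eq[symmetric] by (subst distr_distr[OF m2 m1]) (simp add: comp_def)
  also have "(\<lambda>\<omega>. (\<lambda>z n. z (p n)) (\<lambda>j. Y j \<omega>)) = clocks"
    by (auto simp: fun_eq_iff clocks_def p_def Y_def split: event.splits)
  finally show ?thesis by simp
qed

lemma nn_integral_clocks:
  "f \<in> borel_measurable clock_space \<Longrightarrow> (\<integral>\<^sup>+ \<omega>. f (clocks \<omega>) \<partial>M) = (\<E> \<kappa>. f \<kappa>)"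
  unfolding distr_clocks[symmetric] by (rule nn_integral_distr[OF clocks_measurable, symmetric]) simp

lemma AE_clocks: "AE \<kappa> in clock_law. P \<kappa> \<Longrightarrow> AE \<omega> in M. P (clocks \<omega>)"
  unfolding distr_clocks[symmetric] by (rule AE_distrD[OF clocks_measurable])

lemma prob_clocks:
  assumes S: "S \<in> sets clock_space"
  shows "measure M {\<omega> \<in> space M. clocks \<omega> \<in> S} = measure clock_law S"
  unfolding distr_clocks[symmetric]
  by (subst measure_distr[OF clocks_measurable S]) (auto intro: arg_cong[where f="measure M"])

lemma state_at_sets: "{\<kappa>. state_at E t (x, \<kappa>) = y} \<in> sets clock_space"
proof -
  have "(\<lambda>\<kappa>. state_at E t (x, \<kappa>)) -` {y} \<inter> space clock_space \<in> sets clock_space"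
    by (rule measurable_sets[OF measurable_compose[OF Pair_measurable_clocks state_at_measurable]]) simp
  then show ?thesis by (simp add: space_PiM vimage_def)
qed

lemma transition_prob_eq: "transition_prob M X = trans_prob"
proof (intro ext)
  fix t x y
  show "transition_prob M X t x y = trans_prob t x y"
    using prob_clocks[OF state_at_sets, of t x y] by (simp add: transition_prob_def X_eq trans_prob_def)
qed

lemma finite_dim_prob:
  fixes u :: "nat \<Rightarrow> real"
  assumes "0 \<le> u 0" "\<And>i. i < n \<Longrightarrow> u i < u (Suc i)"
  shows "\<P>(\<omega> in M. \<forall>i\<le>n. X x (u i) \<omega> = y i) =
    trans_prob (u 0) x (y 0) * (\<Prod>i<n. trans_prob (u (Suc i) - u i) (y i) (y (Suc i)))"
proof -
  define S where "S = {\<kappa>. \<forall>i\<le>n. state_at E (u i) (x, \<kappa>) = y i}"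
  have "S = (\<Inter>i\<in>{..n}. {\<kappa>. state_at E (u i) (x, \<kappa>) = y i})"
    by (auto simp: S_def)
  also have "\<dots> \<in> sets clock_space"
    by (intro sets.finite_INT state_at_sets) auto
  finally have S: "S \<in> sets clock_space" .
  have "ennreal (measure clock_law S) = (\<E> \<kappa>. indicator S \<kappa>)"
    using S by (simp add: K.emeasure_eq_measure sets_clock_law)
  also have "\<dots> = (\<E> \<kappa>. of_bool (\<forall>i\<le>n. state_at E (u i) (x, \<kappa>) = y i))"
    by (rule nn_integral_cong) (simp add: S_def indicator_def)
  also have "\<dots> = ennreal (trans_prob (u 0) x (y 0) * (\<Prod>i<n. trans_prob (u (Suc i) - u i) (y i) (y (Suc i))))"
    by (rule finite_dim_distribution) (use assms in auto)
  finally have "measure clock_law S = trans_prob (u 0) x (y 0) * (\<Prod>i<n. trans_prob (u (Suc i) - u i) (y i) (y (Suc i)))"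
    by (subst (asm) ennreal_inj) (auto intro!: mult_nonneg_nonneg prod_nonneg)
  then show ?thesis
    using prob_clocks[OF S] by (simp add: S_def X_eq)
qed

lemma X_measurable: "x \<in> states E \<Longrightarrow> X x t \<in> measurable M (count_space (states E))"
proof -
  assume x: "x \<in> states E"
  have "(\<lambda>\<omega>. state_at E t (x, clocks \<omega>)) \<in> measurable M (count_space UNIV)"
    by (rule measurable_compose[OF clocks_measurable measurable_compose[OF Pair_measurable_clocks state_at_measurable]])
  then have "X x t -` S \<inter> space M \<in> sets M" for S
    unfolding X_eq[abs_def] by (rule measurable_sets) simp
  then show ?thesis
    by (intro measurableI) (auto simp: X_eq state_at_closed x)
qed

lemma AE_good_clocks: "AE \<omega> in M. good (x, clocks \<omega>)"
  by (rule AE_clocks[OF AE_good])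

text \<open>The conditional probability is a quotient of two finite-dimensional distributions, of
  which only the last factor remains.\<close>

lemma markov_chain_X:
  assumes x: "x \<in> states E"
  shows "markov_chain M (states E) (transition_prob M X) (X x)"
  unfolding markov_chain_def transition_prob_eq
proof (intro conjI allI impI)
  show "AE \<omega> in M. \<forall>t\<ge>0. \<exists>\<epsilon>>0. \<forall>u\<in>{t..<t + \<epsilon>}. X x u \<omega> = X x t \<omega>"
    using AE_good_clocks[of x] by eventually_elim (simp add: X_eq state_at_right_continuous)
next
  fix n :: nat and t :: "nat \<Rightarrow> real" and y :: "nat \<Rightarrow> ('c, 's) state"
  assume t: "0 \<le> t 0" "\<forall>i\<le>n. t i < t (Suc i)"
    and pos: "\<P>(\<omega> in M. \<forall>i\<le>n. X x (t i) \<omega> = y i) \<noteq> 0"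
  have p1: "\<P>(\<omega> in M. \<forall>i\<le>n. X x (t i) \<omega> = y i) =
      trans_prob (t 0) x (y 0) * (\<Prod>i<n. trans_prob (t (Suc i) - t i) (y i) (y (Suc i)))"
    using t by (intro finite_dim_prob) auto
  have p2: "\<P>(\<omega> in M. \<forall>i\<le>Suc n. X x (t i) \<omega> = y i) =
      trans_prob (t 0) x (y 0) * (\<Prod>i<Suc n. trans_prob (t (Suc i) - t i) (y i) (y (Suc i)))"
    using t by (intro finite_dim_prob) auto
  have "\<P>(\<omega> in M. X x (t (Suc n)) \<omega> = y (Suc n) \<and> (\<forall>i\<le>n. X x (t i) \<omega> = y i)) =
      \<P>(\<omega> in M. \<forall>i\<le>Suc n. X x (t i) \<omega> = y i)"
    by (rule arg_cong[where f="measure M"]) (auto simp: le_Suc_eq)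
  then show "\<P>(\<omega> in M. X x (t (Suc n)) \<omega> = y (Suc n) \<bar> \<forall>i\<le>n. X x (t i) \<omega> = y i) =
      trans_prob (t (Suc n) - t n) (y n) (y (Suc n))"
    using pos unfolding cond_prob_def p2 p1 by simp
qed (use x in \<open>simp_all add: M.prob_space_axioms transition_function_trans_prob X_measurable\<close>)

end

section \<open>The balance equations\<close>

text \<open>The common shape of the two products in \<open>product_form\<close>, with the roles of
  customers and servers exchanged. The identities below are proved once and used for both.\<close>

definition list_weight :: "('a \<Rightarrow> real) \<Rightarrow> ('a set \<Rightarrow> real) \<Rightarrow> 'a list \<Rightarrow> real" where
  "list_weight f h L = (\<Prod>k<length L. f (L ! k) / h (set (take (Suc k) L)))"

lemma list_weight_Nil[simp]: "list_weight f h [] = 1"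
  by (simp add: list_weight_def)

lemma list_weight_snoc: "list_weight f h (L @ [b]) = list_weight f h L * (f b / h (insert b (set L)))"
proof -
  have "(\<Prod>k<length L. f ((L @ [b]) ! k) / h (set (take (Suc k) (L @ [b])))) =
    (\<Prod>k<length L. f (L ! k) / h (set (take (Suc k) L)))"
    by (rule prod.cong) (auto simp: nth_append)
  then show ?thesis by (simp add: list_weight_def)
qed

lemma list_weight_pos:
  assumes "\<And>a. 0 < f a" "\<And>X. X \<noteq> {} \<Longrightarrow> 0 < h X"
  shows "0 < list_weight f h L"
  unfolding list_weight_def
proof (intro prod_pos divide_pos_pos assms ballI)
  show "set (take (Suc k) L) \<noteq> {}" if "k \<in> {..<length L}" for k
    using that by (cases L) auto
qed

text \<open>With \<open>D\<^sub>k = h {L\<^sub>1, \<dots>, L\<^sub>k}\<close> and \<open>D'\<^sub>k = h {L\<^sub>1, \<dots>, L\<^sub>k, a}\<close>, dividing by the right-hand side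
  turns the sum into \<open>\<Sum>\<^sub>k (1 - D\<^sub>k / D'\<^sub>k) (\<Prod>\<^sub>j\<^sub>>\<^sub>k D\<^sub>j / D'\<^sub>j)\<close>, which telescopes to \<open>1\<close> since \<open>D\<^sub>0 = 0\<close>.\<close>

lemma sum_list_weight_insertions:
  assumes h0: "h {} = 0" and h: "\<And>X. X \<noteq> {} \<Longrightarrow> 0 < h X"
  shows "(\<Sum>k\<le>length L. (h (insert a (set (take k L))) - h (set (take k L))) *
      list_weight f h (take k L @ a # drop k L)) = f a * list_weight f h L"
proof (induct L rule: rev_induct)
  case Nil
  then show ?case
    using list_weight_snoc[of f h "[]" a] h[of "{a}"] by (simp add: h0)
next
  case (snoc b L)
  define H where "H = h (insert a (insert b (set L)))"
  define Hb where "Hb = h (insert b (set L))"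
  have pos: "0 < H" "0 < Hb" using h by (auto simp: H_def Hb_def)
  have ins: "list_weight f h (take k (L @ [b]) @ a # drop k (L @ [b])) =
      list_weight f h (take k L @ a # drop k L) * (f b / H)" if "k \<le> length L" for k
  proof -
    have "set (take k L) \<union> set (drop k L) = set L"
      by (metis append_take_drop_id set_append)
    then have "insert b (set (take k L @ a # drop k L)) = insert a (insert b (set L))"
      by auto
    then show ?thesis
      using list_weight_snoc[of f h "take k L @ a # drop k L" b] that by (simp add: H_def)
  qed
  have last: "list_weight f h (L @ [b] @ [a]) = list_weight f h (L @ [b]) * (f a / H)"
    using list_weight_snoc[of f h "L @ [b]" a] by (simp add: H_def)
  define t where "t k = (h (insert a (set (take k (L @ [b])))) - h (set (take k (L @ [b])))) *
      list_weight f h (take k (L @ [b]) @ a # drop k (L @ [b]))" for k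
  have "sum t {..length L} = (\<Sum>k\<le>length L. (h (insert a (set (take k L))) - h (set (take k L))) *
      list_weight f h (take k L @ a # drop k L)) * (f b / H)"
    unfolding sum_distrib_right
  proof (rule sum.cong[OF refl])
    fix k assume "k \<in> {..length L}"
    then show "t k = (h (insert a (set (take k L))) - h (set (take k L))) *
      list_weight f h (take k L @ a # drop k L) * (f b / H)"
      unfolding t_def using ins[of k] by (simp only: mult.assoc atMost_iff) simp
  qed
  moreover have "t (Suc (length L)) = (H - Hb) * (list_weight f h (L @ [b]) * (f a / H))"
    using last by (simp add: t_def H_def Hb_def)
  ultimately have "sum t {..length (L @ [b])} =
    (\<Sum>k\<le>length L. (h (insert a (set (take k L))) - h (set (take k L))) *
      list_weight f h (take k L @ a # drop k L)) * (f b / H) +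
    (H - Hb) * (list_weight f h (L @ [b]) * (f a / H))"
    by simp
  also have "\<dots> = f a * list_weight f h L * (f b / H) + (H - Hb) * (list_weight f h (L @ [b]) * (f a / H))"
    by (simp only: snoc)
  finally show ?case
    using pos unfolding t_def by (simp add: list_weight_snoc Hb_def[symmetric] field_simps)
qed

text \<open>Only the last entry of \<open>L\<close> contributes, and \<open>h (set L)\<close>
  cancels the last denominator; for the empty list both sides are 0. This is the inflow by customers
  who join the queue, or by servers that become idle.\<close>

lemma sum_list_weight_butlast:
  assumes h0: "h {} = 0" and h: "\<And>X. X \<noteq> {} \<Longrightarrow> 0 < h X"
  shows "(\<Sum>b\<in>UNIV. f b * (\<Sum>L'\<in>{L'. L = L' @ [b]}. list_weight f h L')) =
    list_weight f h L * h (set (L :: 'a :: finite list))"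
proof (cases L rule: rev_cases)
  case Nil
  then show ?thesis by (simp add: h0)
next
  case (snoc L0 b0)
  have "(\<Sum>b\<in>UNIV. f b * (\<Sum>L'\<in>{L'. L = L' @ [b]}. list_weight f h L')) =
    (\<Sum>b\<in>UNIV. if b = b0 then f b0 * list_weight f h L0 else 0)"
    by (rule sum.cong) (auto simp: snoc)
  also have "\<dots> = f b0 * list_weight f h L0" by simp
  also have "\<dots> = list_weight f h L * h (set L)"
    using h[of "insert b0 (set L0)"] by (simp add: snoc list_weight_snoc)
  finally show ?thesis .
qed

text \<open>The lists from which \<open>List.extract\<close> for the partner \<open>b\<close> leaves
  \<open>L\<close>: the inserted entry is the first one compatible with \<open>b\<close>. The set
  \<open>T\<close> will consist of the entries whose presence makes the predecessor an admissible
  state.\<close>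

definition insertions :: "('a \<Rightarrow> 'b \<Rightarrow> bool) \<Rightarrow> 'a set \<Rightarrow> 'a list \<Rightarrow> 'b \<Rightarrow> 'a list set" where
  "insertions R T L b = {L1 @ a # L2 | L1 a L2. L = L1 @ L2 \<and> a \<in> T \<and> R a b \<and> (\<forall>a'\<in>set L1. \<not> R a' b)}"

lemma insertions_eq_image:
  "insertions R T L b = (\<lambda>(k, a). take k L @ a # drop k L) `
     {(k, a). k \<le> length L \<and> a \<in> T \<and> R a b \<and> (\<forall>a'\<in>set (take k L). \<not> R a' b)}" (is "?I = ?F ` ?K")
proof
  show "?I \<subseteq> ?F ` ?K"
  proof
    fix L' assume "L' \<in> ?I"
    then obtain L1 a L2 where *: "L' = L1 @ a # L2" "L = L1 @ L2" "a \<in> T" "R a b" "\<forall>a'\<in>set L1. \<not> R a' b"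
      by (auto simp: insertions_def)
    then show "L' \<in> ?F ` ?K" by (intro image_eqI[of _ _ "(length L1, a)"]) auto
  qed
  show "?F ` ?K \<subseteq> ?I"
    unfolding insertions_def by (auto intro!: exI simp: append_take_drop_id)
qed

text \<open>\<open>List.extract\<close> recovers both the position and the inserted entry.\<close>

lemma inj_on_insertions:
  "inj_on (\<lambda>(k, a). take k L @ a # drop k L)
     {(k, a). k \<le> length L \<and> a \<in> T \<and> R a b \<and> (\<forall>a'\<in>set (take k L). \<not> R a' b)}"
proof (rule inj_onI, safe)
  fix k a k' a'
  assume a: "k \<le> length L" "R a b" "\<forall>a'\<in>set (take k L). \<not> R a' b"
    and a': "k' \<le> length L" "R a' b" "\<forall>a'\<in>set (take k' L). \<not> R a' b"
    and eq: "take k L @ a # drop k L = take k' L @ a' # drop k' L"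
  have "List.extract (\<lambda>x. R x b) (take k L @ a # drop k L) = Some (take k L, a, drop k L)"
    using a by (simp add: extract_Some_iff)
  moreover have "List.extract (\<lambda>x. R x b) (take k L @ a # drop k L) = Some (take k' L, a', drop k' L)"
    unfolding eq using a' by (simp add: extract_Some_iff)
  ultimately have *: "take k L = take k' L" "a = a'" by auto
  from arg_cong[OF *(1), of length] a a' show "k = k'" by simp
  show "a = a'" by fact
qed

lemma finite_insertions: "finite (insertions R T (L :: 'a :: finite list) b)"
proof -
  have "{(k, a). k \<le> length L \<and> a \<in> T \<and> R a b \<and> (\<forall>a'\<in>set (take k L). \<not> R a' b)} \<subseteq> {..length L} \<times> UNIV"
    by auto
  then show ?thesis
    unfolding insertions_eq_image by (intro finite_imageI) (rule finite_subset, auto)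
qed

text \<open>For a fixed entry \<open>a\<close> and position \<open>k\<close>, the partners that pick
  this entry are those compatible with \<open>a\<close> but with none of the first \<open>k\<close>
  entries. Their rates sum to the increment of \<open>h\<close> caused by \<open>a\<close>, which is
  the coefficient in the telescoping sum over the positions.\<close>

lemma sum_insertions:
  fixes R :: "'a :: finite \<Rightarrow> 'b :: finite \<Rightarrow> bool"
  assumes g: "\<And>b. 0 < g b" and R: "\<And>a. \<exists>b. R a b"
  defines "h \<equiv> \<lambda>X. sum g {b. \<exists>a\<in>X. R a b}"
  shows "(\<Sum>b\<in>UNIV. g b * (\<Sum>L'\<in>insertions R T L b. list_weight f h L')) = sum f T * list_weight f h L"
proof -
  have h0: "h {} = 0" by (simp add: h_def)
  have h: "0 < h X" if "X \<noteq> {}" for X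
  proof -
    from that obtain a where "a \<in> X" by blast
    moreover obtain b where "R a b" using R by blast
    ultimately show ?thesis unfolding h_def by (intro sum_pos g) auto
  qed
  define W where "W k a = list_weight f h (take k L @ a # drop k L)" for k a
  define c where "c k a b \<longleftrightarrow> R a b \<and> (\<forall>a'\<in>set (take k L). \<not> R a' b)" for k a b
  have "(\<Sum>L'\<in>insertions R T L b. list_weight f h L') =
      (\<Sum>a\<in>T. \<Sum>k\<le>length L. if c k a b then W k a else 0)" for b
  proof -
    have "(\<Sum>L'\<in>insertions R T L b. list_weight f h L') =
      (\<Sum>(k, a)\<in>{(k, a). k \<le> length L \<and> a \<in> T \<and> R a b \<and> (\<forall>a'\<in>set (take k L). \<not> R a' b)}. W k a)"
      unfolding insertions_eq_image
      by (subst sum.reindex[OF inj_on_insertions]) (auto intro!: sum.cong simp: W_def)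
    also have "\<dots> = (\<Sum>(k, a)\<in>{..length L} \<times> T. if c k a b then W k a else 0)"
      by (rule sum.mono_neutral_cong_left) (auto simp: c_def split: if_splits)
    also have "\<dots> = (\<Sum>k\<le>length L. \<Sum>a\<in>T. if c k a b then W k a else 0)"
      by (simp add: sum.cartesian_product)
    also have "\<dots> = (\<Sum>a\<in>T. \<Sum>k\<le>length L. if c k a b then W k a else 0)"
      by (rule sum.swap)
    finally show ?thesis .
  qed
  then have "(\<Sum>b\<in>UNIV. g b * (\<Sum>L'\<in>insertions R T L b. list_weight f h L')) =
      (\<Sum>b\<in>UNIV. \<Sum>a\<in>T. \<Sum>k\<le>length L. g b * (if c k a b then W k a else 0))"
    by (simp add: sum_distrib_left)
  also have "\<dots> = (\<Sum>a\<in>T. \<Sum>b\<in>UNIV. \<Sum>k\<le>length L. g b * (if c k a b then W k a else 0))"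
    by (rule sum.swap)
  also have "\<dots> = (\<Sum>a\<in>T. \<Sum>k\<le>length L. \<Sum>b\<in>UNIV. g b * (if c k a b then W k a else 0))"
    by (intro sum.cong refl sum.swap)
  also have "\<dots> = (\<Sum>a\<in>T. \<Sum>k\<le>length L. (h (insert a (set (take k L))) - h (set (take k L))) * W k a)"
  proof (intro sum.cong refl)
    fix a k
    have "(\<Sum>b\<in>UNIV. g b * (if c k a b then W k a else 0)) = (\<Sum>b\<in>{b. c k a b}. g b * W k a)"
      by (rule sum.mono_neutral_cong_right) auto
    also have "\<dots> = sum g {b. c k a b} * W k a" by (simp add: sum_distrib_right)
    also have "sum g {b. c k a b} = h (insert a (set (take k L))) - h (set (take k L))"
    proof -
      have "{b. \<exists>a'\<in>insert a (set (take k L)). R a' b} = {b. c k a b} \<union> {b. \<exists>a'\<in>set (take k L). R a' b}"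
        by (auto simp: c_def)
      moreover have "{b. c k a b} \<inter> {b. \<exists>a'\<in>set (take k L). R a' b} = {}"
        by (auto simp: c_def)
      ultimately show ?thesis
        unfolding h_def by (subst sum.union_disjoint[symmetric, THEN eq_diff_eq[THEN iffD2, rotated]]) auto
    qed
    finally show "(\<Sum>b\<in>UNIV. g b * (if c k a b then W k a else 0)) =
        (h (insert a (set (take k L))) - h (set (take k L))) * W k a" .
  qed
  also have "\<dots> = (\<Sum>a\<in>T. f a * list_weight f h L)"
    unfolding W_def by (intro sum.cong refl sum_list_weight_insertions h0 h)
  finally show ?thesis by (simp add: sum_distrib_right)
qed

lemma sum_event:
  fixes f :: "('c::finite, 's::finite) event \<Rightarrow> real"
  shows "(\<Sum>e\<in>UNIV. f e) = (\<Sum>c\<in>UNIV. f (Arrival c)) + (\<Sum>s\<in>UNIV. f (Completion s))"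
  unfolding UNIV_event
  by (subst sum.union_disjoint) (auto simp: sum.reindex inj_on_def)

section \<open>Predecessors of a state, and the balance equations\<close>

context queue
begin

abbreviation form :: "('c, 's) state \<Rightarrow> real" where
  "form \<equiv> product_form E lam mu"

definition cust_weight :: "'c list \<Rightarrow> real" where
  "cust_weight = list_weight lam (\<lambda>C. sum mu (servers_of E C))"

definition serv_weight :: "'s list \<Rightarrow> real" where
  "serv_weight = list_weight mu (\<lambda>S. sum lam (customers_of E S))"

lemma form_eq: "form (w, i) = cust_weight w * serv_weight i"
  by (simp add: product_form_def cust_weight_def serv_weight_def list_weight_def)

lemma servers_of_eq: "servers_of E C = {s. \<exists>c\<in>C. (s, c) \<in> E}"
  by (auto simp: servers_of_def)

lemma customers_of_eq: "customers_of E S = {c. \<exists>s\<in>S. (s, c) \<in> E}"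
  by (auto simp: customers_of_def)

definition preds :: "('c, 's) event \<Rightarrow> ('c, 's) state \<Rightarrow> ('c, 's) state set" where
  "preds e z = {x \<in> states E. e \<in> enabled x \<and> next_state E e x = z}"

text \<open>Either the arriving customer is now the last one waiting, or it took a server
  \<open>s\<close> that was idle. Such an \<open>s\<close> is now busy, and it is incompatible with
  all waiting customers because the predecessor was admissible.\<close>

lemma preds_Arrival:
  assumes z: "(w, i) \<in> states E"
  shows "preds (Arrival c) (w, i) = (\<lambda>w'. (w', i)) ` {w'. w = w' @ [c]} \<union>
    Pair w ` insertions (\<lambda>s c. (s, c) \<in> E) (- set i - servers_of E (set w)) i c" (is "_ = ?L \<union> ?R")
proof (intro equalityI subsetI)
  fix x assume "x \<in> preds (Arrival c) (w, i)"
  then obtain w' i' where x: "x = (w', i')" "(w', i') \<in> states E" "next_state E (Arrival c) (w', i') = (w, i)"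
    by (cases x) (auto simp: preds_def)
  show "x \<in> ?L \<union> ?R"
  proof (cases "List.extract (\<lambda>s. (s, c) \<in> E) i'")
    case None
    then show ?thesis using x by auto
  next
    case (Some a)
    then obtain i1 s i2 where ex: "List.extract (\<lambda>s. (s, c) \<in> E) i' = Some (i1, s, i2)" by (metis prod.collapse)
    have i': "i' = i1 @ s # i2" "(s, c) \<in> E" "\<forall>y\<in>set i1. (y, c) \<notin> E"
      using extract_Some_iff[THEN iffD1, OF ex] by auto
    have wi: "w = w'" "i = i1 @ i2" using x(3) ex by auto
    have "s \<in> - set i - servers_of E (set w)"
      using x(2) by (auto simp: states_def i' wi servers_of_def)
    then have "i' \<in> insertions (\<lambda>s c. (s, c) \<in> E) (- set i - servers_of E (set w)) i c"
      unfolding insertions_def using i' wi by blast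
    then show ?thesis by (simp add: x wi)
  qed
next
  fix x assume "x \<in> ?L \<union> ?R"
  then show "x \<in> preds (Arrival c) (w, i)"
  proof
    assume "x \<in> ?L"
    then obtain w' where x: "x = (w', i)" "w = w' @ [c]" by auto
    then have "\<not> (\<exists>s\<in>set i. (s, c) \<in> E)" using z by (auto simp: states_def)
    then have "List.extract (\<lambda>s. (s, c) \<in> E) i = None" by (rule extract_None_iff[THEN iffD2])
    then show ?thesis using x z by (auto simp: preds_def states_def)
  next
    assume "x \<in> ?R"
    then obtain i1 s i2 where x: "x = (w, i1 @ s # i2)" "i = i1 @ i2"
      "s \<in> - set i - servers_of E (set w)" "(s, c) \<in> E" "\<forall>y\<in>set i1. (y, c) \<notin> E"
      by (auto simp: insertions_def)
    have "List.extract (\<lambda>s. (s, c) \<in> E) (i1 @ s # i2) = Some (i1, s, i2)"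
      using x by (simp add: extract_Some_iff)
    then show ?thesis using x z by (auto simp: preds_def states_def servers_of_def)
  qed
qed

text \<open>Dual to \<open>preds_Arrival\<close>: either \<open>s\<close> is now the last idle
  server, or it took a waiting customer, who is incompatible with all idle servers.\<close>

lemma preds_Completion:
  assumes z: "(w, i) \<in> states E"
  shows "preds (Completion s) (w, i) = Pair w ` {i'. i = i' @ [s]} \<union>
    (\<lambda>w'. (w', i)) ` insertions (\<lambda>c s. (s, c) \<in> E) (- customers_of E (set i)) w s" (is "_ = ?L \<union> ?R")
proof (intro equalityI subsetI)
  fix x assume "x \<in> preds (Completion s) (w, i)"
  then obtain w' i' where x: "x = (w', i')" "(w', i') \<in> states E" "next_state E (Completion s) (w', i') = (w, i)"
    by (cases x) (auto simp: preds_def)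
  show "x \<in> ?L \<union> ?R"
  proof (cases "List.extract (\<lambda>c. (s, c) \<in> E) w'")
    case None
    then show ?thesis using x by auto
  next
    case (Some a)
    then obtain w1 c w2 where ex: "List.extract (\<lambda>c. (s, c) \<in> E) w' = Some (w1, c, w2)" by (metis prod.collapse)
    have w': "w' = w1 @ c # w2" "(s, c) \<in> E" "\<forall>y\<in>set w1. (s, y) \<notin> E"
      using extract_Some_iff[THEN iffD1, OF ex] by auto
    have wi: "i = i'" "w = w1 @ w2" using x(3) ex by auto
    have "c \<in> - customers_of E (set i)"
      using x(2) by (auto simp: states_def w' wi customers_of_def)
    then have "w' \<in> insertions (\<lambda>c s. (s, c) \<in> E) (- customers_of E (set i)) w s"
      unfolding insertions_def using w' wi by blast
    then show ?thesis by (simp add: x wi)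
  qed
next
  fix x assume "x \<in> ?L \<union> ?R"
  then show "x \<in> preds (Completion s) (w, i)"
  proof
    assume "x \<in> ?L"
    then obtain i' where x: "x = (w, i')" "i = i' @ [s]" by auto
    then have "\<not> (\<exists>c\<in>set w. (s, c) \<in> E)" using z by (auto simp: states_def)
    then have "List.extract (\<lambda>c. (s, c) \<in> E) w = None" by (rule extract_None_iff[THEN iffD2])
    then show ?thesis using x z by (auto simp: preds_def states_def)
  next
    assume "x \<in> ?R"
    then obtain w1 c w2 where x: "x = (w1 @ c # w2, i)" "w = w1 @ w2"
      "c \<in> - customers_of E (set i)" "(s, c) \<in> E" "\<forall>y\<in>set w1. (s, y) \<notin> E"
      by (auto simp: insertions_def)
    have "List.extract (\<lambda>c. (s, c) \<in> E) (w1 @ c # w2) = Some (w1, c, w2)"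
      using x by (simp add: extract_Some_iff)
    then show ?thesis using x z by (auto simp: preds_def states_def customers_of_def)
  qed
qed

lemma finite_snoc_eq: "finite {L'. L = L' @ [b]}"
  by (cases L rule: rev_cases) auto

lemma finite_preds: "finite (preds e z)"
proof (cases "z \<in> states E")
  case True
  obtain w i where z: "z = (w, i)" by (rule prod.exhaust)
  show ?thesis
    by (cases e)
       (use True in \<open>simp_all add: z preds_Arrival preds_Completion finite_snoc_eq finite_insertions\<close>)
next
  case False
  then have "preds e z = {}" using next_state_closed by (auto simp: preds_def)
  then show ?thesis by simp
qed

lemma total_rate_eq: "total_rate (w, i) = sum lam UNIV + sum mu (- set i)"
  unfolding total_rate_def enabled_def
  by (subst sum.union_disjoint) (auto simp: sum.reindex inj_on_def rate_def comp_def)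

text \<open>Partial balance holds: the inflow by arrivals equals the outflow by completions, and
  conversely. Arrivals that join the queue account for the rates of the busy servers compatible with
  some waiting customer, arrivals that take an idle server for those of the other busy servers.
  Inflow by completions accounts for all of \<open>lam\<close> in the same way.\<close>

theorem balance:
  assumes compatible: "\<And>s. \<exists>c. (s, c) \<in> E" and served: "\<And>c. \<exists>s. (s, c) \<in> E"
    and z: "z \<in> states E"
  shows "(\<Sum>e\<in>UNIV. \<Sum>x\<in>preds e z. rate e * form x) = total_rate z * form z"
proof -
  obtain w i where zwi: "z = (w, i)" by (rule prod.exhaust)
  have z': "(w, i) \<in> states E" using z zwi by simp
  let ?hc = "\<lambda>C. sum mu (servers_of E C)" and ?hs = "\<lambda>S. sum lam (customers_of E S)"
  let ?T = "- set i - servers_of E (set w)" and ?U = "- customers_of E (set i)"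
  let ?Is = "insertions (\<lambda>s c. (s, c) \<in> E) ?T i" and ?Ic = "insertions (\<lambda>c s. (s, c) \<in> E) ?U w"
  have hc: "0 < ?hc C" if "C \<noteq> {}" for C
  proof -
    from that obtain c where "c \<in> C" by blast
    moreover obtain s where "(s, c) \<in> E" using served by blast
    ultimately show ?thesis by (intro sum_pos mu_pos) (auto simp: servers_of_def)
  qed
  have hs: "0 < ?hs S" if "S \<noteq> {}" for S
  proof -
    from that obtain s where "s \<in> S" by blast
    moreover obtain c where "(s, c) \<in> E" using compatible by blast
    ultimately show ?thesis by (intro sum_pos lam_pos) (auto simp: customers_of_def)
  qed
  have hc0: "?hc {} = 0" and hs0: "?hs {} = 0" by (simp_all add: servers_of_def customers_of_def)
  have "(\<Sum>x\<in>preds (Arrival c) z. rate (Arrival c) * form x) =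
      lam c * (\<Sum>w'\<in>{w'. w = w' @ [c]}. cust_weight w') * serv_weight i +
      cust_weight w * (lam c * (\<Sum>i'\<in>?Is c. serv_weight i'))" for c
    unfolding zwi preds_Arrival[OF z']
    by (subst sum.union_disjoint)
       (auto simp: finite_snoc_eq finite_insertions sum.reindex inj_on_def form_eq rate_def
         sum_distrib_left sum_distrib_right mult_ac)
  then have "(\<Sum>c\<in>UNIV. \<Sum>x\<in>preds (Arrival c) z. rate (Arrival c) * form x) =
      (\<Sum>c\<in>UNIV. lam c * (\<Sum>w'\<in>{w'. w = w' @ [c]}. cust_weight w')) * serv_weight i +
      cust_weight w * (\<Sum>c\<in>UNIV. lam c * (\<Sum>i'\<in>?Is c. serv_weight i'))"
    by (simp add: sum.distrib sum_distrib_left sum_distrib_right)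
  also have "\<dots> = (cust_weight w * ?hc (set w)) * serv_weight i + cust_weight w * (sum mu ?T * serv_weight i)"
    using sum_list_weight_butlast[where f=lam and h="?hc" and L=w, OF hc0 hc]
      sum_insertions[where R="\<lambda>s c. (s, c) \<in> E" and g=lam and f=mu and T="?T" and L=i, OF lam_pos compatible]
    by (simp add: cust_weight_def serv_weight_def customers_of_eq)
  finally have arr: "(\<Sum>c\<in>UNIV. \<Sum>x\<in>preds (Arrival c) z. rate (Arrival c) * form x) =
      (?hc (set w) + sum mu ?T) * form z"
    by (simp add: zwi form_eq algebra_simps)
  have "(\<Sum>x\<in>preds (Completion s) z. rate (Completion s) * form x) =
      cust_weight w * (mu s * (\<Sum>i'\<in>{i'. i = i' @ [s]}. serv_weight i')) +
      mu s * (\<Sum>w'\<in>?Ic s. cust_weight w') * serv_weight i" for s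
    unfolding zwi preds_Completion[OF z']
    by (subst sum.union_disjoint)
       (auto simp: finite_snoc_eq finite_insertions sum.reindex inj_on_def form_eq rate_def
         sum_distrib_left sum_distrib_right mult_ac)
  then have "(\<Sum>s\<in>UNIV. \<Sum>x\<in>preds (Completion s) z. rate (Completion s) * form x) =
      cust_weight w * (\<Sum>s\<in>UNIV. mu s * (\<Sum>i'\<in>{i'. i = i' @ [s]}. serv_weight i')) +
      (\<Sum>s\<in>UNIV. mu s * (\<Sum>w'\<in>?Ic s. cust_weight w')) * serv_weight i"
    by (simp add: sum.distrib sum_distrib_left sum_distrib_right)
  also have "\<dots> = cust_weight w * (serv_weight i * ?hs (set i)) + (sum lam ?U * cust_weight w) * serv_weight i"
    using sum_list_weight_butlast[where f=mu and h="?hs" and L=i, OF hs0 hs]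
      sum_insertions[where R="\<lambda>c s. (s, c) \<in> E" and g=mu and f=lam and T="?U" and L=w, OF mu_pos served]
    by (simp add: cust_weight_def serv_weight_def servers_of_eq)
  finally have compl: "(\<Sum>s\<in>UNIV. \<Sum>x\<in>preds (Completion s) z. rate (Completion s) * form x) =
      (?hs (set i) + sum lam ?U) * form z"
    by (simp add: zwi form_eq algebra_simps)
  have "servers_of E (set w) \<subseteq> - set i"
    using z' by (auto simp: states_def servers_of_def)
  then have 1: "?hc (set w) + sum mu ?T = sum mu (- set i)"
    by (subst sum.subset_diff[of "servers_of E (set w)" "- set i"]) auto
  have 2: "?hs (set i) + sum lam ?U = sum lam UNIV"
    by (subst sum.subset_diff[of "customers_of E (set i)" UNIV]) (auto simp: Compl_eq_Diff_UNIV)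
  show ?thesis
    unfolding sum_event arr compl 1 2 by (simp add: zwi total_rate_eq algebra_simps)
qed

end

section \<open>Mean return times of discrete chains\<close>

lemma nn_integral_count_space_swap:
  "(\<S> x. (\<S> y. f x y)) =
   (\<S> y. (\<S> x. (f x y :: ennreal)))"
  using nn_integral_fst_count_space[of "\<lambda>(x, y). f x y"] nn_integral_snd_count_space[of "\<lambda>(x, y). f x y"]
  by simp

lemma suminf_ennreal_split_head: "(\<Sum>n. f n) = f 0 + (\<Sum>n. (f (Suc n) :: ennreal))"
  using suminf_offset[of f 1] by (simp add: add.commute)

text \<open>The measure \<open>m\<close> is finite at each point but may have infinite total mass.
  The results below tie the finiteness of that mass to the mean return time to
  \<open>r0\<close>.\<close>

locale invariant_kernel =
  fixes k :: "'x \<Rightarrow> 'x \<Rightarrow> ennreal" and m :: "'x \<Rightarrow> ennreal" and r0 :: 'x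
  assumes stochastic: "(\<S> y. k x y) = 1"
    and invariant: "(\<S> x. m x * k x y) = m y"
    and m_finite: "m x < \<infinity>"
    and m_r0: "m r0 \<noteq> 0"
begin

definition off :: "'x \<Rightarrow> ennreal" where
  "off x = of_bool (x \<noteq> r0)"

text \<open>One step of the chain killed on entering \<open>r0\<close>.\<close>

definition avoid :: "('x \<Rightarrow> ennreal) \<Rightarrow> 'x \<Rightarrow> ennreal" where
  "avoid f x = (\<S> y. k x y * (off y * f y))"

abbreviation integral_m :: "('x \<Rightarrow> ennreal) \<Rightarrow> ennreal" where
  "integral_m f \<equiv> (\<S> x. m x * f x)"

lemma nn_integral_avoid:
  "(\<S> x. t x * avoid f x) =
   (\<S> y. (\<S> x. t x * k x y) * (off y * f y))"
proof -
  have "(\<S> x. t x * avoid f x) =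
    (\<S> x. (\<S> y. t x * k x y * (off y * f y)))"
    unfolding avoid_def by (simp add: nn_integral_cmult[symmetric] mult.assoc)
  also have "\<dots> = (\<S> y. (\<S> x. t x * k x y * (off y * f y)))"
    by (rule nn_integral_count_space_swap)
  also have "\<dots> = (\<S> y. (\<S> x. t x * k x y) * (off y * f y))"
    by (simp add: nn_integral_multc)
  finally show ?thesis .
qed

text \<open>In terms of the chain with kernel \<open>k\<close> started in \<open>r0\<close>, \<open>(avoid ^^ n) 1 r0\<close> is the probability
  of no return to \<open>r0\<close> within \<open>n\<close> steps, so that the series is the mean return time.\<close>

lemma return_series_finite:
  assumes fin: "integral_m (\<lambda>_. 1) < \<infinity>"
  shows "(\<Sum>n. (avoid ^^ n) (\<lambda>_. 1) r0) < \<infinity>"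
proof -
  define g where "g n = (avoid ^^ n) (\<lambda>_. 1)" for n
  \<comment> \<open>\<open>g n x\<close> is the probability of avoiding \<open>r0\<close> at times 1
    to \<open>n\<close> from \<open>x\<close>, and \<open>a n\<close> the \<open>m\<close>-mass of
    paths off \<open>r0\<close> at times 0 to \<open>n\<close>. Invariance of \<open>m\<close> moves
    the time origin by one, which makes the series telescope.\<close>
  define a where "a n = integral_m (\<lambda>x. off x * g n x)" for n
  have split: "integral_m (g (Suc n)) = m r0 * g (Suc n) r0 + a (Suc n)" for n
  proof -
    have "integral_m (g (Suc n)) =
      (\<S> x. m r0 * g (Suc n) r0 * indicator {r0} x + m x * (off x * g (Suc n) x))"
      by (intro nn_integral_cong) (auto simp: off_def indicator_def)
    also have "\<dots> = (\<S> x. m r0 * g (Suc n) r0 * indicator {r0} x) + a (Suc n)"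
      unfolding a_def by (rule nn_integral_add) auto
    finally show ?thesis by (simp add: nn_integral_cmult)
  qed
  have "integral_m (g (Suc n)) = a n" for n
  proof -
    have "g (Suc n) = avoid (g n)" by (simp add: g_def)
    then show ?thesis unfolding a_def by (simp only: nn_integral_avoid invariant)
  qed
  with split have step: "a n = m r0 * g (Suc n) r0 + a (Suc n)" for n
    by metis
  have partial: "(\<Sum>n<N. m r0 * g (Suc n) r0) + a N = a 0" for N
  proof (induct N)
    case (Suc N)
    have "(\<Sum>n<Suc N. m r0 * g (Suc n) r0) + a (Suc N) =
        (\<Sum>n<N. m r0 * g (Suc n) r0) + (m r0 * g (Suc N) r0 + a (Suc N))"
      by (simp only: sum.lessThan_Suc add.assoc)
    then show ?case by (simp only: step[symmetric] Suc)
  qed simp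
  have "a 0 \<le> integral_m (\<lambda>_. 1)"
    unfolding a_def g_def by (intro nn_integral_mono mult_left_mono) (auto simp: off_def)
  then have "(\<Sum>n<N. m r0 * g (Suc n) r0) \<le> integral_m (\<lambda>_. 1)" for N
    using partial[of N] by (metis add.right_neutral add_left_mono order_trans zero_le)
  then have "(\<Sum>n. m r0 * g (Suc n) r0) \<le> integral_m (\<lambda>_. 1)"
    by (intro suminf_le_const) auto
  then have "m r0 * (\<Sum>n. g (Suc n) r0) < \<infinity>"
    using fin by (simp add: ennreal_suminf_cmult)
  then have "(\<Sum>n. g (Suc n) r0) < \<infinity>"
    using m_r0 by (auto simp: ennreal_mult_less_top)
  moreover have "(\<Sum>n. g n r0) = g 0 r0 + (\<Sum>n. g (Suc n) r0)"
    by (rule suminf_ennreal_split_head)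
  ultimately show ?thesis by (simp add: g_def)
qed

text \<open>The expected occupation measure \<open>\<nu>\<close> of an excursion from \<open>r0\<close> is invariant and dominated by
  \<open>m\<close>; their difference is invariant and vanishes at \<open>r0\<close>, hence vanishes identically.\<close>

lemma invariant_mass_finite:
  assumes series: "(\<Sum>n. (avoid ^^ n) (\<lambda>_. 1) r0) < \<infinity>"
    and reach: "\<And>y. m y \<noteq> 0 \<Longrightarrow> (y, r0) \<in> {(a, b). k a b \<noteq> 0}\<^sup>*"
  shows "integral_m (\<lambda>_. 1) < \<infinity>"
proof -
  \<comment> \<open>\<open>t n y\<close> is the probability, from \<open>r0\<close>, of being in
    \<open>y\<close> at time \<open>n\<close> with no visit to \<open>r0\<close> at times 1 to
    \<open>n\<close>.\<close>
  define t where "t = rec_nat (\<lambda>x. of_bool (x = r0)) (\<lambda>_ u y. off y * (\<S> z. u z * k z y))"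
  have t0: "t 0 = (\<lambda>x. of_bool (x = r0))"
    and tS: "t (Suc n) = (\<lambda>y. off y * (\<S> z. t n z * k z y))" for n
    by (simp_all add: t_def)
  have pair: "(\<S> x. t n x * f x) = (avoid ^^ n) f r0" for n f
  proof (induct n arbitrary: f)
    case 0
    have "(\<S> x. t 0 x * f x) = (\<S> x. f r0 * indicator {r0} x)"
      by (intro nn_integral_cong) (auto simp: t0 indicator_def)
    then show ?case by (simp add: nn_integral_cmult)
  next
    case (Suc n)
    have "(\<S> x. t (Suc n) x * f x) = (\<S> x. t n x * avoid f x)"
      unfolding nn_integral_avoid tS by (intro nn_integral_cong) (simp add: mult_ac)
    then show ?case by (simp add: Suc funpow_swap1)
  qed
  \<comment> \<open>The factor \<open>m r0\<close> makes the occupation measure agree with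
    \<open>m\<close> at \<open>r0\<close>.\<close>
  define \<nu> where "\<nu> y = (\<Sum>n. m r0 * t n y)" for y
  have mass: "(\<S> y. \<nu> y) < \<infinity>"
  proof -
    have "(\<S> y. \<nu> y) = (\<Sum>n. (\<S> y. m r0 * t n y))"
      unfolding \<nu>_def by (rule nn_integral_suminf) simp
    also have "\<dots> = (\<Sum>n. m r0 * (avoid ^^ n) (\<lambda>_. 1) r0)"
      using pair[of _ "\<lambda>_. 1"] by (simp add: nn_integral_cmult)
    finally show ?thesis
      using series m_finite[of r0] by (simp add: ennreal_suminf_cmult ennreal_mult_less_top)
  qed
  have t_r0: "t n r0 = of_bool (n = 0)" for n
    by (cases n) (auto simp: t0 tS off_def)
  have \<nu>_r0: "\<nu> r0 = m r0"
  proof -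
    have "(\<lambda>n. m r0 * t n r0) = (\<lambda>n. if n = 0 then m r0 else 0)" by (auto simp: t_r0)
    then show ?thesis unfolding \<nu>_def using sums_single[of 0 "\<lambda>_. m r0"] by (simp add: sums_iff)
  qed
  have \<nu>_step: "(\<S> z. \<nu> z * k z y) = \<nu> y" if "y \<noteq> r0" for y
  proof -
    have "(\<S> z. \<nu> z * k z y) = (\<S> z. (\<Sum>n. m r0 * t n z * k z y))"
      unfolding \<nu>_def by (simp add: ennreal_suminf_multc)
    also have "\<dots> = (\<Sum>n. (\<S> z. m r0 * t n z * k z y))"
      by (rule nn_integral_suminf) simp
    also have "\<dots> = (\<Sum>n. m r0 * t (Suc n) y)"
      using that by (simp add: tS off_def nn_integral_cmult mult.assoc)
    also have "\<dots> = \<nu> y"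
      unfolding \<nu>_def using that by (subst suminf_ennreal_split_head) (simp add: t0)
    finally show ?thesis .
  qed
  have mass_k: "(\<S> y. (\<S> z. u z * k z y)) = (\<S> z. u z)" for u
    by (subst nn_integral_count_space_swap) (simp add: nn_integral_cmult stochastic)
  have \<nu>_inv: "(\<S> z. \<nu> z * k z y) = \<nu> y" for y
  proof (cases "y = r0")
    case True
    \<comment> \<open>One step preserves the total mass, and the masses off \<open>r0\<close> agree
      and are finite; so the masses at \<open>r0\<close> agree as well.\<close>
    define u where "u y = (\<S> z. \<nu> z * k z y)" for y
    have dec: "(\<S> y. v y) = v r0 + (\<S> y. off y * v y)" for v
    proof -
      have "(\<S> y. v y) = (\<S> y. v r0 * indicator {r0} y + off y * v y)"
        by (intro nn_integral_cong) (auto simp: off_def indicator_def)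
      then show ?thesis by (simp add: nn_integral_add nn_integral_cmult)
    qed
    have "(\<S> y. off y * u y) = (\<S> y. off y * \<nu> y)"
      unfolding u_def by (intro nn_integral_cong) (auto simp: off_def \<nu>_step)
    moreover have "(\<S> y. off y * \<nu> y) \<noteq> \<infinity>"
      using mass dec[of \<nu>] by auto
    moreover have "(\<S> y. u y) = (\<S> y. \<nu> y)"
      unfolding u_def by (rule mass_k)
    ultimately have "u r0 = \<nu> r0"
      unfolding dec[of u] dec[of \<nu>] by (simp add: ennreal_add_left_cancel add.commute)
    then show ?thesis by (simp add: True u_def)
  qed (rule \<nu>_step)
  \<comment> \<open>The occupation measure is truncated to \<open>N\<close> steps so that the
    domination by \<open>m\<close> can be proved by induction, pushing the bound one step forward by
    invariance.\<close>
  have partial_le: "(\<Sum>n<N. m r0 * t n y) \<le> m y" for N y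
  proof (induct N arbitrary: y)
    case (Suc N)
    show ?case
    proof (cases "y = r0")
      case True
      have "(\<Sum>n<Suc N. m r0 * t n y) = (\<Sum>n<Suc N. if n = 0 then m r0 else 0)"
        unfolding True t_r0 by (intro sum.cong) auto
      then show ?thesis by (simp add: True)
    next
      case False
      have "(\<Sum>n<Suc N. m r0 * t n y) = (\<Sum>n<N. m r0 * t (Suc n) y)"
        using False by (simp add: sum.lessThan_Suc_shift t0 del: sum.lessThan_Suc)
      also have "\<dots> = (\<Sum>n<N. (\<S> z. m r0 * t n z * k z y))"
        using False by (simp add: tS off_def nn_integral_cmult mult.assoc)
      also have "\<dots> = (\<S> z. (\<Sum>n<N. m r0 * t n z) * k z y)"
        by (simp add: nn_integral_sum[symmetric] sum_distrib_right)
      also have "\<dots> \<le> (\<S> z. m z * k z y)"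
        by (intro nn_integral_mono mult_right_mono Suc) simp
      finally show ?thesis by (simp add: invariant)
    qed
  qed simp
  have \<nu>_le: "\<nu> y \<le> m y" for y
    unfolding \<nu>_def using partial_le by (intro suminf_le_const) auto
  define \<sigma> where "\<sigma> y = m y - \<nu> y" for y
  have m_eq: "m y = \<sigma> y + \<nu> y" for y
    unfolding \<sigma>_def using \<nu>_le by (simp add: diff_add_cancel_ennreal)
  have \<sigma>_inv: "(\<S> z. \<sigma> z * k z y) = \<sigma> y" for y
  proof -
    have "\<sigma> y + \<nu> y = (\<S> z. (\<sigma> z + \<nu> z) * k z y)"
      unfolding m_eq[symmetric] by (rule invariant[symmetric])
    also have "\<dots> = (\<S> z. \<sigma> z * k z y) + \<nu> y"
      by (simp add: distrib_right nn_integral_add \<nu>_inv)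
    finally show ?thesis
      using \<nu>_le[of y] m_finite[of y] by (auto simp: ennreal_add_left_cancel add.commute[of _ "\<nu> y"] top_unique)
  qed
  \<comment> \<open>A zero of an invariant measure spreads backwards along transitions, since the
    terms flowing into \<open>b\<close> are nonnegative and sum to 0.\<close>
  have zero_back: "\<sigma> a = 0" if "k a b \<noteq> 0" "\<sigma> b = 0" for a b
  proof -
    have "AE z in count_space UNIV. \<sigma> z * k z b = 0"
      using \<sigma>_inv[of b] that(2) by (simp add: nn_integral_0_iff_AE)
    then have "\<sigma> a * k a b = 0" by (simp add: AE_count_space)
    then show ?thesis using that(1) by simp
  qed
  have "\<sigma> y = 0" if "(y, r0) \<in> {(a, b). k a b \<noteq> 0}\<^sup>*" for y
    using that
  proof (induct rule: converse_rtrancl_induct)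
    case base
    show ?case using m_finite[of r0] by (simp add: \<sigma>_def \<nu>_r0 diff_eq_0_ennreal)
  qed (auto intro: zero_back)
  then have "m y = \<nu> y" for y
    using reach[of y] m_eq[of y] \<nu>_le[of y] by (cases "m y = 0") auto
  then show ?thesis using mass by simp
qed

end

section \<open>Summability of the product form\<close>

lemma finite_lists_of_length: "finite {w :: 'a :: finite list. length w = n \<and> P w}"
  using finite_lists_length_eq[of "UNIV :: 'a set" n] by (rule finite_subset[rotated]) auto

lemma sum_lists_snoc:
  fixes F :: "'a :: finite list \<Rightarrow> real"
  shows "(\<Sum>w\<in>{w. length w = Suc n \<and> P w}. F w) =
    (\<Sum>c\<in>UNIV. \<Sum>w\<in>{w. length w = n \<and> P (w @ [c])}. F (w @ [c]))"
proof -
  have "(\<Sum>c\<in>UNIV. \<Sum>w\<in>{w. length w = n \<and> P (w @ [c])}. F (w @ [c])) =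
    (\<Sum>(c, w)\<in>Sigma UNIV (\<lambda>c. {w. length w = n \<and> P (w @ [c])}). F (w @ [c]))"
    by (rule sum.Sigma) (auto simp: finite_lists_of_length)
  also have "\<dots> = (\<Sum>w\<in>{w. length w = Suc n \<and> P w}. F w)"
  proof -
    have snoc: "butlast w @ [last w] = w" if "length w = Suc n" for w :: "'a list"
    proof -
      have "w \<noteq> []" using that by auto
      then show ?thesis by (rule append_butlast_last_id)
    qed
    show ?thesis
      by (rule sum.reindex_bij_witness[where i="\<lambda>w. (last w, butlast w)" and j="\<lambda>(c, w). w @ [c]"])
         (auto simp: snoc)
  qed
  finally show ?thesis ..
qed

context queue
begin

lemma cust_weight_snoc:
  "cust_weight (w @ [c]) = cust_weight w * (lam c / sum mu (servers_of E (insert c (set w))))"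
  unfolding cust_weight_def by (rule list_weight_snoc)

lemma cust_weight_Nil[simp]: "cust_weight [] = 1" and serv_weight_Nil[simp]: "serv_weight [] = 1"
  by (simp_all add: cust_weight_def serv_weight_def)

lemma cust_weight_nonneg[simp]: "0 \<le> cust_weight w"
  unfolding cust_weight_def list_weight_def using lam_pos mu_pos
  by (intro prod_nonneg divide_nonneg_nonneg sum_nonneg) (auto intro: less_imp_le)

lemma serv_weight_nonneg[simp]: "0 \<le> serv_weight i"
  unfolding serv_weight_def list_weight_def using lam_pos mu_pos
  by (intro prod_nonneg divide_nonneg_nonneg sum_nonneg) (auto intro: less_imp_le)

lemma form_nonneg[simp]: "0 \<le> form x"
  by (cases x) (simp add: form_eq)

lemma nn_integral_lists:
  fixes f :: "'a :: finite list \<Rightarrow> real"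
  assumes f: "\<And>w. 0 \<le> f w"
  shows "(\<S> w. ennreal (f w)) = (\<Sum>n. ennreal (\<Sum>w\<in>{w. length w = n}. f w))"
proof -
  have fin: "finite {w :: 'a list. length w = n}" for n
    using finite_lists_of_length[of n "\<lambda>_. True"] by simp
  have "(\<Sum>n. ennreal (f w) * indicator {w. length w = n} w) = ennreal (f w)" for w
  proof -
    have "(\<lambda>n. ennreal (f w) * indicator {w. length w = n} w) = (\<lambda>n. if n = length w then ennreal (f w) else 0)"
      by (auto simp: fun_eq_iff indicator_def)
    then show ?thesis using sums_single[of "length w" "\<lambda>_. ennreal (f w)"] by (simp add: sums_iff)
  qed
  then have "(\<S> w. ennreal (f w)) =
      (\<S> w. (\<Sum>n. ennreal (f w) * indicator {w. length w = n} w))"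
    by simp
  also have "\<dots> = (\<Sum>n. (\<S> w. ennreal (f w) * indicator {w. length w = n} w))"
    by (rule nn_integral_suminf) simp
  also have "\<dots> = (\<Sum>n. ennreal (\<Sum>w\<in>{w. length w = n}. f w))"
  proof (rule suminf_cong)
    fix n
    have "(\<S> w. ennreal (f w) * indicator {w. length w = n} w) =
        (\<integral>\<^sup>+ w. ennreal (f w) \<partial>count_space {w. length w = n})"
      by (rule nn_integral_count_space_indicator[symmetric]) simp
    also have "\<dots> = (\<Sum>w\<in>{w. length w = n}. ennreal (f w))"
      by (rule nn_integral_count_space_finite[OF fin])
    also have "\<dots> = ennreal (\<Sum>w\<in>{w. length w = n}. f w)"
      using f by (rule sum_ennreal)
    finally show "(\<S> w. ennreal (f w) * indicator {w. length w = n} w) =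
        ennreal (\<Sum>w\<in>{w. length w = n}. f w)" .
  qed
  finally show ?thesis .
qed

text \<open>Induction on the number of types. Without its last entry \<open>c\<close>, a list with
  type set \<open>D\<close> has type set \<open>D\<close> or \<open>D - {c}\<close>, and the last
  denominator is the service rate for \<open>D\<close> in both cases. So the sums for
  \<open>D\<close> obey a linear recursion with factor below 1, whose inhomogeneity is bounded by
  hypothesis.\<close>

lemma cust_weight_sum_bounded:
  assumes cond: "\<And>C. C \<noteq> {} \<Longrightarrow> sum lam C < sum mu (servers_of E C)"
  shows "\<exists>B. \<forall>N. (\<Sum>n<N. \<Sum>w\<in>{w. length w = n \<and> set w = D}. cust_weight w) \<le> B"
proof (induct "card D" arbitrary: D rule: less_induct)
  case less
  define a where "a n D = (\<Sum>w\<in>{w. length w = n \<and> set w = D}. cust_weight w)" for n D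
  have a_nonneg: "0 \<le> a n D" for n D
    unfolding a_def by (rule sum_nonneg) simp
  show ?case
  proof (cases "D = {}")
    case True
    have "a n D = of_bool (n = 0)" for n
    proof -
      have "{w. length w = n \<and> set w = D} = (if n = 0 then {[]} else {})" using True by auto
      then show ?thesis by (simp add: a_def)
    qed
    then have "(\<Sum>n<N. a n D) \<le> 1" for N
      by (cases N) (simp_all add: sum.lessThan_Suc_shift del: sum.lessThan_Suc)
    then show ?thesis unfolding a_def by blast
  next
    case False
    define \<mu> where "\<mu> = sum mu (servers_of E D)"
    define \<rho> where "\<rho> = sum lam D / \<mu>"
    have lamD: "0 < sum lam D" using False by (intro sum_pos lam_pos) auto
    have \<mu>: "0 < \<mu>" using cond[OF False] lamD by (simp add: \<mu>_def)
    have \<rho>: "0 \<le> \<rho>" "\<rho> < 1" using cond[OF False] \<mu> lamD by (simp_all add: \<rho>_def \<mu>_def)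
    have rec: "a (Suc n) D = \<rho> * a n D + (\<Sum>c\<in>D. lam c / \<mu> * a n (D - {c}))" for n
    proof -
      have inner: "(\<Sum>w\<in>{w. length w = n \<and> set (w @ [c]) = D}. cust_weight (w @ [c])) =
          (if c \<in> D then lam c / \<mu> * (a n D + a n (D - {c})) else 0)" for c
      proof (cases "c \<in> D")
        case True
        have "{w. length w = n \<and> set (w @ [c]) = D} =
            {w. length w = n \<and> set w = D} \<union> {w. length w = n \<and> set w = D - {c}}"
          using True by auto
        moreover have "cust_weight (w @ [c]) = cust_weight w * (lam c / \<mu>)"
          if "w \<in> {w. length w = n \<and> set (w @ [c]) = D}" for w
          using that by (auto simp: cust_weight_snoc \<mu>_def)
        ultimately have "(\<Sum>w\<in>{w. length w = n \<and> set (w @ [c]) = D}. cust_weight (w @ [c])) =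
            (\<Sum>w\<in>{w. length w = n \<and> set w = D} \<union> {w. length w = n \<and> set w = D - {c}}. cust_weight w * (lam c / \<mu>))"
          by (intro sum.cong) auto
        also have "\<dots> = (a n D + a n (D - {c})) * (lam c / \<mu>)"
          unfolding sum_distrib_right[symmetric] a_def using True
          by (subst sum.union_disjoint) (auto simp: finite_lists_of_length)
        finally show ?thesis using True by (simp add: mult.commute)
      next
        case False
        then have "{w. length w = n \<and> set (w @ [c]) = D} = {}" by auto
        then show ?thesis using False by (metis (no_types, lifting) sum.empty)
      qed
      have "a (Suc n) D = (\<Sum>c\<in>UNIV. if c \<in> D then lam c / \<mu> * (a n D + a n (D - {c})) else 0)"
        unfolding a_def[of "Suc n"] sum_lists_snoc inner ..
      also have "\<dots> = (\<Sum>c\<in>D. lam c / \<mu> * (a n D + a n (D - {c})))"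
        by (simp add: sum.If_cases)
      also have "\<dots> = \<rho> * a n D + (\<Sum>c\<in>D. lam c / \<mu> * a n (D - {c}))"
        by (simp add: distrib_left sum.distrib \<rho>_def sum_divide_distrib sum_distrib_right)
      finally show ?thesis .
    qed
    have "\<forall>c\<in>D. \<exists>B. \<forall>N. (\<Sum>n<N. a n (D - {c})) \<le> B"
      unfolding a_def by (intro ballI less card_Diff1_less finite)
    then obtain B where B: "(\<Sum>n<N. a n (D - {c})) \<le> B c" if "c \<in> D" for c N
      by metis
    define K where "K = (\<Sum>c\<in>D. lam c / \<mu> * B c)"
    have K: "(\<Sum>n<N. \<Sum>c\<in>D. lam c / \<mu> * a n (D - {c})) \<le> K" for N
    proof -
      have "(\<Sum>n<N. \<Sum>c\<in>D. lam c / \<mu> * a n (D - {c})) = (\<Sum>c\<in>D. lam c / \<mu> * (\<Sum>n<N. a n (D - {c})))"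
        by (subst sum.swap) (simp add: sum_distrib_left)
      also have "\<dots> \<le> K"
        unfolding K_def using B \<mu> lam_pos by (intro sum_mono mult_left_mono) (auto intro: less_imp_le)
      finally show ?thesis .
    qed
    have K0: "0 \<le> K" using K[of 0] by simp
    have a0: "a 0 D = 0" using False by (auto simp: a_def)
    \<comment> \<open>\<open>K / (1 - \<rho>)\<close> is the fixed point of the map taking
      \<open>S\<close> to \<open>\<rho> * S + K\<close>, so the bound reproduces itself.\<close>
    have "(\<Sum>n<N. a n D) \<le> K / (1 - \<rho>)" for N
    proof (induct N)
      case 0
      then show ?case using K0 \<rho> by simp
    next
      case (Suc N)
      have "(\<Sum>n<Suc N. a n D) = \<rho> * (\<Sum>n<N. a n D) + (\<Sum>n<N. \<Sum>c\<in>D. lam c / \<mu> * a n (D - {c}))"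
        by (simp add: sum.lessThan_Suc_shift a0 rec sum.distrib sum_distrib_left del: sum.lessThan_Suc)
      also have "\<dots> \<le> \<rho> * (K / (1 - \<rho>)) + K"
        by (intro add_mono mult_left_mono Suc K \<rho>)
      also have "\<dots> = K / (1 - \<rho>)" using \<rho> by (simp add: field_simps)
      finally show ?case .
    qed
    then show ?thesis unfolding a_def by blast
  qed
qed

text \<open>Lists are grouped by their sets of types, of which there are finitely many.\<close>

lemma cust_weight_summable:
  assumes cond: "\<And>C. C \<noteq> {} \<Longrightarrow> sum lam C < sum mu (servers_of E C)"
  shows "(\<S> w. ennreal (cust_weight w)) < \<infinity>"
proof -
  have "\<forall>D. \<exists>B. \<forall>N. (\<Sum>n<N. \<Sum>w\<in>{w. length w = n \<and> set w = D}. cust_weight w) \<le> B"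
    by (intro allI cust_weight_sum_bounded cond)
  from choice[OF this] obtain B
    where B: "(\<Sum>n<N. \<Sum>w\<in>{w. length w = n \<and> set w = D}. cust_weight w) \<le> B D" for D N
    by blast
  have split: "(\<Sum>w\<in>{w. length w = n}. cust_weight w) =
      (\<Sum>D\<in>UNIV. \<Sum>w\<in>{w. length w = n \<and> set w = D}. cust_weight w)" for n
    using sum.group[of "{w :: 'c list. length w = n}" "UNIV :: 'c set set" set cust_weight]
      finite_lists_of_length[of n "\<lambda>_ :: 'c list. True"] by simp
  have "(\<Sum>n<N. \<Sum>w\<in>{w. length w = n}. cust_weight w) \<le> sum B UNIV" for N
    unfolding split by (subst sum.swap) (intro sum_mono B)
  then have "(\<Sum>n<N. ennreal (\<Sum>w\<in>{w. length w = n}. cust_weight w)) \<le> ennreal (sum B UNIV)" for N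
    by (subst sum_ennreal) (auto intro!: sum_nonneg ennreal_leI)
  then have "(\<Sum>n. ennreal (\<Sum>w\<in>{w. length w = n}. cust_weight w)) \<le> ennreal (sum B UNIV)"
    by (intro suminf_le_const) auto
  then show ?thesis
    unfolding nn_integral_lists[OF cust_weight_nonneg] by (simp add: le_less_trans)
qed

text \<open>The product form extended by 0, so that sums can run over the whole type.\<close>

definition mass :: "('c, 's) state \<Rightarrow> real" where
  "mass x = (if x \<in> states E then form x else 0)"

lemma mass_nonneg[simp]: "0 \<le> mass x"
  by (simp add: mass_def)

text \<open>Idle servers are distinct, so only finitely many lists of them occur, and the sum over
  the customer lists decides.\<close>

lemma mass_summable:
  assumes cond: "\<And>C. C \<noteq> {} \<Longrightarrow> sum lam C < sum mu (servers_of E C)"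
  shows "(\<S> x. ennreal (mass x)) < \<infinity>"
proof -
  let ?I = "{i :: 's list. set i \<subseteq> UNIV \<and> distinct i}"
  have fin: "finite ?I" by (rule finite_subset_distinct) simp
  define S where "S = (\<Sum>i\<in>?I. serv_weight i)"
  have "(\<S> x. ennreal (mass x)) =
      (\<S> w. (\<S> i. ennreal (mass (w, i))))"
    by (rule nn_integral_fst_count_space[symmetric])
  also have "\<dots> \<le> (\<S> w. ennreal (cust_weight w) * ennreal S)"
  proof (rule nn_integral_mono)
    fix w
    have "(\<S> i. ennreal (mass (w, i))) \<le>
      (\<S> i. ennreal (cust_weight w) * ennreal (serv_weight i) * indicator ?I i)"
      by (intro nn_integral_mono)
         (auto simp: mass_def form_eq states_def indicator_def ennreal_mult')
    also have "\<dots> = ennreal (cust_weight w) * ennreal S"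
    proof -
      have "(\<S> i. ennreal (cust_weight w) * ennreal (serv_weight i) * indicator ?I i) =
        ennreal (cust_weight w) * (\<S> i. ennreal (serv_weight i) * indicator ?I i)"
        unfolding mult.assoc by (rule nn_integral_cmult) simp
      also have "(\<S> i. ennreal (serv_weight i) * indicator ?I i) =
        (\<integral>\<^sup>+ i. ennreal (serv_weight i) \<partial>count_space ?I)"
        by (rule nn_integral_count_space_indicator[symmetric]) simp
      also have "\<dots> = (\<Sum>i\<in>?I. ennreal (serv_weight i))"
        by (rule nn_integral_count_space_finite[OF fin])
      also have "\<dots> = ennreal S"
        unfolding S_def by (rule sum_ennreal) simp
      finally show ?thesis .
    qed
    finally show "(\<S> i. ennreal (mass (w, i))) \<le> ennreal (cust_weight w) * ennreal S" .
  qed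
  also have "\<dots> = (\<S> w. ennreal (cust_weight w)) * ennreal S"
    by (rule nn_integral_multc) simp
  also have "\<dots> < \<infinity>"
    using cust_weight_summable[OF cond] by (simp add: ennreal_mult_less_top)
  finally show ?thesis .
qed

text \<open>For lists over \<open>C\<close> all denominators are at most the service rate for
  \<open>C\<close>. If the load condition failed, appending a customer from \<open>C\<close> would
  multiply the total weight of the lists of each length by at least 1. Every length would then
  contribute at least 1, already among the states without idle servers.\<close>

lemma load_of_mass_summable:
  assumes served: "\<And>c. \<exists>s. (s, c) \<in> E"
    and fin: "(\<S> x. ennreal (mass x)) < \<infinity>" and C: "C \<noteq> {}"
  shows "sum lam C < sum mu (servers_of E C)"
proof (rule ccontr)
  assume not: "\<not> ?thesis"
  define \<mu> where "\<mu> = sum mu (servers_of E C)"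
  have load: "\<mu> \<le> sum lam C" using not by (simp add: \<mu>_def)
  define b where "b n = (\<Sum>w\<in>{w. length w = n \<and> set w \<subseteq> C}. cust_weight w)" for n
  have "1 \<le> b n" for n
  proof (induct n)
    case 0
    have "{w. length w = 0 \<and> set w \<subseteq> C} = {[]}" by auto
    then show ?case by (simp add: b_def)
  next
    case (Suc n)
    have pos: "0 < sum mu (servers_of E (insert c D))" for c D
    proof -
      obtain s where "(s, c) \<in> E" using served by blast
      then show ?thesis by (intro sum_pos mu_pos) (auto simp: servers_of_def)
    qed
    have \<mu>: "0 < \<mu>"
    proof -
      obtain c where "c \<in> C" using C by blast
      then have "insert c C = C" by auto
      then show ?thesis using pos[of c C] by (simp add: \<mu>_def)
    qed
    have "1 \<le> b n * (sum lam C / \<mu>)"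
      using mult_mono[OF Suc, of 1 "sum lam C / \<mu>"] Suc load \<mu> by simp
    also have "\<dots> = (\<Sum>c\<in>C. \<Sum>w\<in>{w. length w = n \<and> set w \<subseteq> C}. cust_weight w * (lam c / \<mu>))"
      by (simp add: b_def sum_distrib_left[symmetric] sum_distrib_right[symmetric] sum_divide_distrib[symmetric] mult.commute)
    also have "\<dots> \<le> (\<Sum>c\<in>C. \<Sum>w\<in>{w. length w = n \<and> set (w @ [c]) \<subseteq> C}. cust_weight (w @ [c]))"
    proof (intro sum_mono)
      fix c assume c: "c \<in> C"
      have "(\<Sum>w\<in>{w. length w = n \<and> set w \<subseteq> C}. cust_weight w * (lam c / \<mu>)) \<le>
        (\<Sum>w\<in>{w. length w = n \<and> set w \<subseteq> C}. cust_weight (w @ [c]))"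
      proof (rule sum_mono)
        fix w assume w: "w \<in> {w. length w = n \<and> set w \<subseteq> C}"
        have "sum mu (servers_of E (insert c (set w))) \<le> \<mu>"
          unfolding \<mu>_def using c w mu_pos
          by (intro sum_mono2) (auto simp: servers_of_def intro: less_imp_le)
        then have "lam c / \<mu> \<le> lam c / sum mu (servers_of E (insert c (set w)))"
          using pos[of c "set w"] lam_pos[of c] by (intro divide_left_mono) (auto simp: \<mu>)
        then show "cust_weight w * (lam c / \<mu>) \<le> cust_weight (w @ [c])"
          unfolding cust_weight_snoc by (intro mult_left_mono) auto
      qed
      then show "(\<Sum>w\<in>{w. length w = n \<and> set w \<subseteq> C}. cust_weight w * (lam c / \<mu>)) \<le>
          (\<Sum>w\<in>{w. length w = n \<and> set (w @ [c]) \<subseteq> C}. cust_weight (w @ [c]))"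
        using c by simp
    qed
    also have "\<dots> \<le> (\<Sum>c\<in>UNIV. \<Sum>w\<in>{w. length w = n \<and> set (w @ [c]) \<subseteq> C}. cust_weight (w @ [c]))"
      by (rule sum_mono2) (auto intro!: sum_nonneg)
    also have "\<dots> = b (Suc n)"
      unfolding b_def by (rule sum_lists_snoc[symmetric])
    finally show ?case .
  qed
  then have "(1 :: ennreal) \<le> ennreal (\<Sum>w\<in>{w. length w = n}. cust_weight w)" for n
  proof -
    have "b n \<le> (\<Sum>w\<in>{w. length w = n}. cust_weight w)"
      unfolding b_def using finite_lists_of_length[of n "\<lambda>_ :: 'c list. True"] by (intro sum_mono2) auto
    with \<open>1 \<le> b n\<close> show ?thesis by (simp add: ennreal_ge_1)
  qed
  then have "(\<Sum>n. (1 :: ennreal)) \<le> (\<Sum>n. ennreal (\<Sum>w\<in>{w. length w = n}. cust_weight w))"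
    by (intro suminf_le) auto
  also have "\<dots> = (\<S> w. ennreal (cust_weight w))"
    by (rule nn_integral_lists[OF cust_weight_nonneg, symmetric])
  also have "\<dots> = (\<S> w. ennreal (mass (w, [])))"
    by (simp add: mass_def form_eq states_def)
  also have "\<dots> \<le> (\<S> w. (\<S> i. ennreal (mass (w, i))))"
    by (intro nn_integral_mono nn_integral_ge_point) simp
  also have "\<dots> = (\<S> x. ennreal (mass x))"
    by (rule nn_integral_fst_count_space)
  finally have "(\<Sum>n. (1 :: ennreal)) < \<infinity>" using fin by (rule le_less_trans)
  moreover have "(\<Sum>n. (1 :: ennreal)) = \<infinity>"
    unfolding nn_integral_count_space_nat[of "\<lambda>_. 1", symmetric] nn_integral_const by simp
  ultimately show False by simp
qed

end

section \<open>The jump chain\<close>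

context queue
begin

lemma total_rate_nonzero[simp]: "total_rate x \<noteq> 0"
  using total_rate_pos[of x] by (rule less_imp_neq[symmetric])

lemma mass_balance:
  assumes compatible: "\<And>s. \<exists>c. (s, c) \<in> E" and served: "\<And>c. \<exists>s. (s, c) \<in> E"
  shows "(\<Sum>e\<in>UNIV. \<Sum>x\<in>preds e z. rate e * mass x) = total_rate z * mass z"
proof (cases "z \<in> states E")
  case True
  have "(\<Sum>e\<in>UNIV. \<Sum>x\<in>preds e z. rate e * mass x) = (\<Sum>e\<in>UNIV. \<Sum>x\<in>preds e z. rate e * form x)"
    by (intro sum.cong refl) (auto simp: preds_def mass_def)
  then show ?thesis using balance[OF assms True] True by (simp add: mass_def)
next
  case False
  then have "preds e z = {}" for e using next_state_closed by (auto simp: preds_def)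
  then show ?thesis using False by (simp add: mass_def)
qed

lemma form_pos:
  assumes compatible: "\<And>s. \<exists>c. (s, c) \<in> E" and served: "\<And>c. \<exists>s. (s, c) \<in> E"
  shows "0 < form x"
proof -
  obtain w i where x: "x = (w, i)" by (rule prod.exhaust)
  have "0 < sum mu (servers_of E C)" if "C \<noteq> {}" for C
  proof -
    from that obtain c where "c \<in> C" by blast
    moreover obtain s where "(s, c) \<in> E" using served by blast
    ultimately show ?thesis by (intro sum_pos mu_pos) (auto simp: servers_of_def)
  qed
  moreover have "0 < sum lam (customers_of E S)" if "S \<noteq> {}" for S
  proof -
    from that obtain s where "s \<in> S" by blast
    moreover obtain c where "(s, c) \<in> E" using compatible by blast
    ultimately show ?thesis by (intro sum_pos lam_pos) (auto simp: customers_of_def)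
  qed
  ultimately show ?thesis
    unfolding x form_eq cust_weight_def serv_weight_def
    by (intro mult_pos_pos list_weight_pos lam_pos mu_pos) auto
qed

definition kern :: "('c, 's) state \<Rightarrow> ('c, 's) state \<Rightarrow> ennreal" where
  "kern x y = jump_op (\<lambda>z. of_bool (z = y)) x"

lemma nn_integral_kern: "(\<S> y. kern x y * f y) = jump_op f x"
proof -
  have "(\<S> y. kern x y * f y) = (\<S> y. (\<Sum>e\<in>enabled x.
      ennreal (rate e / total_rate x) * f (next_state E e x) * indicator {next_state E e x} y))"
    unfolding kern_def jump_op_def sum_distrib_right
    by (intro nn_integral_cong sum.cong refl) (auto simp: indicator_def)
  also have "\<dots> = (\<Sum>e\<in>enabled x. (\<S> y. ennreal (rate e / total_rate x) * f (next_state E e x) *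
      indicator {next_state E e x} y))"
    by (rule nn_integral_sum) simp
  also have "\<dots> = jump_op f x"
    unfolding jump_op_def by (intro sum.cong refl) (subst nn_integral_cmult_indicator, auto)
  finally show ?thesis .
qed

definition jump_mass :: "('c, 's) state \<Rightarrow> ennreal" where
  "jump_mass x = ennreal (mass x * total_rate x)"

lemma jump_mass_invariant:
  assumes compatible: "\<And>s. \<exists>c. (s, c) \<in> E" and served: "\<And>c. \<exists>s. (s, c) \<in> E"
  shows "(\<S> x. jump_mass x * kern x y) = jump_mass y"
proof -
  have "jump_mass x * kern x y = (\<Sum>e\<in>UNIV. ennreal (rate e * mass x) * indicator (preds e y) x)" for x
  proof (cases "x \<in> states E")
    case True
    have "jump_mass x * kern x y = (\<Sum>e\<in>enabled x. ennreal (rate e * mass x) * of_bool (next_state E e x = y))"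
      unfolding jump_mass_def kern_def jump_op_def sum_distrib_left
    proof (rule sum.cong[OF refl])
      fix e
      have "mass x * total_rate x * (rate e / total_rate x) = rate e * mass x"
        by simp
      then show "ennreal (mass x * total_rate x) *
          (ennreal (rate e / total_rate x) * of_bool (next_state E e x = y)) =
        ennreal (rate e * mass x) * of_bool (next_state E e x = y)"
        unfolding mult.assoc[symmetric] by (subst ennreal_mult[symmetric]) simp_all
    qed
    also have "\<dots> = (\<Sum>e\<in>UNIV. ennreal (rate e * mass x) * indicator (preds e y) x)"
      by (rule sum.mono_neutral_cong_left) (auto simp: preds_def True)
    finally show ?thesis .
  qed (simp add: jump_mass_def mass_def)
  then have "(\<S> x. jump_mass x * kern x y) =
      (\<Sum>e\<in>UNIV. (\<S> x. ennreal (rate e * mass x) * indicator (preds e y) x))"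
    by (simp only: nn_integral_sum[OF borel_measurable_count_space])
  also have "\<dots> = (\<Sum>e\<in>UNIV. ennreal (\<Sum>x\<in>preds e y. rate e * mass x))"
  proof (rule sum.cong[OF refl])
    fix e
    have "(\<S> x. ennreal (rate e * mass x) * indicator (preds e y) x) =
        (\<integral>\<^sup>+ x. ennreal (rate e * mass x) \<partial>count_space (preds e y))"
      by (rule nn_integral_count_space_indicator[symmetric]) simp
    also have "\<dots> = (\<Sum>x\<in>preds e y. ennreal (rate e * mass x))"
      by (rule nn_integral_count_space_finite[OF finite_preds])
    also have "\<dots> = ennreal (\<Sum>x\<in>preds e y. rate e * mass x)"
      by (rule sum_ennreal) simp
    finally show "(\<S> x. ennreal (rate e * mass x) * indicator (preds e y) x) =
        ennreal (\<Sum>x\<in>preds e y. rate e * mass x)" .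
  qed
  also have "\<dots> = ennreal (\<Sum>e\<in>UNIV. \<Sum>x\<in>preds e y. rate e * mass x)"
    by (rule sum_ennreal) (auto intro: sum_nonneg)
  also have "\<dots> = jump_mass y"
    unfolding mass_balance[OF assms] jump_mass_def by (simp add: mult.commute)
  finally show ?thesis .
qed

lemma invariant_kernel_kern:
  assumes compatible: "\<And>s. \<exists>c. (s, c) \<in> E" and served: "\<And>c. \<exists>s. (s, c) \<in> E"
    and r: "r \<in> states E"
  shows "invariant_kernel kern jump_mass r"
proof
  show "(\<S> y. kern x y) = 1" for x
    using nn_integral_kern[of x "\<lambda>_. 1"] by (simp add: jump_op_const)
  show "(\<S> x. jump_mass x * kern x y) = jump_mass y" for y
    by (rule jump_mass_invariant[OF assms(1,2)])
  show "jump_mass x < \<infinity>" for x by (simp add: jump_mass_def)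
  show "jump_mass r \<noteq> 0"
    using form_pos[OF assms(1,2), of r] r by (simp add: jump_mass_def mass_def)
qed

lemma sum_lam_le_total_rate: "sum lam UNIV \<le> total_rate x"
  by (cases x) (simp add: total_rate_eq sum_nonneg less_imp_le[OF mu_pos])

lemma sum_lam_pos: "0 < sum lam UNIV"
  by (intro sum_pos lam_pos) auto

lemma jump_mass_finite_iff:
  "(\<S> x. jump_mass x * 1) < \<infinity> \<longleftrightarrow> (\<S> x. ennreal (mass x)) < \<infinity>"
proof
  assume fin: "(\<S> x. jump_mass x * 1) < \<infinity>"
  have "(\<S> x. ennreal (mass x)) \<le>
      (\<S> x. ennreal (1 / sum lam UNIV) * jump_mass x)"
  proof (rule nn_integral_mono)
    fix x
    have "mass x * sum lam UNIV \<le> mass x * total_rate x"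
      by (intro mult_left_mono sum_lam_le_total_rate) simp
    then have "mass x \<le> 1 / sum lam UNIV * (mass x * total_rate x)"
      using sum_lam_pos by (simp add: field_simps)
    then show "ennreal (mass x) \<le> ennreal (1 / sum lam UNIV) * jump_mass x"
      unfolding jump_mass_def using sum_lam_pos
      by (subst ennreal_mult[symmetric]) (auto intro: ennreal_leI)
  qed
  also have "\<dots> < \<infinity>"
    using fin by (simp add: nn_integral_cmult ennreal_mult_less_top)
  finally show "(\<S> x. ennreal (mass x)) < \<infinity>" .
next
  assume fin: "(\<S> x. ennreal (mass x)) < \<infinity>"
  have "(\<S> x. jump_mass x * 1) \<le>
      (\<S> x. ennreal rate_bound * ennreal (mass x))"
  proof (rule nn_integral_mono)
    fix x
    have "mass x * total_rate x \<le> rate_bound * mass x"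
      using mult_left_mono[OF total_rate_le[of x] mass_nonneg[of x]] by (simp add: mult.commute)
    then show "jump_mass x * 1 \<le> ennreal rate_bound * ennreal (mass x)"
      unfolding jump_mass_def using rate_bound_pos
      by (subst ennreal_mult[symmetric]) (auto intro: ennreal_leI)
  qed
  also have "\<dots> < \<infinity>"
    using fin by (simp add: nn_integral_cmult ennreal_mult_less_top)
  finally show "(\<S> x. jump_mass x * 1) < \<infinity>" .
qed

abbreviation jumps :: "(('c, 's) state \<times> ('c, 's) state) set" where
  "jumps \<equiv> {(x, y). kern x y \<noteq> 0}"

lemma jumpsI: "e \<in> enabled x \<Longrightarrow> (x, next_state E e x) \<in> jumps"
proof -
  assume e: "e \<in> enabled x"
  have "0 < ennreal (rate e / total_rate x)"
    by (simp add: ennreal_zero_less_divide divide_pos_pos)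
  moreover have "ennreal (rate e / total_rate x) * of_bool (next_state E e x = next_state E e x) \<le> kern x (next_state E e x)"
    unfolding kern_def jump_op_def by (rule member_le_sum[OF e]) auto
  ultimately show ?thesis by (auto simp: not_le[symmetric])
qed

lemma jumpsE:
  assumes "(x, y) \<in> jumps"
  obtains e where "e \<in> enabled x" "next_state E e x = y"
proof -
  have "\<exists>e\<in>enabled x. next_state E e x = y"
  proof (rule ccontr)
    assume "\<not> ?thesis"
    then have "kern x y = 0" unfolding kern_def jump_op_def by (intro sum.neutral) auto
    with assms show False by simp
  qed
  with that show ?thesis by blast
qed

text \<open>The oldest customer can be the next to enter service, through any compatible server,
  since in an admissible state that server is busy. Once the queue is empty, arriving customers take
  the idle servers one by one.\<close>

lemma jumps_to_empty:
  assumes compatible: "\<And>s. \<exists>c. (s, c) \<in> E" and served: "\<And>c. \<exists>s. (s, c) \<in> E"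
    and "(w, i) \<in> states E"
  shows "((w, i), ([], [])) \<in> jumps\<^sup>*"
  using assms(3)
proof (induct w)
  case (Cons c w)
  obtain s where s: "(s, c) \<in> E" using served by blast
  then have "s \<notin> set i" using Cons.prems by (auto simp: states_def)
  moreover have "List.extract (\<lambda>c. (s, c) \<in> E) (c # w) = Some ([], c, w)"
    using s by (simp add: extract_Some_iff)
  ultimately have "((c # w, i), (w, i)) \<in> jumps"
    using jumpsI[of "Completion s" "(c # w, i)"] by simp
  moreover have "(w, i) \<in> states E" using Cons.prems by (auto simp: states_def)
  ultimately show ?case using Cons.hyps by (meson converse_rtrancl_into_rtrancl)
next
  case Nil
  show ?case
  proof (induct i)
    case (Cons s i)
    obtain c where c: "(s, c) \<in> E" using compatible by blast
    have "List.extract (\<lambda>s. (s, c) \<in> E) (s # i) = Some ([], s, i)"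
      using c by (simp add: extract_Some_iff)
    then have "(([], s # i), ([], i)) \<in> jumps"
      using jumpsI[of "Arrival c" "([], s # i)"] by simp
    then show ?case using Cons by (meson converse_rtrancl_into_rtrancl)
  qed simp
qed

text \<open>Customers arrive first, while all servers are busy; then the servers of \<open>i\<close>
  complete in order and find no compatible customer.\<close>

lemma jumps_from_empty:
  assumes "(w, i) \<in> states E"
  shows "(([], []), (w, i)) \<in> jumps\<^sup>*"
  using assms
proof (induct i rule: rev_induct)
  case (snoc s i)
  have "List.extract (\<lambda>c. (s, c) \<in> E) w = None"
    using snoc.prems by (intro extract_None_iff[THEN iffD2]) (auto simp: states_def)
  moreover have "s \<notin> set i" using snoc.prems by (auto simp: states_def)
  ultimately have "((w, i), (w, i @ [s])) \<in> jumps"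
    using jumpsI[of "Completion s" "(w, i)"] by simp
  moreover have "(w, i) \<in> states E" using snoc.prems by (auto simp: states_def)
  ultimately show ?case using snoc.hyps by (meson rtrancl.rtrancl_into_rtrancl)
next
  case Nil
  show ?case
  proof (induct w rule: rev_induct)
    case (snoc c w)
    have "((w, []), (w @ [c], [])) \<in> jumps"
      using jumpsI[of "Arrival c" "(w, [])"] by (simp add: extract_Nil_code)
    then show ?case using snoc by (meson rtrancl.rtrancl_into_rtrancl)
  qed simp
qed

lemma jumps_connected:
  assumes "\<And>s. \<exists>c. (s, c) \<in> E" "\<And>c. \<exists>s. (s, c) \<in> E" and "x \<in> states E" "y \<in> states E"
  shows "(x, y) \<in> jumps\<^sup>*"
  using jumps_to_empty[OF assms(1,2), of "fst x" "snd x"] jumps_from_empty[of "fst y" "snd y"] assms(3,4)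
  by (simp add: rtrancl_trans)

text \<open>The operator \<open>avoid\<close> for the kernel \<open>kern\<close>, written as a
  finite sum over events so that it matches the first-step analysis of the paths.\<close>

definition avoiding :: "('c, 's) state \<Rightarrow> (('c, 's) state \<Rightarrow> ennreal) \<Rightarrow> ('c, 's) state \<Rightarrow> ennreal" where
  "avoiding r f x = jump_op (\<lambda>y. of_bool (y \<noteq> r) * f y) x"

theorem return_series_finite_iff:
  assumes compatible: "\<And>s. \<exists>c. (s, c) \<in> E" and served: "\<And>c. \<exists>s. (s, c) \<in> E"
    and r: "r \<in> states E"
  shows "(\<Sum>n. (avoiding r ^^ n) (\<lambda>_. 1) r) < \<infinity> \<longleftrightarrow> (\<forall>C. C \<noteq> {} \<longrightarrow> sum lam C < sum mu (servers_of E C))"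
proof -
  interpret I: invariant_kernel kern jump_mass r
    by (rule invariant_kernel_kern[OF assms])
  have avoid: "I.avoid = avoiding r"
    by (intro ext) (simp add: I.avoid_def avoiding_def nn_integral_kern I.off_def)
  have reach: "(y, r) \<in> jumps\<^sup>*" if "jump_mass y \<noteq> 0" for y
    using that r by (intro jumps_connected[OF assms(1,2)]) (auto simp: jump_mass_def mass_def split: if_splits)
  have "(\<Sum>n. (avoiding r ^^ n) (\<lambda>_. 1) r) < \<infinity> \<longleftrightarrow> (\<S> x. jump_mass x * 1) < \<infinity>"
    unfolding avoid[symmetric]
    by (rule iffI) (erule I.invariant_mass_finite[OF _ reach], assumption, rule I.return_series_finite)
  also have "\<dots> \<longleftrightarrow> (\<forall>C. C \<noteq> {} \<longrightarrow> sum lam C < sum mu (servers_of E C))"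
    unfolding jump_mass_finite_iff
  proof (intro iffI allI impI)
    assume "\<forall>C. C \<noteq> {} \<longrightarrow> sum lam C < sum mu (servers_of E C)"
    then show "(\<S> x. ennreal (mass x)) < \<infinity>"
      by (intro mass_summable) simp
  qed (rule load_of_mass_summable[OF served])
  finally show ?thesis .
qed

section \<open>Return times of the path in terms of the jump chain\<close>

lemma next_state_neq: "e \<in> enabled x \<Longrightarrow> next_state E e x \<noteq> x"
proof -
  obtain w i where x: "x = (w, i)" by (rule prod.exhaust)
  show ?thesis
  proof (cases e)
    case (Arrival c)
    show ?thesis
    proof (cases "List.extract (\<lambda>s. (s, c) \<in> E) i")
      case (Some a)
      then obtain i1 s i2 where ex: "List.extract (\<lambda>s. (s, c) \<in> E) i = Some (i1, s, i2)" by (metis prod.collapse)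
      then have "i = i1 @ s # i2" by (simp add: extract_Some_iff)
      then show ?thesis using ex by (simp add: x Arrival)
    qed (simp add: x Arrival)
  next
    case (Completion s)
    show ?thesis
    proof (cases "List.extract (\<lambda>c. (s, c) \<in> E) w")
      case (Some a)
      then obtain w1 c w2 where ex: "List.extract (\<lambda>c. (s, c) \<in> E) w = Some (w1, c, w2)" by (metis prod.collapse)
      then have "w = w1 @ c # w2" by (simp add: extract_Some_iff)
      then show ?thesis using ex by (simp add: x Completion)
    qed (simp add: x Completion)
  qed
qed

text \<open>Each event changes the length of exactly one of the two lists. Hence the first event
  leaves the initial state, as \<open>return_time\<close> demands before a visit counts as a return,
  and no state is absorbing.\<close>

lemma fst_after_event_neq: "fst (after_event E k) \<noteq> fst k"
  by (cases k) (simp add: after_event_def next_state_neq)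

lemma jump_time_step: "jump_time E k (Suc n) = jump_time E k n + holding ((after_event E ^^ n) k)"
  by (simp add: jump_time_def)

lemma jump_time_mono:
  assumes "good k" "m \<le> n"
  shows "jump_time E k m \<le> jump_time E k n"
  using assms(2)
proof (induct rule: dec_induct)
  case (step n)
  have "0 < holding ((after_event E ^^ n) k)" using assms(1) by (simp add: good_def)
  with step show ?case by (simp add: jump_time_step)
qed simp

lemma state_at_jump_time:
  assumes "good k"
  shows "state_at E (jump_time E k n) k = fst ((after_event E ^^ n) k)"
proof -
  have "0 < holding ((after_event E ^^ n) k)" using assms by (simp add: good_def)
  then have "in_period n (jump_time E k n) k"
    using jump_time_mono[OF assms] by (auto simp: in_period_def jump_time_step[of k n])
  then show ?thesis by (simp add: state_at_def jump_index_eqI)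
qed

lemma return_timeD:
  assumes k: "good k" and t: "0 \<le> t" "state_at E t k = fst k" and u: "0 \<le> u" "u < t" "state_at E u k \<noteq> fst k"
  shows "\<exists>n>0. fst ((after_event E ^^ n) k) = fst k \<and> jump_time E k n \<le> t"
proof -
  define n where "n = jump_index E t k"
  have n: "in_period n t k" unfolding n_def by (rule good_in_period[OF k t(1)])
  have "n \<noteq> 0"
  proof
    assume "n = 0"
    with n u(2) have "u < holding k" by (simp add: in_period_0)
    with u(3) show False by (simp add: state_at_less_holding)
  qed
  then obtain m where m: "n = Suc m" by (cases n) auto
  have "fst ((after_event E ^^ n) k) = fst k" using t(2) by (simp add: state_at_def n_def)
  moreover have "jump_time E k n \<le> t" using n unfolding m by (simp add: in_period_def)
  ultimately show ?thesis using \<open>n \<noteq> 0\<close> by auto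
qed

text \<open>The first return happens at a jump time, the sum of the holding times before it; the
  indicator stops the series there. Without a return both sides are infinite, because the jump times
  are unbounded.\<close>

lemma return_time_state_at:
  assumes k: "good k"
  shows "return_time (\<lambda>t. state_at E t k) (fst k) =
    (\<Sum>n. of_bool (\<forall>j\<in>{1..n}. fst ((after_event E ^^ j) k) \<noteq> fst k) * ennreal (holding ((after_event E ^^ n) k)))"
    (is "_ = (\<Sum>n. ?h n)")
proof -
  let ?Y = "\<lambda>n. fst ((after_event E ^^ n) k)"
  let ?S = "{ennreal t | t. 0 \<le> t \<and> state_at E t k = fst k \<and> (\<exists>u. 0 \<le> u \<and> u < t \<and> state_at E u k \<noteq> fst k)}"
  have hold: "0 < holding ((after_event E ^^ n) k)" for n using k by (simp add: good_def)
  have partial: "(\<Sum>n<N. ennreal (holding ((after_event E ^^ n) k))) = ennreal (jump_time E k N)" for N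
    unfolding jump_time_def using hold by (subst sum_ennreal) (auto intro: less_imp_le)
  show ?thesis
  proof (cases "\<exists>n>0. ?Y n = fst k")
    case True
    define N where "N = (LEAST n. 0 < n \<and> ?Y n = fst k)"
    have N: "0 < N" "?Y N = fst k" unfolding N_def using LeastI_ex[OF True] by auto
    have least: "N \<le> n" if "0 < n" "?Y n = fst k" for n
      unfolding N_def using that by (intro Least_le) simp
    have Y1: "?Y 1 \<noteq> fst k" using fst_after_event_neq by simp
    then have N1: "1 < N" using N by (cases "N = 1") auto
    have h: "?h n = (if n < N then ennreal (holding ((after_event E ^^ n) k)) else 0)" for n
    proof (cases "n < N")
      case True
      have "\<forall>j\<in>{1..n}. ?Y j \<noteq> fst k"
      proof (intro ballI notI)
        fix j assume "j \<in> {1..n}" "?Y j = fst k"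
        with least[of j] True show False by simp
      qed
      with True show ?thesis by simp
    next
      case False
      then have "N \<in> {1..n}" using N(1) by simp
      with N(2) have "\<not> (\<forall>j\<in>{1..n}. ?Y j \<noteq> fst k)" by blast
      with False show ?thesis by simp
    qed
    have "(\<Sum>n. ?h n) = (\<Sum>n<N. ennreal (holding ((after_event E ^^ n) k)))"
    proof -
      have "(\<Sum>n. ?h n) = sum ?h {..<N}"
        by (rule suminf_finite) (simp_all only: h finite_lessThan lessThan_iff if_False)
      also have "\<dots> = (\<Sum>n<N. ennreal (holding ((after_event E ^^ n) k)))"
        by (rule sum.cong[OF refl]) (simp only: h lessThan_iff if_True)
      finally show ?thesis .
    qed
    then have rhs: "(\<Sum>n. ?h n) = ennreal (jump_time E k N)" by (simp add: partial)
    have "Inf ?S = ennreal (jump_time E k N)"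
    proof (rule antisym)
      have 0: "0 \<le> jump_time E k n" for n
        using jump_time_mono[OF k, of 0 n] by simp
      \<comment> \<open>A return takes at least two jumps, and the first jump time is the witness
        that the path was away before.\<close>
      have "jump_time E k 1 < jump_time E k 2"
        using hold[of 1] jump_time_step[of k 1] by (simp add: numeral_2_eq_2)
      also have "\<dots> \<le> jump_time E k N" using N1 by (intro jump_time_mono[OF k]) simp
      finally have lt: "jump_time E k 1 < jump_time E k N" .
      have "ennreal (jump_time E k N) \<in> ?S"
        using 0 lt N Y1 state_at_jump_time[OF k, of 1] state_at_jump_time[OF k, of N]
        by (intro CollectI exI[of _ "jump_time E k N"] conjI exI[of _ "jump_time E k 1"]) simp_all
      then show "Inf ?S \<le> ennreal (jump_time E k N)" by (rule Inf_lower)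
      show "ennreal (jump_time E k N) \<le> Inf ?S"
      proof (rule Inf_greatest)
        fix s assume "s \<in> ?S"
        then obtain t u where s: "s = ennreal t" and t: "0 \<le> t" "state_at E t k = fst k"
          and u: "0 \<le> u" "u < t" "state_at E u k \<noteq> fst k" by blast
        from return_timeD[OF k t u] obtain n where n: "0 < n" "?Y n = fst k" "jump_time E k n \<le> t" by blast
        then have "jump_time E k N \<le> t"
          using jump_time_mono[OF k least[OF n(1,2)]] by simp
        then show "ennreal (jump_time E k N) \<le> s" unfolding s by (rule ennreal_leI)
      qed
    qed
    then show ?thesis unfolding return_time_def rhs .
  next
    case False
    have empty: "?S = {}"
    proof (rule ccontr)
      assume "?S \<noteq> {}"
      then obtain t u where t: "0 \<le> t" "state_at E t k = fst k"
        and u: "0 \<le> u" "u < t" "state_at E u k \<noteq> fst k" by blast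
      from return_timeD[OF k t u] False show False by blast
    qed
    have lhs: "return_time (\<lambda>t. state_at E t k) (fst k) = \<infinity>"
      unfolding return_time_def empty by simp
    have "?h n = ennreal (holding ((after_event E ^^ n) k))" for n
    proof -
      have "\<forall>j\<in>{1..n}. ?Y j \<noteq> fst k"
      proof (intro ballI notI)
        fix j assume "j \<in> {1..n}" "?Y j = fst k"
        with False show False by (metis atLeastAtMost_iff less_eq_Suc_le One_nat_def)
      qed
      then show ?thesis by simp
    qed
    moreover have "(\<Sum>n. ennreal (holding ((after_event E ^^ n) k))) = \<infinity>"
    proof (rule ccontr)
      assume "\<not> ?thesis"
      then obtain T where T: "(\<Sum>n. ennreal (holding ((after_event E ^^ n) k))) = ennreal T" "0 \<le> T"
        by (cases "\<Sum>n. ennreal (holding ((after_event E ^^ n) k))" rule: ennreal_cases) auto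
      obtain N where "T < jump_time E k N" using k by (auto simp: good_def)
      moreover have "ennreal (jump_time E k N) \<le> ennreal T"
        unfolding partial[symmetric] T(1)[symmetric] by (rule sum_le_suminf) auto
      ultimately show False using T(2) by (simp add: ennreal_le_iff)
    qed
    ultimately show ?thesis unfolding lhs by simp
  qed
qed

end

section \<open>Return times and ergodicity\<close>

lemma nn_integral_exp_law_le:
  assumes "0 < q" "0 \<le> h"
  shows "(\<integral>\<^sup>+ y. of_bool (y \<le> h) \<partial>exp_law q) = ennreal (1 - exp (- q * h))"
proof -
  have "(\<integral>\<^sup>+ y. of_bool (y \<le> h) \<partial>exp_law q) = (\<integral>\<^sup>+ y. indicator {..h} y \<partial>exp_law q)"
    by (rule nn_integral_cong) (simp add: indicator_def)
  also have "\<dots> = emeasure (exp_law q) {..h}"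
    by (rule nn_integral_indicator) simp
  also have "\<dots> = ennreal (erlang_CDF 0 q h)"
    by (rule emeasure_erlang_density[OF assms(1)])
  finally show ?thesis using assms by (simp add: erlang_CDF_def)
qed

lemma nn_integral_exp_law_id:
  assumes "0 < q"
  shows "(\<integral>\<^sup>+ y. ennreal y \<partial>exp_law q) = ennreal (1 / q)"
proof -
  have "(\<integral>\<^sup>+ y. ennreal y \<partial>exp_law q) = (\<integral>\<^sup>+ y. ennreal (exponential_density q y) * ennreal y \<partial>lborel)"
    by (rule nn_integral_exp_law) simp
  also have "\<dots> = (\<integral>\<^sup>+ y. ennreal (erlang_density 0 q y * y ^ 1) \<partial>lborel)"
    using assms by (intro nn_integral_cong) (simp add: ennreal_mult' less_imp_le)
  also have "\<dots> = ennreal (1 / q)"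
    by (subst nn_integral_erlang_ith_moment[OF assms]) simp
  finally show ?thesis .
qed

context queue
begin

lemma of_bool_le_measurable: "(\<lambda>u :: real. of_bool (u \<le> h) :: ennreal) \<in> borel_measurable borel"
  by measurable

lemma nn_integral_holding: "(\<E> \<kappa>. ennreal (holding (x, \<kappa>))) = ennreal (1 / total_rate x)"
proof -
  have "(\<E> \<kappa>. ennreal (holding (x, \<kappa>))) = (\<Sum>e\<in>enabled x. ennreal (rate e / total_rate x) *
      (\<integral>\<^sup>+ y. (\<E> \<kappa>. ennreal y) \<partial>exp_law (total_rate x)))"
    by (rule nn_integral_holding_after_event[where F="\<lambda>y _. ennreal y"])
       (rule measurable_compose[OF measurable_fst], simp)
  also have "\<dots> = jump_op (\<lambda>_. ennreal (1 / total_rate x)) x"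
    unfolding jump_op_def by (simp add: emeasure_clock_law_UNIV nn_integral_exp_law_id)
  finally show ?thesis by (simp only: jump_op_const)
qed

lemma nn_integral_holding_le:
  "0 \<le> h \<Longrightarrow> (\<E> \<kappa>. of_bool (holding (x, \<kappa>) \<le> h)) = ennreal (1 - exp (- total_rate x * h))"
proof -
  assume h: "0 \<le> h"
  have "(\<E> \<kappa>. of_bool (holding (x, \<kappa>) \<le> h)) = (\<Sum>e\<in>enabled x. ennreal (rate e / total_rate x) *
      (\<integral>\<^sup>+ y. (\<E> \<kappa>. of_bool (y \<le> h)) \<partial>exp_law (total_rate x)))"
    by (rule nn_integral_holding_after_event[where F="\<lambda>y _. of_bool (y \<le> h)"])
       (rule measurable_compose[OF measurable_fst of_bool_le_measurable])
  also have "\<dots> = jump_op (\<lambda>_. ennreal (1 - exp (- total_rate x * h))) x"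
    unfolding jump_op_def
    by (simp add: emeasure_clock_law_UNIV nn_integral_exp_law_le h del: mult_minus_left)
  finally show ?thesis by (simp only: jump_op_const)
qed

definition excursion :: "('c, 's) state \<Rightarrow> nat \<Rightarrow> ('c, 's) timed \<Rightarrow> ennreal" where
  "excursion r n k =
    of_bool (\<forall>j\<in>{1..n}. fst ((after_event E ^^ j) k) \<noteq> r) * ennreal (holding ((after_event E ^^ n) k))"

lemma excursion_Suc:
  "excursion r (Suc n) k = of_bool (fst (after_event E k) \<noteq> r) * excursion r n (after_event E k)"
proof -
  have "{1..Suc n} = insert 1 (Suc ` {1..n})"
    by (auto simp: image_iff Suc_le_eq)
  then show ?thesis
    unfolding excursion_def by (simp add: funpow_swap1 of_bool_conj mult.assoc del: image_Suc_atLeastAtMost)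
qed

lemma excursion_measurable: "excursion r n \<in> borel_measurable pair_space"
proof (induct n)
  case 0
  have "(\<lambda>k. ennreal (holding k)) \<in> borel_measurable pair_space"
    by (rule measurable_compose[OF holding_measurable]) simp
  moreover have "excursion r 0 = (\<lambda>k. ennreal (holding k))"
    by (rule ext) (simp add: excursion_def)
  ultimately show ?case by (simp only:)
next
  case (Suc n)
  have "(\<lambda>k. of_bool (fst (after_event E k) \<noteq> r) :: ennreal) \<in> borel_measurable pair_space"
    by (rule measurable_compose[OF measurable_compose[OF after_event_measurable measurable_fst]]) simp
  then show ?case
    unfolding excursion_Suc[abs_def]
    by (rule borel_measurable_times_ennreal) (rule measurable_compose[OF after_event_measurable Suc])
qed

text \<open>First-step analysis; the function at the end of the iteration is the mean holding time
  in the state then reached.\<close>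

lemma nn_integral_excursion:
  "(\<E> \<kappa>. excursion r n (x, \<kappa>)) = (avoiding r ^^ n) (\<lambda>z. ennreal (1 / total_rate z)) x"
proof (induct n arbitrary: x)
  case 0
  then show ?case by (simp add: excursion_def nn_integral_holding)
next
  case (Suc n)
  define F where "F k = of_bool (fst k \<noteq> r) * excursion r n k" for k
  have F: "F \<in> borel_measurable pair_space"
    unfolding F_def
    by (intro borel_measurable_times_ennreal excursion_measurable)
       (rule measurable_compose[OF measurable_fst], simp)
  have inner: "(\<E> \<kappa>. F (z, \<kappa>)) =
      of_bool (z \<noteq> r) * (avoiding r ^^ n) (\<lambda>z. ennreal (1 / total_rate z)) z" for z
    unfolding Suc[symmetric] F_def by (cases "z = r") simp_all
  have "(\<E> \<kappa>. excursion r (Suc n) (x, \<kappa>)) = (\<E> \<kappa>. F (after_event E (x, \<kappa>)))"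
    by (simp add: excursion_Suc F_def)
  also have "\<dots> = jump_op (\<lambda>z. of_bool (z \<noteq> r) * (avoiding r ^^ n) (\<lambda>z. ennreal (1 / total_rate z)) z) x"
    unfolding nn_integral_after_event[OF F] inner ..
  finally show ?case
    unfolding funpow.simps comp_apply
    by (simp only: avoiding_def[of r "(avoiding r ^^ n) (\<lambda>z. ennreal (1 / total_rate z))"])
qed

lemma avoiding_mono: "f \<le> g \<Longrightarrow> avoiding r f \<le> avoiding r g"
  unfolding avoiding_def le_fun_def by (intro allI jump_op_mono mult_left_mono) auto

lemma funpow_avoiding_mono: "f \<le> g \<Longrightarrow> (avoiding r ^^ n) f \<le> (avoiding r ^^ n) g"
  by (induct n) (auto intro: avoiding_mono)

lemma avoiding_cmult: "avoiding r (\<lambda>x. c * f x) x = c * avoiding r f x"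
  by (simp add: avoiding_def jump_op_def sum_distrib_left mult_ac)

lemma funpow_avoiding_const: "(avoiding r ^^ n) (\<lambda>_. c) x = c * (avoiding r ^^ n) (\<lambda>_. 1) x"
proof (induct n arbitrary: x)
  case (Suc n)
  have "(avoiding r ^^ n) (\<lambda>_. c) = (\<lambda>x. c * (avoiding r ^^ n) (\<lambda>_. 1) x)"
    using Suc by (rule ext)
  then show ?case by (simp only: funpow.simps comp_apply avoiding_cmult)
qed simp

lemma excursion_series_finite_iff:
  "(\<Sum>n. (avoiding r ^^ n) (\<lambda>z. ennreal (1 / total_rate z)) r) < \<infinity> \<longleftrightarrow>
   (\<Sum>n. (avoiding r ^^ n) (\<lambda>_. 1) r) < \<infinity>"
proof
  have "(\<Sum>n. (avoiding r ^^ n) (\<lambda>_. ennreal (1 / rate_bound)) r) \<le>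
      (\<Sum>n. (avoiding r ^^ n) (\<lambda>z. ennreal (1 / total_rate z)) r)"
  proof (intro suminf_le funpow_avoiding_mono[THEN le_funD] le_funI ennreal_leI)
    show "1 / rate_bound \<le> 1 / total_rate z" for z
      using total_rate_le[of z] total_rate_pos[of z] by (intro divide_left_mono) (auto simp: rate_bound_pos)
  qed auto
  moreover assume "(\<Sum>n. (avoiding r ^^ n) (\<lambda>z. ennreal (1 / total_rate z)) r) < \<infinity>"
  ultimately have "(\<Sum>n. (avoiding r ^^ n) (\<lambda>_. ennreal (1 / rate_bound)) r) < \<infinity>"
    by (rule le_less_trans)
  then have "ennreal (1 / rate_bound) * (\<Sum>n. (avoiding r ^^ n) (\<lambda>_. 1) r) < \<infinity>"
    unfolding funpow_avoiding_const[where c="ennreal (1 / rate_bound)"] by simp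
  moreover have "0 < ennreal (1 / rate_bound)" using rate_bound_pos by simp
  ultimately show "(\<Sum>n. (avoiding r ^^ n) (\<lambda>_. 1) r) < \<infinity>"
    by (auto simp: ennreal_mult_less_top)
next
  assume fin: "(\<Sum>n. (avoiding r ^^ n) (\<lambda>_. 1) r) < \<infinity>"
  have "(\<Sum>n. (avoiding r ^^ n) (\<lambda>z. ennreal (1 / total_rate z)) r) \<le>
      (\<Sum>n. (avoiding r ^^ n) (\<lambda>_. ennreal (1 / sum lam UNIV)) r)"
  proof (intro suminf_le funpow_avoiding_mono[THEN le_funD] le_funI ennreal_leI)
    show "1 / total_rate z \<le> 1 / sum lam UNIV" for z
      using sum_lam_le_total_rate[of z] total_rate_pos[of z] by (intro divide_left_mono) (auto simp: sum_lam_pos)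
  qed auto
  also have "\<dots> = ennreal (1 / sum lam UNIV) * (\<Sum>n. (avoiding r ^^ n) (\<lambda>_. 1) r)"
    unfolding funpow_avoiding_const[where c="ennreal (1 / sum lam UNIV)"] by simp
  also have "\<dots> < \<infinity>"
    using fin by (simp add: ennreal_mult_less_top)
  finally show "(\<Sum>n. (avoiding r ^^ n) (\<lambda>z. ennreal (1 / total_rate z)) r) < \<infinity>" .
qed

section \<open>Irreducibility\<close>

lemma trans_prob_mult_le:
  assumes "0 \<le> t" "0 \<le> s"
  shows "trans_prob t x z * trans_prob s z y \<le> trans_prob (t + s) x y"
proof -
  have "ennreal (trans_prob t x z) * ennreal (trans_prob s z y) \<le> ennreal (trans_prob (t + s) x y)"
    unfolding trans_prob_add[OF assms] by (rule nn_integral_ge_point) simp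
  then show ?thesis by (simp add: ennreal_mult'[symmetric] ennreal_le_iff)
qed

text \<open>With positive probability the first event is one that leads to \<open>y\<close>, it
  occurs by time 1, and the next holding time exceeds 1. The process is then in \<open>y\<close> at
  time 1.\<close>

lemma trans_prob_jump:
  assumes "(x, y) \<in> jumps"
  shows "0 < trans_prob 1 x y"
proof -
  from assms obtain e where e: "e \<in> enabled x" "next_state E e x = y" by (rule jumpsE)
  define g where "g k = (of_bool (fst k = y) * of_bool (1 < holding k) :: ennreal)" for k
  define F where "F u k = of_bool (u \<le> 1) * g k" for u :: real and k
  have gt: "(\<lambda>u :: real. of_bool (1 < u) :: ennreal) \<in> borel_measurable borel" by measurable
  have g: "g \<in> borel_measurable pair_space"
    unfolding g_def
    by (intro borel_measurable_times_ennreal measurable_compose[OF holding_measurable gt])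
       (rule measurable_compose[OF measurable_fst], simp)
  have F: "(\<lambda>z. F (fst z) (snd z)) \<in> borel_measurable (borel \<Otimes>\<^sub>M pair_space)"
    unfolding F_def
    by (intro borel_measurable_times_ennreal measurable_compose[OF measurable_fst of_bool_le_measurable]
        measurable_compose[OF measurable_snd g])
  have inner: "(\<E> \<kappa>. F u (y, \<kappa>)) = of_bool (u \<le> 1) * ennreal (exp (- total_rate y * 1))" for u
    by (cases "u \<le> 1") (simp_all only: F_def g_def of_bool_eq fst_conv refl mult_1 mult_zero_left simp_thms
        nn_integral_less_holding[OF zero_le_one] nn_integral_const)
  have pos: "0 < ennreal (rate e / total_rate x) * (\<integral>\<^sup>+ u. (\<E> \<kappa>. F u (y, \<kappa>)) \<partial>exp_law (total_rate x))"
  proof -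
    have "(\<integral>\<^sup>+ u. (\<E> \<kappa>. F u (y, \<kappa>)) \<partial>exp_law (total_rate x)) =
        ennreal (1 - exp (- total_rate x * 1)) * ennreal (exp (- total_rate y * 1))"
      unfolding inner nn_integral_exp_law_le[OF total_rate_pos zero_le_one, symmetric]
      by (rule nn_integral_multc, rule measurable_compose[OF _ of_bool_le_measurable]) simp
    moreover have "0 < 1 - exp (- total_rate x * 1)" by simp
    ultimately show ?thesis
      by (simp add: ennreal_zero_less_mult_iff ennreal_zero_less_divide divide_pos_pos)
  qed
  also have "\<dots> \<le> (\<Sum>e\<in>enabled x. ennreal (rate e / total_rate x) *
      (\<integral>\<^sup>+ u. (\<E> \<kappa>. F u (next_state E e x, \<kappa>)) \<partial>exp_law (total_rate x)))"
    using member_le_sum[OF e(1), of "\<lambda>e. ennreal (rate e / total_rate x) *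
      (\<integral>\<^sup>+ u. (\<E> \<kappa>. F u (next_state E e x, \<kappa>)) \<partial>exp_law (total_rate x))"] e(2) by simp
  also have "\<dots> = (\<E> \<kappa>. F (holding (x, \<kappa>)) (after_event E (x, \<kappa>)))"
    by (rule nn_integral_holding_after_event[OF F, symmetric])
  also have "\<dots> \<le> (\<E> \<kappa>. of_bool (state_at E 1 (x, \<kappa>) = y))"
  proof (rule nn_integral_mono_AE)
    show "AE \<kappa> in clock_law. F (holding (x, \<kappa>)) (after_event E (x, \<kappa>)) \<le> of_bool (state_at E 1 (x, \<kappa>) = y)"
      using AE_holding_pos[of 0 x]
    proof eventually_elim
      case (elim \<kappa>)
      show ?case
      proof (cases "holding (x, \<kappa>) \<le> 1 \<and> fst (after_event E (x, \<kappa>)) = y \<and> 1 < holding (after_event E (x, \<kappa>))")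
        case True
        then have "in_period (Suc 0) 1 (x, \<kappa>)"
          using elim by (simp add: in_period_Suc in_period_0)
        then have "state_at E 1 (x, \<kappa>) = y" using True by (simp add: state_at_def jump_index_eqI)
        then show ?thesis by (simp add: F_def g_def)
      qed (auto simp: F_def g_def)
    qed
  qed
  finally show ?thesis unfolding nn_integral_of_bool_state_at by simp
qed

lemma trans_prob_pos_of_jumps:
  assumes "(x, y) \<in> jumps\<^sup>*"
  shows "\<exists>t\<ge>0. 0 < trans_prob t x y"
  using assms
proof (induct rule: rtrancl_induct)
  case base
  show ?case by (intro exI[of _ 0]) (simp add: trans_prob_0)
next
  case (step y z)
  then obtain t where t: "0 \<le> t" "0 < trans_prob t x y" by blast
  have "0 < trans_prob t x y * trans_prob 1 y z"
    using t(2) trans_prob_jump[OF step(2)] by simp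
  also have "\<dots> \<le> trans_prob (t + 1) x z"
    using t(1) by (intro trans_prob_mult_le) auto
  finally show ?case using t(1) by (intro exI[of _ "t + 1"]) simp
qed

lemma irreducible_chain_trans_prob:
  assumes "\<And>s. \<exists>c. (s, c) \<in> E" "\<And>c. \<exists>s. (s, c) \<in> E"
  shows "irreducible_chain (states E) trans_prob"
  unfolding irreducible_chain_def using trans_prob_pos_of_jumps jumps_connected[OF assms] by blast

lemma unserved_stays:
  assumes "\<And>s. (s, c) \<notin> E" "c \<in> set (fst (fst k))"
  shows "c \<in> set (fst (fst ((after_event E ^^ n) k)))"
proof (induct n)
  case (Suc n)
  obtain w i \<kappa> where k: "(after_event E ^^ n) k = ((w, i), \<kappa>)" by (metis prod.collapse)
  have c: "c \<in> set w" using Suc by (simp add: k)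
  have "c \<in> set (fst (next_state E e (w, i)))" for e
  proof (cases e)
    case (Arrival d)
    then show ?thesis using c by (auto split: option.split)
  next
    case (Completion s)
    show ?thesis
    proof (cases "List.extract (\<lambda>c. (s, c) \<in> E) w")
      case (Some a)
      then obtain w1 d w2 where ex: "List.extract (\<lambda>c. (s, c) \<in> E) w = Some (w1, d, w2)" by (metis prod.collapse)
      then have "w = w1 @ d # w2" "(s, d) \<in> E" by (auto simp: extract_Some_iff)
      then show ?thesis using c assms(1) ex by (auto simp: Completion)
    qed (simp add: Completion c)
  qed
  moreover have "(after_event E ^^ Suc n) k = after_event E ((w, i), \<kappa>)" by (simp add: k)
  ultimately show ?case by (simp add: after_event_def del: funpow.simps)
qed (use assms(2) in simp)

text \<open>A waiting customer whom no server can serve never leaves the queue, so the empty queue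
  could not be reached from a state with such a customer.\<close>

lemma served_of_irreducible:
  assumes "irreducible_chain (states E) trans_prob"
  shows "\<exists>s. (s, c) \<in> E"
proof (rule ccontr)
  assume "\<not> ?thesis"
  then have un: "\<And>s. (s, c) \<notin> E" by blast
  have "([c], []) \<in> states E" "([], []) \<in> states E" by (auto simp: states_def)
  then obtain t where t: "0 < trans_prob t ([c], []) ([], [])"
    using assms unfolding irreducible_chain_def by blast
  have "c \<in> set (fst (state_at E t (([c], []), \<kappa>)))" for \<kappa>
    unfolding state_at_def by (rule unserved_stays[OF un]) simp
  then have "state_at E t (([c], []), \<kappa>) \<noteq> ([], [])" for \<kappa>
    by (metis empty_iff empty_set fst_conv)
  then have "{\<kappa>. state_at E t (([c], []), \<kappa>) = ([], [])} = {}" by blast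
  with t show False by (simp add: trans_prob_def)
qed

end

section \<open>Ergodicity of the process on the given probability space\<close>

context driven_queue
begin

lemma expected_return_time:
  "(\<integral>\<^sup>+ \<omega>. return_time (\<lambda>t. X x t \<omega>) x \<partial>M) = (\<Sum>n. (avoiding x ^^ n) (\<lambda>z. ennreal (1 / total_rate z)) x)"
proof -
  have m: "(\<lambda>\<kappa>. excursion x n (x, \<kappa>)) \<in> borel_measurable clock_space" for n
    by (rule measurable_compose[OF Pair_measurable_clocks excursion_measurable])
  have m': "(\<lambda>\<kappa>. \<Sum>n. excursion x n (x, \<kappa>)) \<in> borel_measurable clock_space"
    by (rule borel_measurable_suminf_order[OF m])
  have "(\<integral>\<^sup>+ \<omega>. return_time (\<lambda>t. X x t \<omega>) x \<partial>M) = (\<integral>\<^sup>+ \<omega>. (\<Sum>n. excursion x n (x, clocks \<omega>)) \<partial>M)"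
  proof (rule nn_integral_cong_AE)
    show "AE \<omega> in M. return_time (\<lambda>t. X x t \<omega>) x = (\<Sum>n. excursion x n (x, clocks \<omega>))"
      using AE_good_clocks[of x]
    proof eventually_elim
      case (elim \<omega>)
      then show ?case
        using return_time_state_at[of "(x, clocks \<omega>)"] by (simp only: X_eq excursion_def fst_conv)
    qed
  qed
  also have "\<dots> = (\<E> \<kappa>. (\<Sum>n. excursion x n (x, \<kappa>)))"
    by (rule nn_integral_clocks[OF m'])
  also have "\<dots> = (\<Sum>n. (\<E> \<kappa>. excursion x n (x, \<kappa>)))"
    by (rule nn_integral_suminf) (use m in \<open>simp only: measurable_clock_law\<close>)
  finally show ?thesis by (simp only: nn_integral_excursion)
qed

lemma not_absorbing: "\<not> (AE \<omega> in M. \<forall>t\<ge>0. X x t \<omega> = x)"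
proof
  assume "AE \<omega> in M. \<forall>t\<ge>0. X x t \<omega> = x"
  then have "AE \<omega> in M. False"
    using AE_good_clocks[of x]
  proof eventually_elim
    case (elim \<omega>)
    have "X x (jump_time E (x, clocks \<omega>) 1) \<omega> \<noteq> x"
      using state_at_jump_time[OF elim(2), of 1] fst_after_event_neq[of "(x, clocks \<omega>)"] by (simp add: X_eq)
    moreover have "0 \<le> jump_time E (x, clocks \<omega>) 1"
      using jump_time_mono[OF elim(2), of 0 1] by simp
    ultimately show False using elim(1) by blast
  qed
  then show False by simp
qed

lemma positive_recurrent_iff:
  assumes "\<And>s. \<exists>c. (s, c) \<in> E" "\<And>c. \<exists>s. (s, c) \<in> E" "x \<in> states E"
  shows "positive_recurrent M X x \<longleftrightarrow> (\<forall>C. C \<noteq> {} \<longrightarrow> sum lam C < sum mu (servers_of E C))"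
  unfolding positive_recurrent_def expected_return_time excursion_series_finite_iff
    return_series_finite_iff[OF assms]
  using not_absorbing by simp

text \<open>The recurrence criterion presupposes that every customer type is served. Irreducibility
  gives this in one direction; in the other, a type without server would violate the load condition
  for its singleton, where the right-hand side is an empty sum.\<close>

theorem ergodic_iff:
  assumes compatible: "\<And>s. \<exists>c. (s, c) \<in> E"
  shows "ergodic M (states E) X \<longleftrightarrow> (\<forall>C. C \<noteq> {} \<longrightarrow> sum lam C < sum mu (servers_of E C))"
proof
  assume erg: "ergodic M (states E) X"
  then have served: "\<And>c. \<exists>s. (s, c) \<in> E"
    unfolding ergodic_def transition_prob_eq by (intro served_of_irreducible) simp
  have "([], []) \<in> states E" by (simp add: states_def)
  moreover from this have "positive_recurrent M X ([], [])"
    using erg unfolding ergodic_def by simp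
  ultimately show "\<forall>C. C \<noteq> {} \<longrightarrow> sum lam C < sum mu (servers_of E C)"
    using positive_recurrent_iff[OF compatible served] by simp
next
  assume cond: "\<forall>C. C \<noteq> {} \<longrightarrow> sum lam C < sum mu (servers_of E C)"
  have served: "\<exists>s. (s, c) \<in> E" for c
  proof (rule ccontr)
    assume "\<not> ?thesis"
    then have "servers_of E {c} = {}" by (auto simp: servers_of_def)
    then show False using cond[rule_format, of "{c}"] lam_pos[of c] by simp
  qed
  show "ergodic M (states E) X"
    unfolding ergodic_def transition_prob_eq
  proof (intro conjI ballI)
    show "irreducible_chain (states E) trans_prob"
      by (rule irreducible_chain_trans_prob[OF compatible served])
    show "positive_recurrent M X x" if "x \<in> states E" for x
      using positive_recurrent_iff[OF compatible served that] cond by simp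
  qed
qed

end

section \<open>Stationary distributions\<close>

lemma nn_integral_count_space_eqD:
  fixes f g :: "'x \<Rightarrow> ennreal"
  assumes le: "\<And>x. f x \<le> g x" and eq: "(\<S> x. f x) = (\<S> x. g x)"
    and fin: "(\<S> x. f x) < \<infinity>"
  shows "f x = g x"
proof -
  have "(\<S> x. g x - f x) = (\<S> x. g x) - (\<S> x. f x)"
    using fin le by (intro nn_integral_diff) (auto simp: AE_count_space)
  also have "\<dots> = 0" using eq fin by (simp add: diff_eq_0_ennreal)
  finally have "g x - f x = 0" by (simp add: nn_integral_0_iff_AE AE_count_space)
  then show ?thesis using le[of x] by (metis diff_eq_0_iff_ennreal antisym)
qed

text \<open>From \<open>exp (- u) \<le> 1 / (1 + u)\<close>. Linearising the probability of leaving
  a state thus costs only a second-order term.\<close>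

lemma exp_minus_le: "0 \<le> u \<Longrightarrow> exp (- u) + u \<le> 1 + (u :: real)\<^sup>2"
proof -
  assume u: "0 \<le> u"
  have "exp (- u) \<le> 1 / (1 + u)"
    using exp_ge_add_one_self[of u] u by (simp add: exp_minus divide_inverse le_imp_inverse_le)
  also have "\<dots> \<le> 1 - u + u\<^sup>2"
  proof -
    have "(1 - u + u\<^sup>2) * (1 + u) = 1 + u ^ 3" by (simp add: algebra_simps power2_eq_square power3_eq_cube)
    then have "1 \<le> (1 - u + u\<^sup>2) * (1 + u)" using u by simp
    then show ?thesis using u by (simp add: divide_le_eq)
  qed
  finally show ?thesis by simp
qed

context queue
begin

text \<open>Up to time \<open>h\<close> there is no event, exactly one, or more. More than one
  forces the first two holding times to be at most \<open>h\<close>, which has probability at most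
  \<open>(rate_bound * h)\<^sup>2\<close>; since \<open>f\<close> is at most 1, this also bounds the
  contribution.\<close>

lemma small_time_bound:
  assumes h: "0 \<le> h" and f: "\<And>x. f x \<le> (1 :: ennreal)"
  shows "(\<E> \<kappa>. f (state_at E h (x, \<kappa>))) \<le>
    ennreal (exp (- total_rate x * h)) * f x + ennreal (total_rate x * h) * jump_op f x + ennreal ((rate_bound * h)\<^sup>2)"
proof -
  define p where "p z = 1 - exp (- total_rate z * h)" for z
  have p_le: "p z \<le> total_rate z * h" for z
    using exp_ge_add_one_self[of "- total_rate z * h"] by (simp add: p_def)
  have p_nonneg: "0 \<le> p z" for z
    using h by (simp add: p_def)
  define F where "F u k = of_bool (u \<le> h) * f (fst k)" for u :: real and k :: "('c, 's) timed"
  define G where "G u k = (of_bool (u \<le> h) * of_bool (holding k \<le> h) :: ennreal)" for u :: real and k :: "('c, 's) timed"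
  have F: "(\<lambda>z. F (fst z) (snd z)) \<in> borel_measurable (borel \<Otimes>\<^sub>M pair_space)"
    unfolding F_def
    by (intro borel_measurable_times_ennreal measurable_compose[OF measurable_fst of_bool_le_measurable]
        measurable_compose[OF measurable_compose[OF measurable_snd measurable_fst], of f]) simp
  have G: "(\<lambda>z. G (fst z) (snd z)) \<in> borel_measurable (borel \<Otimes>\<^sub>M pair_space)"
    unfolding G_def
    by (intro borel_measurable_times_ennreal measurable_compose[OF measurable_fst of_bool_le_measurable]
        measurable_compose[OF measurable_compose[OF measurable_snd holding_measurable] of_bool_le_measurable])
  have prob1: "(\<E> \<kappa>. c) = c" for c
    by (simp add: emeasure_clock_law_UNIV)
  have intF: "(\<E> \<kappa>. F (holding (x, \<kappa>)) (after_event E (x, \<kappa>))) = ennreal (p x) * jump_op f x"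
  proof -
    have "(\<integral>\<^sup>+ u. (\<E> \<kappa>. F u (z, \<kappa>)) \<partial>exp_law (total_rate x)) = ennreal (p x) * f z" for z
      unfolding F_def fst_conv prob1 p_def nn_integral_exp_law_le[OF total_rate_pos h, symmetric]
      by (rule nn_integral_multc, rule measurable_compose[OF _ of_bool_le_measurable]) simp
    then show ?thesis
      unfolding nn_integral_holding_after_event[OF F] jump_op_def by (simp only: sum_distrib_left mult.left_commute)
  qed
  have intG: "(\<E> \<kappa>. G (holding (x, \<kappa>)) (after_event E (x, \<kappa>))) \<le> ennreal ((rate_bound * h)\<^sup>2)"
  proof -
    have p_bound: "p z \<le> rate_bound * h" for z
      using p_le[of z] mult_right_mono[OF total_rate_le h, of z] by linarith
    have "(\<integral>\<^sup>+ u. (\<E> \<kappa>. G u (z, \<kappa>)) \<partial>exp_law (total_rate x)) \<le> ennreal ((rate_bound * h)\<^sup>2)" for z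
    proof -
      have "(\<E> \<kappa>. G u (z, \<kappa>)) = of_bool (u \<le> h) * ennreal (p z)" for u
        by (cases "u \<le> h") (simp_all only: G_def of_bool_eq simp_thms mult_1 mult_zero_left
            nn_integral_holding_le[OF h] p_def prob1)
      then have "(\<integral>\<^sup>+ u. (\<E> \<kappa>. G u (z, \<kappa>)) \<partial>exp_law (total_rate x)) =
          (\<integral>\<^sup>+ u. of_bool (u \<le> h) * ennreal (p z) \<partial>exp_law (total_rate x))"
        by (simp only:)
      also have "\<dots> = ennreal (p x) * ennreal (p z)"
        unfolding p_def[of x] nn_integral_exp_law_le[OF total_rate_pos h, symmetric]
        by (rule nn_integral_multc, rule measurable_compose[OF _ of_bool_le_measurable]) simp
      also have "\<dots> \<le> ennreal (rate_bound * h) * ennreal (rate_bound * h)"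
        by (intro mult_mono ennreal_leI p_bound) auto
      also have "\<dots> = ennreal ((rate_bound * h)\<^sup>2)"
        using rate_bound_pos h by (simp add: ennreal_mult'[symmetric] power2_eq_square)
      finally show ?thesis .
    qed
    then have "(\<E> \<kappa>. G (holding (x, \<kappa>)) (after_event E (x, \<kappa>))) \<le>
        jump_op (\<lambda>_. ennreal ((rate_bound * h)\<^sup>2)) x"
      unfolding nn_integral_holding_after_event[OF G] jump_op_def by (intro sum_mono mult_left_mono) auto
    then show ?thesis by (simp only: jump_op_const)
  qed
  define a where "a \<kappa> = of_bool (h < holding (x, \<kappa>)) * f x" for \<kappa>
  have gt: "(\<lambda>u :: real. of_bool (h < u) :: ennreal) \<in> borel_measurable borel" by measurable
  have P: "Pair x \<in> measurable clock_law pair_space"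
    unfolding measurable_clock_law by (rule Pair_measurable_clocks)
  have am: "(\<lambda>\<kappa>. of_bool (h < holding (x, \<kappa>)) :: ennreal) \<in> borel_measurable clock_law"
    by (rule measurable_compose[OF measurable_compose[OF P holding_measurable] gt])
  have a_meas: "a \<in> borel_measurable clock_law"
    unfolding a_def by (intro borel_measurable_times_ennreal am borel_measurable_const)
  have HA: "(\<lambda>\<kappa>. (holding (x, \<kappa>), after_event E (x, \<kappa>))) \<in> measurable clock_law (borel \<Otimes>\<^sub>M pair_space)"
    by (intro measurable_Pair measurable_compose[OF P holding_measurable] measurable_compose[OF P after_event_measurable])
  have F_meas: "(\<lambda>\<kappa>. F (holding (x, \<kappa>)) (after_event E (x, \<kappa>))) \<in> borel_measurable clock_law"
    using measurable_compose[OF HA F] unfolding fst_conv snd_conv .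
  have G_meas: "(\<lambda>\<kappa>. G (holding (x, \<kappa>)) (after_event E (x, \<kappa>))) \<in> borel_measurable clock_law"
    using measurable_compose[OF HA G] unfolding fst_conv snd_conv .
  have "(\<E> \<kappa>. f (state_at E h (x, \<kappa>))) \<le>
    (\<E> \<kappa>. (a \<kappa> + F (holding (x, \<kappa>)) (after_event E (x, \<kappa>))) + G (holding (x, \<kappa>)) (after_event E (x, \<kappa>)))"
  proof (rule nn_integral_mono_AE)
    show "AE \<kappa> in clock_law. f (state_at E h (x, \<kappa>)) \<le>
      (a \<kappa> + F (holding (x, \<kappa>)) (after_event E (x, \<kappa>))) + G (holding (x, \<kappa>)) (after_event E (x, \<kappa>))"
      using AE_holding_pos[of 0 x]
    proof eventually_elim
      case (elim \<kappa>)
      consider "h < holding (x, \<kappa>)" | "holding (x, \<kappa>) \<le> h" "h < holding (after_event E (x, \<kappa>))"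
        | "holding (x, \<kappa>) \<le> h" "holding (after_event E (x, \<kappa>)) \<le> h" by linarith
      then show ?case
      proof cases
        case 1
        then show ?thesis by (simp add: a_def state_at_less_holding add.assoc)
      next
        case 2
        then have "in_period (Suc 0) h (x, \<kappa>)"
          using elim by (simp add: in_period_Suc in_period_0)
        then have "state_at E h (x, \<kappa>) = fst (after_event E (x, \<kappa>))" by (simp add: state_at_def jump_index_eqI)
        then show ?thesis using 2 by (simp add: a_def F_def)
      next
        case 3
        then have "G (holding (x, \<kappa>)) (after_event E (x, \<kappa>)) = 1" by (simp add: G_def)
        then show ?thesis using f[of "state_at E h (x, \<kappa>)"] by (simp add: add_increasing)
      qed
    qed
  qed
  also have "\<dots> = ((\<E> \<kappa>. a \<kappa>) + ennreal (p x) * jump_op f x) +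
      (\<E> \<kappa>. G (holding (x, \<kappa>)) (after_event E (x, \<kappa>)))"
    unfolding intF[symmetric]
    by (subst nn_integral_add[OF borel_measurable_add[OF a_meas F_meas] G_meas])
       (subst nn_integral_add[OF a_meas F_meas], rule refl)
  also have "(\<E> \<kappa>. a \<kappa>) = ennreal (exp (- total_rate x * h)) * f x"
    unfolding a_def nn_integral_less_holding[OF h, symmetric] by (rule nn_integral_multc[OF am])
  finally have "(\<E> \<kappa>. f (state_at E h (x, \<kappa>))) \<le>
      (ennreal (exp (- total_rate x * h)) * f x + ennreal (p x) * jump_op f x) +
      (\<E> \<kappa>. G (holding (x, \<kappa>)) (after_event E (x, \<kappa>)))" .
  also have "\<dots> \<le> (ennreal (exp (- total_rate x * h)) * f x + ennreal (total_rate x * h) * jump_op f x) +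
      ennreal ((rate_bound * h)\<^sup>2)"
    by (intro add_mono mult_right_mono ennreal_leI p_le intG order_refl) auto
  finally show ?thesis .
qed

definition mass_integral :: "(('c, 's) state \<Rightarrow> ennreal) \<Rightarrow> ennreal" where
  "mass_integral f = (\<S> x. ennreal (mass x) * f x)"

definition total_mass :: ennreal where
  "total_mass = (\<S> x. ennreal (mass x))"

definition semigroup :: "real \<Rightarrow> (('c, 's) state \<Rightarrow> ennreal) \<Rightarrow> ('c, 's) state \<Rightarrow> ennreal" where
  "semigroup t f x = (\<E> \<kappa>. f (state_at E t (x, \<kappa>)))"

lemma semigroup_add: "0 \<le> t \<Longrightarrow> 0 \<le> s \<Longrightarrow> semigroup (t + s) f = semigroup t (semigroup s f)"
  unfolding semigroup_def by (intro ext nn_integral_state_at_add)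

lemma semigroup_le_1:
  assumes "\<And>x. f x \<le> 1"
  shows "semigroup t f x \<le> 1"
proof -
  have "semigroup t f x \<le> (\<E> \<kappa>. 1)"
    unfolding semigroup_def by (intro nn_integral_mono assms)
  then show ?thesis by (simp add: emeasure_clock_law_UNIV)
qed

text \<open>The balance equations tested against an arbitrary function.\<close>

lemma mass_integral_jump_op:
  assumes compatible: "\<And>s. \<exists>c. (s, c) \<in> E" and served: "\<And>c. \<exists>s. (s, c) \<in> E"
  shows "mass_integral (\<lambda>x. ennreal (total_rate x) * jump_op f x) = mass_integral (\<lambda>x. ennreal (total_rate x) * f x)"
proof -
  have jm: "ennreal (mass x) * (ennreal (total_rate x) * a) = jump_mass x * a" for x a
    by (simp add: jump_mass_def ennreal_mult mult.assoc)
  have "mass_integral (\<lambda>x. ennreal (total_rate x) * jump_op f x) =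
      (\<S> x. (\<S> y. jump_mass x * kern x y * f y))"
    unfolding mass_integral_def jm nn_integral_kern[symmetric]
    by (intro nn_integral_cong) (simp add: nn_integral_cmult[symmetric] mult.assoc)
  also have "\<dots> = (\<S> y. (\<S> x. jump_mass x * kern x y * f y))"
    by (rule nn_integral_count_space_swap)
  also have "\<dots> = (\<S> y. jump_mass y * f y)"
    by (simp add: nn_integral_multc jump_mass_invariant[OF assms])
  finally show ?thesis unfolding mass_integral_def jm .
qed

text \<open>In the short-time bound the balance equations replace \<open>jump_op f\<close> by
  \<open>f\<close>. The coefficient of \<open>f\<close> is then \<open>exp (- u) + u\<close> with
  \<open>u = total_rate x * h\<close>, hence at most 1 up to second order. The factor 2 adds this
  error to that of several events.\<close>

lemma mass_integral_small_time:
  assumes compatible: "\<And>s. \<exists>c. (s, c) \<in> E" and served: "\<And>c. \<exists>s. (s, c) \<in> E"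
    and h: "0 \<le> h" and f: "\<And>x. f x \<le> 1"
  shows "mass_integral (semigroup h f) \<le> mass_integral f + ennreal (2 * (rate_bound * h)\<^sup>2) * total_mass"
proof -
  let ?C = "ennreal ((rate_bound * h)\<^sup>2)"
  have meas: "g \<in> borel_measurable (count_space UNIV)" for g :: "('c, 's) state \<Rightarrow> ennreal"
    by simp
  have "mass_integral (semigroup h f) \<le> (\<S> x. (ennreal (mass x) * (ennreal (exp (- total_rate x * h)) * f x) +
      ennreal h * (ennreal (mass x) * (ennreal (total_rate x) * jump_op f x))) + ?C * ennreal (mass x))"
    unfolding mass_integral_def
  proof (rule nn_integral_mono)
    fix x
    have "ennreal (mass x) * semigroup h f x \<le> ennreal (mass x) *
        (ennreal (exp (- total_rate x * h)) * f x + ennreal (total_rate x * h) * jump_op f x + ?C)"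
      unfolding semigroup_def by (intro mult_left_mono small_time_bound h f) simp
    also have "ennreal (total_rate x * h) = ennreal (total_rate x) * ennreal h"
      by (rule ennreal_mult) (simp_all add: h)
    finally show "ennreal (mass x) * semigroup h f x \<le> (ennreal (mass x) * (ennreal (exp (- total_rate x * h)) * f x) +
      ennreal h * (ennreal (mass x) * (ennreal (total_rate x) * jump_op f x))) + ?C * ennreal (mass x)"
      by (simp add: distrib_left mult_ac)
  qed
  also have "\<dots> = (\<S> x. ennreal (mass x) * (ennreal (exp (- total_rate x * h)) * f x)) +
      ennreal h * mass_integral (\<lambda>x. ennreal (total_rate x) * jump_op f x) + ?C * total_mass"
    unfolding mass_integral_def total_mass_def
    by (simp only: nn_integral_add[OF meas meas] nn_integral_cmult[OF meas])
  also have "\<dots> = (\<S> x. (ennreal (mass x) * (ennreal (exp (- total_rate x * h)) * f x) +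
      ennreal h * (ennreal (mass x) * (ennreal (total_rate x) * f x))) + ?C * ennreal (mass x))"
    unfolding mass_integral_jump_op[OF assms(1,2)] unfolding mass_integral_def total_mass_def
    by (simp only: nn_integral_add[OF meas meas] nn_integral_cmult[OF meas])
  also have "\<dots> \<le> (\<S> x. ennreal (mass x) * f x + ennreal (2 * (rate_bound * h)\<^sup>2) * ennreal (mass x))"
  proof (rule nn_integral_mono)
    fix x
    let ?u = "total_rate x * h"
    have u: "0 \<le> ?u" "?u \<le> rate_bound * h"
      using h mult_right_mono[OF total_rate_le h, of x] by simp_all
    have "exp (- ?u) + ?u \<le> 1 + (rate_bound * h)\<^sup>2"
      using exp_minus_le[OF u(1)] power_mono[OF u(2) u(1), of 2] by linarith
    then have "ennreal (exp (- total_rate x * h)) + ennreal ?u \<le> 1 + ?C"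
      using u(1) by (simp add: ennreal_plus[symmetric] del: ennreal_plus)
                    (metis ennreal_1 ennreal_leI ennreal_plus zero_le_one zero_le_power2)
    then have "(ennreal (exp (- total_rate x * h)) + ennreal ?u) * f x \<le> (1 + ?C) * f x"
      by (rule mult_right_mono) simp
    also have "\<dots> \<le> f x + ?C"
      using mult_left_mono[OF f[of x], of ?C] by (simp add: distrib_right add_left_mono)
    finally have "ennreal (mass x) * ((ennreal (exp (- total_rate x * h)) + ennreal ?u) * f x) + ?C * ennreal (mass x) \<le>
        ennreal (mass x) * (f x + ?C) + ?C * ennreal (mass x)"
      by (intro add_right_mono mult_left_mono) simp_all
    moreover have "ennreal (2 * (rate_bound * h)\<^sup>2) = ?C + ?C"
      by (simp add: ennreal_plus[symmetric] del: ennreal_plus)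
    moreover have "ennreal ?u = ennreal h * ennreal (total_rate x)"
      using h by (simp add: ennreal_mult mult.commute)
    ultimately show "(ennreal (mass x) * (ennreal (exp (- total_rate x * h)) * f x) +
      ennreal h * (ennreal (mass x) * (ennreal (total_rate x) * f x))) + ?C * ennreal (mass x) \<le>
      ennreal (mass x) * f x + ennreal (2 * (rate_bound * h)\<^sup>2) * ennreal (mass x)"
      by (simp add: distrib_left distrib_right mult_ac add_ac)
  qed
  also have "\<dots> = mass_integral f + ennreal (2 * (rate_bound * h)\<^sup>2) * total_mass"
    unfolding mass_integral_def total_mass_def
    by (simp only: nn_integral_add[OF meas meas] nn_integral_cmult[OF meas])
  finally show ?thesis .
qed

text \<open>Cutting \<open>[0, t]\<close> into \<open>n\<close> steps, the errors of the preceding lemma add up to order \<open>1/n\<close>.\<close>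

lemma mass_subinvariant:
  assumes compatible: "\<And>s. \<exists>c. (s, c) \<in> E" and served: "\<And>c. \<exists>s. (s, c) \<in> E"
    and fin: "total_mass < \<infinity>" and t: "0 \<le> t" and f: "\<And>x. f x \<le> 1"
  shows "mass_integral (semigroup t f) \<le> mass_integral f"
proof -
  obtain Z where Z: "total_mass = ennreal Z" "0 \<le> Z"
    using fin by (cases total_mass rule: ennreal_cases) auto
  have steps: "mass_integral (semigroup (real n * h) f) \<le> mass_integral f + ennreal (real n * (2 * (rate_bound * h)\<^sup>2 * Z))"
    if h: "0 \<le> h" for n h
  proof (induct n)
    case 0
    have "semigroup 0 f = f"
    proof
      fix x
      have "semigroup 0 f x = (\<S> y. f x * indicator {x} y)"
        unfolding semigroup_def nn_integral_state_at
        by (intro nn_integral_cong) (auto simp: trans_prob_0 indicator_def)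
      then show "semigroup 0 f x = f x" by (simp add: nn_integral_cmult)
    qed
    then show ?case by simp
  next
    case (Suc n)
    have "semigroup (real (Suc n) * h) f = semigroup h (semigroup (real n * h) f)"
      using semigroup_add[of h "real n * h" f] h by (simp add: algebra_simps)
    then have "mass_integral (semigroup (real (Suc n) * h) f) =
        mass_integral (semigroup h (semigroup (real n * h) f))" by simp
    also have "\<dots> \<le> mass_integral (semigroup (real n * h) f) + ennreal (2 * (rate_bound * h)\<^sup>2) * total_mass"
      by (rule mass_integral_small_time[OF assms(1,2) h semigroup_le_1[OF f]])
    also have "\<dots> \<le> mass_integral f + ennreal (real n * (2 * (rate_bound * h)\<^sup>2 * Z)) + ennreal (2 * (rate_bound * h)\<^sup>2 * Z)"
      using Suc Z by (intro add_mono) (simp_all add: ennreal_mult'')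
    also have "\<dots> = mass_integral f + ennreal (real (Suc n) * (2 * (rate_bound * h)\<^sup>2 * Z))"
      using Z(2) by (simp add: add.assoc ennreal_plus[symmetric] algebra_simps del: ennreal_plus)
    finally show ?case .
  qed
  define C where "C = 2 * (rate_bound * t)\<^sup>2 * Z"
  have bound: "mass_integral (semigroup t f) \<le> mass_integral f + ennreal (C / real (Suc n))" for n
  proof -
    have "real (Suc n) * (2 * (rate_bound * (t / real (Suc n)))\<^sup>2 * Z) = C / real (Suc n)"
      by (simp add: C_def power2_eq_square divide_simps del: of_nat_Suc)
    then show ?thesis
      using steps[of "t / real (Suc n)" "Suc n"] t by simp
  qed
  have "(\<lambda>n. C / real (Suc n)) \<longlonglongrightarrow> 0"
    using LIMSEQ_Suc[OF lim_const_over_n[of C]] .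
  then have "(\<lambda>n. ennreal (C / real (Suc n))) \<longlonglongrightarrow> ennreal 0"
    by (rule tendsto_ennrealI)
  then have "(\<lambda>n. mass_integral f + ennreal (C / real (Suc n))) \<longlonglongrightarrow> mass_integral f + ennreal 0"
    by (intro tendsto_add tendsto_const)
  then show ?thesis
    using bound by (intro LIMSEQ_le_const[where X="\<lambda>n. mass_integral f + ennreal (C / real (Suc n))"]) auto
qed

section \<open>Invariant measures of the transition function and their uniqueness\<close>

definition push :: "real \<Rightarrow> (('c, 's) state \<Rightarrow> ennreal) \<Rightarrow> ('c, 's) state \<Rightarrow> ennreal" where
  "push t a y = (\<S> x. a x * ennreal (trans_prob t x y))"

lemma nn_integral_push: "(\<S> y. push t a y) = (\<S> x. a x)"
proof -
  have "(\<S> y. ennreal (trans_prob t x y)) = 1" for x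
    using nn_integral_state_at[of "\<lambda>_. 1" t x] by (simp add: emeasure_clock_law_UNIV)
  then show ?thesis
    unfolding push_def by (subst nn_integral_count_space_swap) (simp add: nn_integral_cmult)
qed

lemma push_mono: "(\<And>x. a x \<le> b x) \<Longrightarrow> push t a y \<le> push t b y"
  unfolding push_def by (intro nn_integral_mono mult_right_mono) auto

text \<open>\<open>push\<close> preserves the total mass, so a finite measure that it increases
  nowhere cannot decrease anywhere either.\<close>

lemma push_eqI:
  assumes "\<And>y. push t a y \<le> a y" "(\<S> x. a x) < \<infinity>"
  shows "push t a y = a y"
  by (rule nn_integral_count_space_eqD[where f="push t a"]) (use assms nn_integral_push in auto)

lemma push_mass:
  assumes compatible: "\<And>s. \<exists>c. (s, c) \<in> E" and served: "\<And>c. \<exists>s. (s, c) \<in> E"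
    and fin: "total_mass < \<infinity>" and t: "0 \<le> t"
  shows "push t (\<lambda>x. ennreal (mass x)) y = ennreal (mass y)"
proof (rule push_eqI)
  fix y
  \<comment> \<open>Testing with the indicator of \<open>y\<close> turns the bound for functions
    into one for measures.\<close>
  have "semigroup t (\<lambda>z. of_bool (z = y)) x = ennreal (trans_prob t x y)" for x
    unfolding semigroup_def by (rule nn_integral_of_bool_state_at)
  then have "push t (\<lambda>x. ennreal (mass x)) y = mass_integral (semigroup t (\<lambda>z. of_bool (z = y)))"
    unfolding push_def mass_integral_def by simp
  also have "\<dots> \<le> mass_integral (\<lambda>z. of_bool (z = y))"
    by (rule mass_subinvariant[OF assms]) simp
  also have "\<dots> = (\<S> z. ennreal (mass y) * indicator {y} z)"
    unfolding mass_integral_def by (intro nn_integral_cong) (auto simp: indicator_def)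
  also have "\<dots> = ennreal (mass y)" by (simp add: nn_integral_cmult)
  finally show "push t (\<lambda>x. ennreal (mass x)) y \<le> ennreal (mass y)" .
qed (use fin in \<open>simp add: total_mass_def\<close>)

text \<open>The image of the minimum \<open>w\<close> is below both measures, hence below
  \<open>w\<close>, so \<open>w\<close> is invariant and with it \<open>v = a - w\<close>. If
  \<open>v\<close> were nonzero somewhere, irreducibility would make it positive on all states; then
  \<open>b < a\<close> there, against the equality of the total masses.\<close>

lemma push_invariant_unique:
  assumes irr: "\<And>x y. x \<in> states E \<Longrightarrow> y \<in> states E \<Longrightarrow> \<exists>t\<ge>0. 0 < trans_prob t x y"
    and a: "\<And>t y. 0 \<le> t \<Longrightarrow> push t a y = a y" and b: "\<And>t y. 0 \<le> t \<Longrightarrow> push t b y = b y"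
    and mass: "(\<S> x. a x) = 1" "(\<S> x. b x) = 1"
    and supp: "\<And>x. x \<notin> states E \<Longrightarrow> a x = 0" "\<And>x. x \<notin> states E \<Longrightarrow> b x = 0"
  shows "a x = b x"
proof -
  define w where "w x = min (a x) (b x)" for x
  define v where "v x = a x - w x" for x
  have w_le: "w x \<le> a x" "w x \<le> b x" for x by (simp_all add: w_def)
  have fin_a: "a x < \<infinity>" for x
  proof -
    have "a x \<le> (\<S> x. a x)" by (rule nn_integral_ge_point) simp
    then show ?thesis using mass(1) by (auto simp: le_less_trans)
  qed
  have fin_w: "(\<S> x. w x) < \<infinity>"
  proof -
    have "(\<S> x. w x) \<le> (\<S> x. a x)"
      by (intro nn_integral_mono w_le)
    then show ?thesis using mass(1) by (auto simp: le_less_trans)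
  qed
  have w: "push t w y = w y" if "0 \<le> t" for t y
  proof (rule push_eqI[OF _ fin_w])
    fix y
    show "push t w y \<le> w y"
      unfolding w_def[of y] using push_mono[of w a t y] push_mono[of w b t y] w_le a[OF that] b[OF that] by simp
  qed
  have a_eq: "a x = v x + w x" for x
    unfolding v_def using w_le by (simp add: diff_add_cancel_ennreal)
  have v: "push t v y = v y" if "0 \<le> t" for t y
  proof -
    have "push t a y = push t v y + push t w y"
      unfolding push_def a_eq by (simp add: distrib_right nn_integral_add)
    then have "v y + w y = push t v y + w y"
      unfolding a[OF that] w[OF that] a_eq .
    moreover have "w y \<noteq> \<infinity>" using w_le(1)[of y] fin_a[of y] by (auto simp: top_unique)
    ultimately show ?thesis by (simp add: ennreal_add_left_cancel add.commute[of _ "w y"])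
  qed
  have v_zero: "v x = 0" for x
  proof (rule ccontr)
    assume vx: "v x \<noteq> 0"
    then have x: "x \<in> states E" using supp(1)[of x] a_eq[of x] by auto
    have "v y \<noteq> 0" if y: "y \<in> states E" for y
    proof -
      obtain t where t: "0 \<le> t" "0 < trans_prob t x y" using irr[OF x y] by blast
      have "v x * ennreal (trans_prob t x y) \<le> push t v y"
        unfolding push_def by (rule nn_integral_ge_point) simp
      moreover have "0 < v x * ennreal (trans_prob t x y)"
        using vx t(2) by (simp add: ennreal_zero_less_mult_iff zero_less_iff_neq_zero)
      ultimately show ?thesis using v[OF t(1)] by auto
    qed
    then have lt: "b y < a y" if "y \<in> states E" for y
    proof -
      have "v y \<noteq> 0" by (rule \<open>\<And>y. y \<in> states E \<Longrightarrow> v y \<noteq> 0\<close>[OF that])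
      then have "w y \<noteq> a y" using fin_a[of y] by (auto simp: v_def)
      then show ?thesis by (auto simp: w_def min_def split: if_splits)
    qed
    then have "b y \<le> a y" for y
      using supp(2)[of y] less_imp_le[OF lt[of y]] by (cases "y \<in> states E") simp_all
    then have "b x = a x"
      by (rule nn_integral_count_space_eqD) (simp_all add: mass)
    with lt[OF x] show False by simp
  qed
  then have "a x \<le> b x" for x using a_eq[of x] w_le(2)[of x] by simp
  then show ?thesis
    by (rule nn_integral_count_space_eqD) (simp_all add: mass)
qed

lemma nn_integral_states_indicator:
  "(\<integral>\<^sup>+ x. f x \<partial>count_space (states E)) = (\<S> x. f x * indicator (states E) x)"
  by (rule nn_integral_count_space_indicator) simp

lemma stationary_distribution_iff_push:
  "stationary_distribution (states E) trans_prob \<pi> \<longleftrightarrow>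
    (\<forall>x\<in>states E. 0 \<le> \<pi> x) \<and>
    (\<S> x. ennreal (\<pi> x) * indicator (states E) x) = 1 \<and>
    (\<forall>t\<ge>0. \<forall>y. push t (\<lambda>x. ennreal (\<pi> x) * indicator (states E) x) y = ennreal (\<pi> y) * indicator (states E) y)"
proof (cases "\<forall>x\<in>states E. 0 \<le> \<pi> x")
  case True
  have 1: "(\<pi> has_sum 1) (states E) \<longleftrightarrow> (\<S> x. ennreal (\<pi> x) * indicator (states E) x) = 1"
    using True by (subst nonneg_has_sum_iff_nn_integral) (simp_all add: nn_integral_states_indicator)
  have 2: "((\<lambda>x. \<pi> x * trans_prob t x y) has_sum \<pi> y) (states E) \<longleftrightarrow>
      push t (\<lambda>x. ennreal (\<pi> x) * indicator (states E) x) y = ennreal (\<pi> y) * indicator (states E) y"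
    if y: "y \<in> states E" for t y
  proof -
    have "((\<lambda>x. \<pi> x * trans_prob t x y) has_sum \<pi> y) (states E) \<longleftrightarrow>
        (\<S> x. ennreal (\<pi> x * trans_prob t x y) * indicator (states E) x) = ennreal (\<pi> y)"
      using True y by (subst nonneg_has_sum_iff_nn_integral) (simp_all add: nn_integral_states_indicator)
    also have "(\<S> x. ennreal (\<pi> x * trans_prob t x y) * indicator (states E) x) =
        push t (\<lambda>x. ennreal (\<pi> x) * indicator (states E) x) y"
      unfolding push_def using True
      by (intro nn_integral_cong) (auto simp: indicator_def ennreal_mult)
    finally show ?thesis using y by simp
  qed
  \<comment> \<open>Outside the state space both sides are 0, so the quantifier over
    \<open>y\<close> may range over the whole type.\<close>
  have 3: "push t (\<lambda>x. ennreal (\<pi> x) * indicator (states E) x) y = ennreal (\<pi> y) * indicator (states E) y"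
    if y: "y \<notin> states E" for t y
  proof -
    have "push t (\<lambda>x. ennreal (\<pi> x) * indicator (states E) x) y =
        (\<integral>\<^sup>+ x. 0 \<partial>(count_space UNIV :: ('c, 's) state measure))"
      unfolding push_def by (intro nn_integral_cong) (auto simp: indicator_def trans_prob_outside y)
    then show ?thesis using y by simp
  qed
  show ?thesis
    unfolding stationary_distribution_def 1 using True 2 3 by (metis (no_types, lifting))
next
  case False
  show ?thesis
    unfolding stationary_distribution_def by (simp only: False simp_thms)
qed

theorem stationary_distribution_iff:
  assumes compatible: "\<And>s. \<exists>c. (s, c) \<in> E"
    and irr: "irreducible_chain (states E) trans_prob"
    and cond: "\<And>C. C \<noteq> {} \<Longrightarrow> sum lam C < sum mu (servers_of E C)"
  shows "\<exists>Z>0. \<forall>\<pi>. stationary_distribution (states E) trans_prob \<pi> \<longleftrightarrow> (\<forall>x\<in>states E. \<pi> x = form x / Z)"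
proof -
  have served: "\<And>c. \<exists>s. (s, c) \<in> E" by (rule served_of_irreducible[OF irr])
  have fin: "total_mass < \<infinity>"
    unfolding total_mass_def by (rule mass_summable[OF cond])
  then obtain Z where Z: "total_mass = ennreal Z" "0 \<le> Z"
    by (cases total_mass rule: ennreal_cases) auto
  \<comment> \<open>The state with nobody waiting and no server idle has weight 1, an empty product;
    so the normalising constant is positive.\<close>
  have "ennreal (mass ([], [])) \<le> ennreal Z"
    unfolding Z(1)[symmetric] total_mass_def by (rule nn_integral_ge_point) simp
  moreover have "mass ([], []) = 1" by (simp add: mass_def states_def form_eq)
  ultimately have Z1: "1 \<le> Z" using Z(2) by (simp add: ennreal_le_iff)
  then have Zpos: "0 < Z" by simp
  define b where "b x = ennreal (1 / Z) * ennreal (mass x)" for x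
  have b_eq: "b x = ennreal (form x / Z) * indicator (states E) x" for x
    using Zpos by (auto simp: b_def mass_def indicator_def ennreal_mult'[symmetric])
  have b_mass: "(\<S> x. b x) = 1"
  proof -
    have "(\<S> x. b x) = ennreal (1 / Z) * total_mass"
      unfolding b_def total_mass_def by (rule nn_integral_cmult) simp
    also have "\<dots> = ennreal (1 / Z * Z)"
      unfolding Z(1) by (rule ennreal_mult[symmetric]) (use Zpos in auto)
    finally show ?thesis using Zpos by simp
  qed
  have b_push: "push t b y = b y" if t: "0 \<le> t" for t y
  proof -
    have "push t b y = ennreal (1 / Z) * push t (\<lambda>x. ennreal (mass x)) y"
      unfolding push_def b_def by (simp add: nn_integral_cmult mult.assoc)
    then show ?thesis using push_mass[OF compatible served fin t] by (simp add: b_def)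
  qed
  have irr': "\<exists>t\<ge>0. 0 < trans_prob t x y" if "x \<in> states E" "y \<in> states E" for x y
    using irr that by (simp add: irreducible_chain_def)
  have "stationary_distribution (states E) trans_prob \<pi> \<longleftrightarrow> (\<forall>x\<in>states E. \<pi> x = form x / Z)" for \<pi>
  proof
    define a where "a x = ennreal (\<pi> x) * indicator (states E) x" for x
    assume "stationary_distribution (states E) trans_prob \<pi>"
    then have \<pi>: "\<forall>x\<in>states E. 0 \<le> \<pi> x" and a_mass: "(\<S> x. a x) = 1"
      and a_push: "\<And>t y. 0 \<le> t \<Longrightarrow> push t a y = a y"
      unfolding stationary_distribution_iff_push a_def[symmetric] by blast+
    have "a x = b x" for x
      by (rule push_invariant_unique[OF irr' a_push b_push a_mass b_mass]) (simp_all add: a_def b_eq)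
    then have eq: "ennreal (\<pi> x) * indicator (states E) x = ennreal (form x / Z) * indicator (states E) x" for x
      unfolding a_def b_eq .
    show "\<forall>x\<in>states E. \<pi> x = form x / Z"
    proof
      fix x assume x: "x \<in> states E"
      then have "ennreal (\<pi> x) = ennreal (form x / Z)" using eq[of x] by simp
      then show "\<pi> x = form x / Z" using \<pi> x Zpos by (subst (asm) ennreal_inj) auto
    qed
  next
    assume \<pi>: "\<forall>x\<in>states E. \<pi> x = form x / Z"
    then have eq: "(\<lambda>x. ennreal (\<pi> x) * indicator (states E) x) = b"
      by (auto simp: fun_eq_iff b_eq indicator_def)
    show "stationary_distribution (states E) trans_prob \<pi>"
      unfolding stationary_distribution_iff_push eq
    proof (intro conjI ballI allI impI)
      show "0 \<le> \<pi> x" if "x \<in> states E" for x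
        using that \<pi> Zpos by simp
      show "push t b y = ennreal (\<pi> y) * indicator (states E) y" if "0 \<le> t" for t y
        using b_push[OF that] fun_cong[OF eq, of y] by simp
    qed (rule b_mass)
  qed
  then show ?thesis using Zpos by blast
qed

end

theorem theorem2p3:
  fixes E :: "('s::finite \<times> 'c::finite) set"
    and lam :: "'c \<Rightarrow> real" and mu :: "'s \<Rightarrow> real"
    and M :: "'w measure"
    and A :: "'c \<Rightarrow> nat \<Rightarrow> 'w \<Rightarrow> real" and B :: "'s \<Rightarrow> nat \<Rightarrow> 'w \<Rightarrow> real"
  assumes compatible: "\<And>s. \<exists>c. (s, c) \<in> E"
    and lam_pos: "\<And>c. 0 < lam c" and mu_pos: "\<And>s. 0 < mu s"
    and prob: "prob_space M"
    and interarrival: "\<And>c n. distributed M lborel (A c n) (exponential_density (lam c))"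
    and service: "\<And>s n. distributed M lborel (B s n) (exponential_density (mu s))"
    and indep: "prob_space.indep_vars M (\<lambda>_. borel)
      (\<lambda>j. case j of Inl (c, n) \<Rightarrow> A c n | Inr (s, n) \<Rightarrow> B s n) UNIV"
  shows
    "(\<forall>x\<in>states E. markov_chain M (states E) (transition_prob M (fcfs_alis E A B)) (fcfs_alis E A B x)) \<and>
     (ergodic M (states E) (fcfs_alis E A B) \<longleftrightarrow>
        (\<forall>C. C \<noteq> {} \<longrightarrow> sum lam C < sum mu (servers_of E C))) \<and>
     (ergodic M (states E) (fcfs_alis E A B) \<longrightarrow>
        (\<exists>Z>0. \<forall>\<pi>.
           stationary_distribution (states E) (transition_prob M (fcfs_alis E A B)) \<pi> \<longleftrightarrow>
           (\<forall>x\<in>states E. \<pi> x = product_form E lam mu x / Z)))"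
proof -
  interpret prob_space M by (rule prob)
  interpret driven_queue E lam mu M A B
    by unfold_locales (fact lam_pos mu_pos interarrival service indep)+
  show ?thesis
  proof (intro conjI ballI impI)
    show "markov_chain M (states E) (transition_prob M X) (X x)" if "x \<in> states E" for x
      using that by (rule markov_chain_X)
    show "ergodic M (states E) X \<longleftrightarrow> (\<forall>C. C \<noteq> {} \<longrightarrow> sum lam C < sum mu (servers_of E C))"
      by (rule ergodic_iff[OF compatible])
    assume erg: "ergodic M (states E) X"
    then have "irreducible_chain (states E) trans_prob"
      by (simp add: ergodic_def transition_prob_eq)
    then show "\<exists>Z>0. \<forall>\<pi>. stationary_distribution (states E) (transition_prob M X) \<pi> \<longleftrightarrow>
        (\<forall>x\<in>states E. \<pi> x = product_form E lam mu x / Z)"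
      unfolding transition_prob_eq
      by (rule stationary_distribution_iff[OF compatible])
         (use erg ergodic_iff[OF compatible] in simp)
  qed
qed

end
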